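(* For all $t, v\in [0,1]$ and $j\in\{0,1\}$, $$\lim_{s\to \infty}\mathbb{P}\left(\sqrt{\frac{\log U_s}{\log s}}\leq t,\ \frac{U_s}{U_s+O_s}\leq v,\ \mathbf{1}_{2\mathbb{N}}(N_s)=j\right)=\frac{1}{2}tv^2.$$
   Context: Let $\{\Theta_n\}_{n\ge 1}$ be i.i.d. random variables with density $\frac12\cos\theta$ on $(-\pi/2,\pi/2)$ (and $0$ elsewhere), and let $X_n=\tan\Theta_n$; equivalently, $X_n$ are i.i.d. with distribution function $\frac12+\frac{x}{2\sqrt{1+x^2}}$, $x\in\mathbb{R}$. Let $S_0=0$, $S_n=S_{n-1}+X_n$ for $n\ge1$. For $s>0$ let $N_s=\inf\{n>0: S_n>s\}$ (finite almost surely), $O_s=S_{N_s}-s$ (overshoot) and $U_s=s-S_{N_s-1}$ (undershoot). $\mathbf{1}_{2\mathbb{N}}(N_s)$ equals $1$ if $N_s$ is even and $0$ if $N_s$ is odd. Convention: if $\log U_s/\log s<0$ (with $s>1$) the square root is read as $0$, so that $\{\sqrt{\log U_s/\log s}\le t\}=\{U_s\le s^{t^2}\}$. *)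

theory Defs
  imports "HOL-Probability.Probability"
begin

definition angle_density :: "real \<Rightarrow> real" where
  "angle_density \<theta> = (if - (pi / 2) < \<theta> \<and> \<theta> < pi / 2 then cos \<theta> / 2 else 0)"

definition tan_step :: "(nat \<Rightarrow> 'a \<Rightarrow> real) \<Rightarrow> nat \<Rightarrow> 'a \<Rightarrow> real" where
  "tan_step \<Theta> n \<omega> = tan (\<Theta> n \<omega>)"

definition walk :: "(nat \<Rightarrow> 'a \<Rightarrow> real) \<Rightarrow> nat \<Rightarrow> 'a \<Rightarrow> real" where
  "walk X n \<omega> = (\<Sum>k=1..n. X k \<omega>)"

(* Inf of the empty set of naturals is 0, so passage_time takes the junk value 0 on the event
   that the walk never exceeds s; for the walk considered here this event is null. *)
definition passage_time :: "(nat \<Rightarrow> 'a \<Rightarrow> real) \<Rightarrow> real \<Rightarrow> 'a \<Rightarrow> nat" where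
  "passage_time X s \<omega> = Inf {n. n > 0 \<and> walk X n \<omega> > s}"

definition overshoot :: "(nat \<Rightarrow> 'a \<Rightarrow> real) \<Rightarrow> real \<Rightarrow> 'a \<Rightarrow> real" where
  "overshoot X s \<omega> = walk X (passage_time X s \<omega>) \<omega> - s"

definition undershoot :: "(nat \<Rightarrow> 'a \<Rightarrow> real) \<Rightarrow> real \<Rightarrow> 'a \<Rightarrow> real" where
  "undershoot X s \<omega> = s - walk X (passage_time X s \<omega> - 1) \<omega>"

(* The square root of log u / log s, read as 0 when the ratio is negative. The truncation is
   explicit because the library's sqrt is odd. Since ln 0 = 0, the value at u = 0 is also 0,
   in accordance with log 0 being minus infinity. *)
definition sqrt_log_ratio :: "real \<Rightarrow> real \<Rightarrow> real" where
  "sqrt_log_ratio s u = sqrt (max 0 (ln u / ln s))"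

lemma sqrt_log_ratio_le_iff:
  assumes "s > 1" "u \<ge> 0" "t \<ge> 0"
  shows "sqrt_log_ratio s u \<le> t \<longleftrightarrow> u \<le> s powr (t\<^sup>2)"
proof (cases "u = 0")
  case True
  then show ?thesis using assms by (simp add: sqrt_log_ratio_def)
next
  case False
  with assms have u: "u > 0" by simp
  have "sqrt_log_ratio s u \<le> t \<longleftrightarrow> max 0 (ln u / ln s) \<le> t\<^sup>2"
    unfolding sqrt_log_ratio_def using assms
    by (metis real_sqrt_le_iff real_sqrt_abs abs_of_nonneg)
  also have "\<dots> \<longleftrightarrow> ln u \<le> t\<^sup>2 * ln s"
    using assms by (simp add: divide_le_eq)
  also have "\<dots> \<longleftrightarrow> ln u \<le> ln (s powr (t\<^sup>2))"
    using assms by (simp add: ln_powr)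
  also have "\<dots> \<longleftrightarrow> u \<le> s powr (t\<^sup>2)"
    using assms by (intro ln_le_cancel_iff[OF u]) simp
  finally show ?thesis .
qed

end

theory Submission
  imports Defs "HOL-Real_Asymp.Real_Asymp"
begin

text \<open>
  Look at the walk from the barrier: the heights \<open>s - S\<^sub>n\<close> form, by symmetry of the steps, a walk with the
  same step law started at \<open>s\<close> and killed when it leaves the half line \<open>[0, \<infinity>)\<close>. The undershoot \<open>U\<close> is
  the last height before killing, and \<open>U + O\<close> is the jump that kills. Let \<open>K\<close> be the kernel of the
  killed walk (\<open>kill_op\<close>) and \<open>F(x) = P(X > x)\<close> (\<open>step_tail\<close>), so that \<open>F(x)\<close> is about \<open>1/(4x\<^sup>2)\<close>. The
  probability of being killed in step \<open>n + 1\<close> with \<open>U \<le> w\<close> and \<open>U \<le> v(U + O)\<close> is \<open>(K\<^sup>n \<Psi>)(s)\<close> with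
  \<open>\<Psi>(u) = 1[u \<le> w] P(X > u, u \<le> v X)\<close> (\<open>prob_exit_step\<close>). The theorem is therefore a statement about the
  sums \<open>\<Sum> K\<^sup>n \<Psi> (s)\<close> and \<open>\<Sum> (-1)\<^sup>n K\<^sup>n \<Psi> (s)\<close>, and three mechanisms decide it.

  The law of \<open>U\<close> comes from the borderline variance of the steps, which is about \<open>ln x\<close> after
  truncation at \<open>x\<close>. For a slowly varying
  \<open>h(x) = \<phi>(l)\<close>, \<open>l = ln (1 + x) / T\<close>, the diffusive part of \<open>K h - h\<close> is about \<open>(1/2) ln x h''(x)\<close>, which
  equals \<open>- 2 l \<phi>'(l) F(x)\<close> to leading order, and killing contributes \<open>- \<phi>(l) F(x)\<close>. Hence
  \<open>h - K h = (\<phi> + 2 l \<phi>') F + O(F / T)\<close> (\<open>log_profile_generator\<close>). Since \<open>\<Sum> K\<^sup>n F \<le> 1\<close>, being the total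
  probability of getting killed, summation gives \<open>\<Sum> K\<^sup>n((\<phi> + 2 l \<phi>') F)(s) = \<phi>(ln (1 + s) / T) + O(1 / T)\<close>
  (\<open>green_potential\<close>): the expectation of \<open>r = \<phi> + 2 l \<phi>'\<close> at \<open>ln U / T\<close>. The equation \<open>r = \<phi> + 2 l \<phi>'\<close> is
  solved by the average of \<open>r(l m\<^sup>2)\<close> over \<open>m\<close> in \<open>[0, 1]\<close>, so \<open>ln U / ln s\<close> becomes the square of a
  uniform variable. The explicit pair \<open>\<phi>(y) = (1 + y\<^sup>n) powr (- 1/(2n))\<close>,
  \<open>r(y) = (1 + y\<^sup>n) powr (- 1/(2n) - 1)\<close> turns this into a proof: \<open>r\<close> tends to the indicator of \<open>y < 1\<close>
  as \<open>n\<close> grows, and squeezing gives \<open>P(U \<le> s powr \<tau>) \<longlonglongrightarrow> sqrt \<tau>\<close> (\<open>green_below_limit\<close>). For \<open>\<tau> = 1\<close> this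
  also shows that the barrier is passed with probability tending to one.

  For the ratio, note that given \<open>U = u\<close> the killing jump is a step conditioned to exceed \<open>u\<close>, so the ratio is at
  most \<open>v > 0\<close> with probability \<open>F(u / v) / F(u)\<close>, which tends to \<open>v\<^sup>2\<close> as \<open>u\<close> grows; and \<open>U\<close> tends to infinity
  in probability by the case of small \<open>\<tau>\<close> (\<open>green_exit_reward_limit\<close>).

  The parity is handled by a contraction. The alternating sum \<open>g\<close> satisfies \<open>K g = \<Psi> - g\<close>. Two steps of the walk dominate a fixed
  multiple \<open>c > 0\<close> of one step. If \<open>|g| \<le> \<beta>\<close> far out, then comparing \<open>K(\<beta> \<plusminus> g)\<close> with \<open>K\<^sup>2(\<beta> \<plusminus> g)\<close> yields
  \<open>|g| \<le> \<beta> / (1 + c)\<close> further out (\<open>parity_bound_contract\<close>). So \<open>g\<close> vanishes at infinity, uniformly in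
  \<open>\<Psi>\<close>, and even and odd \<open>n\<close> contribute equally.
\<close>

section \<open>The step law\<close>

definition step_density :: "real \<Rightarrow> real" where
  "step_density y = 1 / (2 * (1 + y\<^sup>2) * sqrt (1 + y\<^sup>2))"

text \<open>
  The law of \<open>tan \<Theta>\<close>; see \<open>tan_step_law\<close>.
\<close>

definition step_law :: "real measure" where
  "step_law = density lborel (\<lambda>y. ennreal (step_density y))"

definition step_tail :: "real \<Rightarrow> real" where
  "step_tail x = (1 - x / sqrt (1 + x\<^sup>2)) / 2"

lemma one_plus_square_pos [simp]:
  "0 < 1 + (x::real)\<^sup>2" "1 + (x::real)\<^sup>2 \<noteq> 0" "\<not> 1 + (x::real)\<^sup>2 < 0"
  "0 < 2 + 2 * (x::real)\<^sup>2" "2 + 2 * (x::real)\<^sup>2 \<noteq> 0" "\<not> 2 + 2 * (x::real)\<^sup>2 < 0"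
  by (smt (verit) zero_le_power2)+

lemma step_density_nonneg [simp]: "0 \<le> step_density y"
  by (simp add: step_density_def)

lemma step_density_measurable [measurable]: "step_density \<in> borel_measurable borel"
  unfolding step_density_def by measurable

lemma sets_step_law [simp, measurable_cong]: "sets step_law = sets borel"
  and space_step_law [simp]: "space step_law = UNIV"
  by (auto simp: step_law_def)

lemma DERIV_unit_root:
  "((\<lambda>y. y / sqrt (1 + y\<^sup>2)) has_real_derivative 2 * step_density x) (at x)"
proof -
  have s: "sqrt (1 + x\<^sup>2) * sqrt (1 + x\<^sup>2) = 1 + x\<^sup>2" by simp
  have "((\<lambda>y. y / sqrt (1 + y\<^sup>2)) has_real_derivative
     (1 * sqrt (1 + x\<^sup>2) - x * (2 * x / (2 * sqrt (1 + x\<^sup>2)))) / (sqrt (1 + x\<^sup>2) * sqrt (1 + x\<^sup>2))) (at x)"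
    by (auto intro!: derivative_eq_intros simp: field_simps)
  also have "(1 * sqrt (1 + x\<^sup>2) - x * (2 * x / (2 * sqrt (1 + x\<^sup>2)))) = 1 / sqrt (1 + x\<^sup>2)"
  proof -
    define w where "w = sqrt (1 + x\<^sup>2)"
    have "w > 0" "w * w = 1 + x * x" using s by (simp_all add: w_def flip: power2_eq_square)
    then show ?thesis unfolding w_def[symmetric] by (simp add: divide_simps)
  qed
  moreover have "1 / r / p = 2 * (1 / (2 * p * r))" for p r :: real by simp
  ultimately show ?thesis unfolding s step_density_def by metis
qed

lemma DERIV_step_tail: "(step_tail has_real_derivative - step_density x) (at x)"
proof -
  have "((\<lambda>x. (1 - x / sqrt (1 + x\<^sup>2)) / 2) has_real_derivative (0 - 2 * step_density x) / 2) (at x)"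
    by (intro DERIV_cdivide DERIV_diff DERIV_const DERIV_unit_root)
  then show ?thesis by (simp add: step_tail_def[abs_def])
qed

lemma step_tail_alt: "step_tail x = 1 / (2 * sqrt (1 + x\<^sup>2) * (sqrt (1 + x\<^sup>2) + x))"
proof -
  have s: "sqrt (1 + x\<^sup>2) * sqrt (1 + x\<^sup>2) = 1 + x\<^sup>2" by simp
  have "\<bar>x\<bar> < sqrt (1 + x\<^sup>2)" by (metis less_add_one add.commute real_sqrt_abs real_sqrt_less_iff)
  then have "sqrt (1 + x\<^sup>2) + x > 0" by linarith
  moreover have "sqrt (1 + x\<^sup>2) > 0" by simp
  moreover have "(sqrt (1 + x\<^sup>2) - x) * (sqrt (1 + x\<^sup>2) + x) = 1"
    using s by (simp add: algebra_simps power2_eq_square)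
  ultimately show ?thesis unfolding step_tail_def by (simp add: divide_simps)
qed

lemma step_tail_at_top: "(step_tail \<longlongrightarrow> 0) at_top"
  unfolding step_tail_def by real_asymp

lemma step_tail_at_bot: "(step_tail \<longlongrightarrow> 1) at_bot"
  unfolding step_tail_def by real_asymp

lemma step_tail_minus: "step_tail (- x) = 1 - step_tail x"
  by (simp add: step_tail_def field_simps)

lemma emeasure_step_law_greaterThan: "emeasure step_law {x<..} = ennreal (step_tail x)"
proof -
  have "emeasure step_law {x<..} = (\<integral>\<^sup>+y. ennreal (step_density y) * indicator {x<..} y \<partial>lborel)"
    by (simp add: step_law_def emeasure_density)
  also have "\<dots> = (\<integral>\<^sup>+y. ennreal (step_density y) * indicator {x..} y \<partial>lborel)"
    using AE_lborel_singleton[of x] by (intro nn_integral_cong_AE) (auto simp: indicator_def elim!: eventually_mono)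
  also have "\<dots> = ennreal (0 - (- step_tail x))"
  proof (rule nn_integral_FTC_atLeast)
    show "((\<lambda>x. - step_tail x) \<longlongrightarrow> 0) at_top" using tendsto_minus[OF step_tail_at_top] by simp
    show "DERIV (\<lambda>x. - step_tail x) y :> step_density y" for y
      using DERIV_minus[OF DERIV_step_tail[of y]] by simp
  qed auto
  finally show ?thesis by simp
qed

lemma step_law_reflect: "distr step_law borel uminus = step_law"
proof -
  have "distr step_law borel uminus = density lborel (\<lambda>y. ennreal (step_density y))"
  proof -
    have "density (distr lborel lborel uminus) (\<lambda>y. ennreal (step_density y)) =
        distr (density lborel (\<lambda>y. ennreal (step_density (- y)))) lborel uminus"
      by (rule density_distr) auto
    then show ?thesis
      by (simp add: step_law_def lborel_distr_uminus step_density_def cong: distr_cong)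
  qed
  then show ?thesis by (simp add: step_law_def)
qed

lemma prob_space_step_law: "prob_space step_law"
proof
  have "((\<lambda>n::nat. emeasure step_law {- real n <..}) \<longlongrightarrow> emeasure step_law (\<Union>n. {- real n <..})) sequentially"
    by (rule Lim_emeasure_incseq) (auto simp: incseq_def)
  moreover have "(\<Union>n. {- real n <..}) = UNIV"
    by (auto intro: ) (metis minus_less_iff reals_Archimedean2)
  moreover have "((\<lambda>n::nat. ennreal (step_tail (- real n))) \<longlongrightarrow> ennreal 1) sequentially"
    by (intro tendsto_ennrealI filterlim_compose[OF step_tail_at_bot]) real_asymp
  ultimately show "emeasure step_law (space step_law) = 1"
    using LIMSEQ_unique by (fastforce simp: emeasure_step_law_greaterThan)
qed

interpretation step_law: prob_space step_law by (rule prob_space_step_law)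

lemma step_tail_pos: "0 < step_tail x"
proof -
  have "\<bar>x\<bar> < sqrt (1 + x\<^sup>2)" by (metis less_add_one add.commute real_sqrt_abs real_sqrt_less_iff)
  then have "sqrt (1 + x\<^sup>2) + x > 0" by linarith
  then show ?thesis by (simp add: step_tail_alt)
qed

lemma step_tail_nonneg [simp]: "0 \<le> step_tail x" using step_tail_pos[of x] by simp

lemma measure_step_law_greaterThan: "measure step_law {x<..} = step_tail x"
  by (simp add: measure_def emeasure_step_law_greaterThan)

lemma step_tail_le_1: "step_tail x \<le> 1"
  using step_law.prob_le_1[of "{x<..}"] by (simp add: measure_step_law_greaterThan)

lemma step_law_singleton: "emeasure step_law {x} = 0"
  by (simp add: step_law_def emeasure_density nn_integral_null_delta null_setsI )
   
lemma integral_step_law: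
  fixes g :: "real \<Rightarrow> real"
  assumes [measurable]: "g \<in> borel_measurable borel"
  shows "(\<integral>y. g y \<partial>step_law) = (\<integral>y. step_density y * g y \<partial>lborel)"
  by (simp add: step_law_def integral_density)

lemma integral_step_law_reflect:
  fixes g :: "real \<Rightarrow> real"
  assumes [measurable]: "g \<in> borel_measurable borel"
  shows "(\<integral>y. g (- y) \<partial>step_law) = (\<integral>y. g y \<partial>step_law)"
  using integral_distr[of uminus step_law borel g] by (simp add: step_law_reflect)

lemma measure_step_law_atLeast: "measure step_law {x..} = step_tail x"
proof -
  have "{x..} = insert x {x<..}" by auto
  then show ?thesis
    using step_law.finite_measure_Union[of "{x}" "{x<..}"]
    by (simp add: measure_step_law_greaterThan measure_def[of step_law "{x}"] step_law_singleton)
qed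

text \<open>
  The second bound is sharp to first order: the drift estimate below multiplies the error by
  \<open>ln (1 + x)\<close>, which the extra power of \<open>1 + x\<close> absorbs. The scale
  \<open>1 + x\<close> instead of \<open>x\<close> keeps the bounds valid down to \<open>x =
  0\<close>.
\<close>

lemma step_tail_bounds:
  assumes "0 \<le> x"
  shows "1 / (4 * (1 + x)\<^sup>2) \<le> step_tail x" "step_tail x \<le> 1 / (4 * (1 + x)\<^sup>2) + 2 / (1 + x) ^ 3"
proof -
  define w where "w = sqrt (1 + x\<^sup>2)"
  have w2: "w * w = 1 + x * x" by (simp add: w_def power2_eq_square)
  have w1: "x \<le> w" "w \<le> 1 + x" "0 < w"
    using assms unfolding w_def
    by (auto simp: power2_sum intro!: real_le_rsqrt real_le_lsqrt)
  have p: "w * (w + x) > 0" using w1 assms by auto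
  have T: "step_tail x = 1 / (2 * (w * (w + x)))" by (simp add: step_tail_alt w_def mult.assoc)
  have up: "w * (w + x) \<le> 2 * (1 + x)\<^sup>2"
    using mult_mono[of w "1+x" "w+x" "2*(1+x)"] w1 assms by (simp add: power2_eq_square algebra_simps)
  then show "1 / (4 * (1 + x)\<^sup>2) \<le> step_tail x"
    unfolding T using p assms w1 by (intro divide_left_mono mult_pos_pos) auto
  have lo: "2 * (x * x) \<le> w * (w + x)" using mult_mono[of x w "2*x" "w+x"] w1 assms by simp
  have lo2: "(1 + x)\<^sup>2 \<le> 2 * (w * (w + x))"
  proof -
    have "(1+x)\<^sup>2 \<le> 2 * (w * w)" using w2 sum_squares_bound[of 1 x] by (simp add: power2_eq_square algebra_simps)
    also have "\<dots> \<le> 2 * (w * (w + x))" using w1 assms by (intro mult_left_mono) auto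
    finally show ?thesis .
  qed
  define a where "a = 1 + x"
  define q where "q = w * (w + x)"
  have a: "a \<ge> 1" using assms by (simp add: a_def)
  have q: "q > 0" "2 * (a - 1)^2 \<le> q" "a\<^sup>2 \<le> 2 * q" using p lo lo2 by (auto simp: q_def a_def power2_eq_square)
  have "1 / (2 * q) - 1 / (4 * a\<^sup>2) = (2 * a\<^sup>2 - q) / (4 * a\<^sup>2 * q)"
    using q a by (simp add: field_simps)
  also have "\<dots> \<le> (4 * a) / (4 * a\<^sup>2 * q)"
    using q a by (intro divide_right_mono) (auto simp: power2_eq_square algebra_simps)
  also have "\<dots> = 1 / (a * q)" using a q by (simp add: field_simps power2_eq_square)
  also have "\<dots> \<le> 1 / (a * (a\<^sup>2 / 2))"
    using q a by (intro divide_left_mono mult_left_mono mult_pos_pos) auto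
  also have "\<dots> = 2 / a ^ 3" using a by (simp add: field_simps power2_eq_square power3_eq_cube)
  finally show "step_tail x \<le> 1 / (4 * (1 + x)\<^sup>2) + 2 / (1 + x) ^ 3"
    unfolding T q_def[symmetric] a_def[symmetric] by linarith
qed

section \<open>Truncated moments of the step law\<close>

lemma has_bochner_integral_step_law:
  fixes g :: "real \<Rightarrow> real"
  assumes "g \<in> borel_measurable borel" "has_bochner_integral lborel (\<lambda>y. step_density y * g y) I"
  shows "has_bochner_integral step_law g I"
  unfolding step_law_def using assms
  by (intro has_bochner_integral_density) auto

lemma has_bochner_integral_step_law_Icc:
  fixes g :: "real \<Rightarrow> real"
  assumes "a \<le> b" and [measurable]: "g \<in> borel_measurable borel"
    and "\<And>y. a \<le> y \<Longrightarrow> y \<le> b \<Longrightarrow> (F has_real_derivative step_density y * g y) (at y)"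
    and "\<And>y. a \<le> y \<Longrightarrow> y \<le> b \<Longrightarrow> isCont g y"
  shows "has_bochner_integral step_law (\<lambda>y. indicator {a..b} y * g y) (F b - F a)"
proof (rule has_bochner_integral_step_law)
  have "isCont step_density y" for y
    unfolding step_density_def[abs_def] by (intro continuous_intros) auto
  then have "has_bochner_integral lborel (\<lambda>y. (step_density y * g y) * indicator {a..b} y) (F b - F a)"
    using assms by (intro has_bochner_integral_FTC_Icc_real continuous_intros) auto
  then show "has_bochner_integral lborel (\<lambda>y. step_density y * (indicator {a..b} y * g y)) (F b - F a)"
    by (simp add: mult_ac)
qed measurable

definition truncated_moment2 :: "real \<Rightarrow> real" where
  "truncated_moment2 b = arsinh b - b / sqrt (1 + b\<^sup>2)"

lemma has_bochner_integral_truncated_moment2: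
  assumes "0 \<le> b"
  shows "has_bochner_integral step_law (\<lambda>y. indicator {-b..b} y * y\<^sup>2) (truncated_moment2 b)"
proof -
  let ?F = "\<lambda>y::real. (arsinh y - y / sqrt (1 + y\<^sup>2)) / 2"
  have "(?F has_real_derivative step_density y * y\<^sup>2) (at y)" for y
  proof -
    have "(?F has_real_derivative (1 / sqrt (y\<^sup>2 + 1) - 2 * step_density y) / 2) (at y)"
      by (intro DERIV_cdivide DERIV_diff DERIV_unit_root) (rule derivative_eq_intros refl | simp)+
    also have "(1 / sqrt (y\<^sup>2 + 1) - 2 * step_density y) / 2 = step_density y * y\<^sup>2"
      by (simp add: step_density_def divide_simps add.commute)
    finally show ?thesis .
  qed
  then have "has_bochner_integral step_law (\<lambda>y. indicator {-b..b} y * y\<^sup>2) (?F b - ?F (-b))"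
    using assms by (intro has_bochner_integral_step_law_Icc) auto
  also have "?F b - ?F (-b) = truncated_moment2 b"
  proof -
    have "arsinh (- b) = - arsinh b" "- b / sqrt (1 + (- b)\<^sup>2) = - (b / sqrt (1 + b\<^sup>2))"
      by (auto simp: arsinh_minus_real)
    moreover have "(p - q) / 2 - (- p - - q) / 2 = p - q" for p q :: real by (simp add: field_simps)
    ultimately show ?thesis unfolding truncated_moment2_def by (simp only:)
  qed
  finally show ?thesis .
qed

text \<open>
  The truncated variance grows like the logarithm. This is the source of the logarithmic scale in
  the theorem. With \<open>b = x / 2\<close> the logarithm is exactly \<open>ln (1 + x)\<close>.
\<close>

lemma truncated_moment2_bounds:
  assumes "0 \<le> b"
  shows "ln (1 + 2 * b) - 2 \<le> truncated_moment2 b" "truncated_moment2 b \<le> ln (1 + 2 * b)"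
proof -
  define w where "w = sqrt (1 + b\<^sup>2)"
  have w: "1 \<le> w" "w \<le> 1 + b" "b \<le> w"
    using assms by (auto simp: w_def power2_sum intro!: real_le_rsqrt real_le_lsqrt)
  have q: "0 \<le> b / w" "b / w \<le> 1" using w assms by (auto simp: divide_simps)
  have A: "arsinh b = ln (b + w)" by (simp add: arsinh_real_def w_def add.commute)
  have "arsinh b \<le> ln (1 + 2 * b)" unfolding A using w assms by (intro ln_mono) auto
  then show "truncated_moment2 b \<le> ln (1 + 2 * b)"
    using q unfolding truncated_moment2_def w_def[symmetric] by linarith
  have "ln (1 + 2 * b) \<le> ln (2 * (b + w))" using w assms by (intro ln_mono) auto
  also have "\<dots> = ln 2 + arsinh b" unfolding A using w assms by (intro ln_mult_pos) auto
  also have "ln (2::real) \<le> 1" using ln_le_minus_one[of "2::real"] by simp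
  finally show "ln (1 + 2 * b) - 2 \<le> truncated_moment2 b"
    using q unfolding truncated_moment2_def w_def[symmetric] by linarith
qed

lemma step_density_cube_le: "\<bar>y\<bar> ^ 3 * step_density y \<le> 1 / 2"
proof -
  have "\<bar>y\<bar> \<le> sqrt (1 + y\<^sup>2)" by (metis add_increasing order_refl real_sqrt_abs real_sqrt_le_iff zero_le_one)
  then have "\<bar>y\<bar>\<^sup>2 * \<bar>y\<bar> \<le> (1 + y\<^sup>2) * sqrt (1 + y\<^sup>2)" by (intro mult_mono) auto
  then have "\<bar>y\<bar> ^ 3 \<le> (1 + y\<^sup>2) * sqrt (1 + y\<^sup>2)" by (simp only: power3_eq_cube power2_eq_square)
  then have "\<bar>y\<bar> ^ 3 / ((1 + y\<^sup>2) * sqrt (1 + y\<^sup>2)) \<le> 1" by (subst divide_le_eq_1) auto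
  moreover have "a * (1 / (2 * p * r)) = a / (p * r) / 2" for a p r :: real by simp
  ultimately show ?thesis unfolding step_density_def by (metis divide_right_mono zero_le_numeral)
qed

text \<open>
  The density is at most \<open>1 / (2 |y|\<^sup>3)\<close>, so the integrand is at most \<open>b
  / 2\<close> on an interval of length \<open>2 b\<close>.
\<close>

lemma truncated_moment4_le:
  assumes "0 \<le> b"
  shows "integrable step_law (\<lambda>y. indicator {-b..b} y * y ^ 4)"
    "(\<integral>y. indicator {-b..b} y * y ^ 4 \<partial>step_law) \<le> b\<^sup>2"
proof -
  show "integrable step_law (\<lambda>y. indicator {-b..b} y * y ^ 4)"
  proof (rule step_law.integrable_const_bound[where B = "b ^ 4"])
    have "y ^ 4 \<le> b ^ 4" if "-b \<le> y" "y \<le> b" for y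
      using power_mono[of "\<bar>y\<bar>" b 4] that assms by (auto simp: abs_le_iff power_even_abs)
    then show "AE y in step_law. norm (indicator {- b..b} y * y ^ 4) \<le> b ^ 4"
      using assms by (auto simp: indicator_def)
  qed simp
  have "(\<integral>y. indicator {-b..b} y * y ^ 4 \<partial>step_law)
      = (\<integral>y. step_density y * (indicator {-b..b} y * y ^ 4) \<partial>lborel)"
    by (intro integral_step_law) simp
  also have "\<dots> \<le> (\<integral>y. b / 2 * indicator {-b..b} y \<partial>lborel)"
  proof (rule integral_mono_AE')
    have "step_density y * y ^ 4 \<le> b / 2" if "\<bar>y\<bar> \<le> b" for y
    proof -
      have "step_density y * y ^ 4 = \<bar>y\<bar> * (\<bar>y\<bar> ^ 3 * step_density y)"
        by (simp add: power_even_abs flip: power_Suc mult.assoc)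
      also have "\<dots> \<le> b * (1 / 2)" using that by (intro mult_mono step_density_cube_le) auto
      finally show ?thesis by simp
    qed
    then show "AE y in lborel. step_density y * (indicator {- b..b} y * y ^ 4) \<le> b / 2 * indicator {-b..b} y"
      by (auto simp: indicator_def abs_le_iff)
  qed (auto intro!: integrable_real_mult_indicator AE_I2 simp: assms)
  also have "\<dots> = b\<^sup>2" using assms by (simp add: power2_eq_square)
  finally show "(\<integral>y. indicator {-b..b} y * y ^ 4 \<partial>step_law) \<le> b\<^sup>2" .
qed

lemma has_bochner_integral_tail_moment1:
  assumes "0 \<le> b"
  shows "has_bochner_integral step_law (\<lambda>y. indicator {b..} y * y) (1 / (2 * sqrt (1 + b\<^sup>2)))"
proof (intro has_bochner_integral_step_law has_bochner_integral_nn_integral)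
  have "(\<integral>\<^sup>+y. ennreal (step_density y * y) * indicator {b..} y \<partial>lborel)
      = ennreal (0 - - (1 / (2 * sqrt (1 + b\<^sup>2))))"
  proof (rule nn_integral_FTC_atLeast)
    fix y :: real assume "b \<le> y"
    show "((\<lambda>b. - (1 / (2 * sqrt (1 + b\<^sup>2)))) has_real_derivative step_density y * y) (at y)"
    proof -
      have s: "sqrt (1 + y\<^sup>2) * sqrt (1 + y\<^sup>2) = 1 + y\<^sup>2" by simp
      have "((\<lambda>b. - (1 / (2 * sqrt (1 + b\<^sup>2)))) has_real_derivative
         y / (2 * (sqrt (1 + y\<^sup>2) * (sqrt (1 + y\<^sup>2) * sqrt (1 + y\<^sup>2))))) (at y)"
        by (auto intro!: derivative_eq_intros simp: divide_simps simp del: real_sqrt_mult_self)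
      moreover have "y / (2 * (r * p)) = 1 / (2 * p * r) * y" for p r :: real by simp
      ultimately show ?thesis unfolding s step_density_def by metis
    qed
    show "0 \<le> step_density y * y" using assms \<open>b \<le> y\<close> by simp
  next
    show "((\<lambda>b::real. - (1 / (2 * sqrt (1 + b\<^sup>2)))) \<longlongrightarrow> 0) at_top" by real_asymp
  qed simp
  moreover have "ennreal (step_density y * (indicator {b..} y * y))
      = ennreal (step_density y * y) * indicator {b..} y" for y
    by (auto simp: indicator_def)
  ultimately show "(\<integral>\<^sup>+y. ennreal (step_density y * (indicator {b..} y * y)) \<partial>lborel)
      = ennreal (1 / (2 * sqrt (1 + b\<^sup>2)))"
    by simp
next
  show "AE y in lborel. 0 \<le> step_density y * (indicator {b..} y * y)"
    using assms by (auto simp: indicator_def)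
qed auto

text \<open>
  Jumps that end close to the barrier have a large logarithmic effect. They have length of order
  \<open>x\<close>, where the density is of order \<open>1 / x\<^sup>3\<close>, and the square
  root growth towards the barrier is integrable on that scale, so together they contribute only
  \<open>O(1 / x\<^sup>2)\<close>.
\<close>

lemma near_barrier_le:
  assumes "0 \<le> x"
  shows "integrable step_law (\<lambda>y. indicator {-x..-(x/2)} y * sqrt ((1 + x) / (1 + x + y)))"
    "(\<integral>y. indicator {-x..-(x/2)} y * sqrt ((1 + x) / (1 + x + y)) \<partial>step_law)
      \<le> (1 + x) / ((1 + (x/2)\<^sup>2) * sqrt (1 + (x/2)\<^sup>2))"
proof -
  let ?g = "\<lambda>y. indicator {-x..-(x/2)} y * sqrt ((1 + x) / (1 + x + y))"
  define c where "c = 1 / (2 * (1 + (x/2)\<^sup>2) * sqrt (1 + (x/2)\<^sup>2))"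
  have c: "c > 0" by (simp add: c_def)
  show "integrable step_law ?g"
  proof (rule step_law.integrable_const_bound[where B = "sqrt (1 + x)"])
    show "AE y in step_law. norm (?g y) \<le> sqrt (1 + x)"
      using assms by (auto simp: indicator_def real_sqrt_divide divide_simps intro!: AE_I2)
  qed simp
  have I: "has_bochner_integral lborel (\<lambda>y. sqrt ((1 + x) / (1 + x + y)) * indicator {-x..-(x/2)} y)
     (2 * sqrt (1 + x) * sqrt (1 + x + - (x/2)) - 2 * sqrt (1 + x) * sqrt (1 + x + - x))"
  proof (rule has_bochner_integral_FTC_Icc_real)
    fix y assume "-x \<le> y" "y \<le> -(x/2)"
    then have p: "1 + x + y > 0" by linarith
    show "((\<lambda>y. 2 * sqrt (1 + x) * sqrt (1 + x + y)) has_real_derivative sqrt ((1 + x) / (1 + x + y))) (at y)"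
      using p by (auto intro!: derivative_eq_intros simp: real_sqrt_divide field_simps)
    show "isCont (\<lambda>y. sqrt ((1 + x) / (1 + x + y))) y"
      using p by (auto intro!: continuous_intros)
  qed (use assms in auto)
  have "(\<integral>y. ?g y \<partial>step_law) = (\<integral>y. step_density y * ?g y \<partial>lborel)"
    by (intro integral_step_law) simp
  also have "\<dots> \<le> (\<integral>y. c * (sqrt ((1 + x) / (1 + x + y)) * indicator {-x..-(x/2)} y) \<partial>lborel)"
  proof (rule integral_mono_AE')
    have "step_density y \<le> c" if "y \<le> -(x/2)" for y
    proof -
      have "(x/2)\<^sup>2 \<le> y\<^sup>2" using power_mono[of "x/2" "-y" 2] that assms by simp
      then show ?thesis unfolding step_density_def c_def
        by (intro divide_left_mono mult_mono) auto
    qed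
    then show "AE y in lborel. step_density y * ?g y \<le> c * (sqrt ((1 + x) / (1 + x + y)) * indicator {-x..-(x/2)} y)"
      using assms by (auto simp: indicator_def intro!: mult_right_mono AE_I2)
    show "AE y in lborel. 0 \<le> c * (sqrt ((1 + x) / (1 + x + y)) * indicator {-x..-(x/2)} y)"
      using assms c by (auto simp: indicator_def intro!: AE_I2)
  qed (use I in \<open>auto simp: has_bochner_integral_iff\<close>)
  also have "\<dots> = c * (2 * sqrt (1 + x) * sqrt (1 + x / 2) - 2 * sqrt (1 + x))"
    using I by (simp add: has_bochner_integral_iff)
  also have "\<dots> \<le> c * (2 * sqrt (1 + x) * sqrt (1 + x))"
  proof (intro mult_left_mono)
    have "2 * sqrt (1 + x) * sqrt (1 + x / 2) \<le> 2 * sqrt (1 + x) * sqrt (1 + x)"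
      using assms by (intro mult_left_mono) auto
    then show "2 * sqrt (1 + x) * sqrt (1 + x / 2) - 2 * sqrt (1 + x) \<le> 2 * sqrt (1 + x) * sqrt (1 + x)"
      using real_sqrt_ge_zero[of "1 + x"] assms by linarith
  qed (use c in simp)
  also have "\<dots> = (1 + x) / ((1 + (x/2)\<^sup>2) * sqrt (1 + (x/2)\<^sup>2))"
  proof -
    have "2 * sqrt (1 + x) * sqrt (1 + x) = 2 * (1 + x)" using assms by (simp add: mult.assoc)
    moreover have "1 / (2 * p * r) * (2 * a) = a / (p * r)" for p r a :: real by simp
    ultimately show ?thesis unfolding c_def by metis
  qed
  finally show "(\<integral>y. ?g y \<partial>step_law) \<le> (1 + x) / ((1 + (x/2)\<^sup>2) * sqrt (1 + (x/2)\<^sup>2))" .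
qed

section \<open>One jump on the logarithmic scale\<close>

lemma inverse_square_le_step_tail:
  assumes "0 \<le> x" shows "1 / (1 + x)\<^sup>2 \<le> 4 * step_tail x"
  using step_tail_bounds(1)[OF assms] by simp

text \<open>
  Used to dominate both the logarithmic jump and its square near the barrier by the same
  integrable function.
\<close>

lemma abs_ln_le_sqrt: "\<bar>ln r\<bar> \<le> 16 * sqrt r" "(ln r)\<^sup>2 \<le> 16 * sqrt r" if "1 \<le> r" for r :: real
proof -
  have l0: "0 \<le> ln r" using that by simp
  have q: "1 \<le> sqrt (sqrt r)" using that by simp
  have "ln r = 4 * ln (sqrt (sqrt r))" using that by (simp add: ln_sqrt)
  also have "\<dots> \<le> 4 * sqrt (sqrt r)" using ln_le_minus_one[of "sqrt (sqrt r)"] q by linarith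
  finally have A: "ln r \<le> 4 * sqrt (sqrt r)" .
  have "(ln r)\<^sup>2 \<le> (4 * sqrt (sqrt r))\<^sup>2" using A l0 by (intro power_mono) auto
  also have "\<dots> = 16 * sqrt r" using that by (simp add: power_mult_distrib)
  finally show "(ln r)\<^sup>2 \<le> 16 * sqrt r" .
  have "sqrt (sqrt r) \<le> sqrt (sqrt r) * sqrt (sqrt r)" using q by (intro mult_le_cancel_left1[THEN iffD2]) auto
  also have "\<dots> = sqrt r" using that by simp
  finally show "\<bar>ln r\<bar> \<le> 16 * sqrt r" using A l0 by linarith
qed

lemma ln_one_plus_sq_le: "(ln (1 + u))\<^sup>2 \<le> 4 * u" if "0 \<le> u" for u :: real
proof -
  have "ln (1 + u) = 2 * ln (sqrt (1 + u))" using that by (simp add: ln_sqrt)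
  also have "\<dots> \<le> 2 * (sqrt (1 + u) - 1)" using ln_le_minus_one[of "sqrt (1 + u)"] that by simp
  also have "sqrt (1 + u) \<le> 1 + sqrt u"
    using that by (intro real_le_lsqrt) (auto simp: power2_sum)
  finally have "ln (1 + u) \<le> 2 * sqrt u" by simp
  then have "(ln (1 + u))\<^sup>2 \<le> (2 * sqrt u)\<^sup>2" using that by (intro power_mono) auto
  then show ?thesis using that by (simp add: power_mult_distrib)
qed

lemma ln_shift:
  fixes x y :: real
  assumes "0 \<le> x" "0 \<le> x + y"
  shows "ln (1 + (x + y)) - ln (1 + x) = ln (1 + y / (1 + x))"
proof -
  have "1 + x \<noteq> 0" using assms by linarith
  then have "1 + y / (1 + x) = (1 + (x + y)) / (1 + x)" by (simp add: divide_simps)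
  then show ?thesis using assms by (simp add: ln_div)
qed

text \<open>
  The change of \<open>ln (1 + x)\<close> caused by a jump \<open>y\<close> that does not kill.
  The shift by one keeps the logarithm bounded at the barrier.
\<close>

definition log_jump :: "real \<Rightarrow> real \<Rightarrow> real" where
  "log_jump x y = indicator {0..} (x + y) * (ln (1 + (x + y)) - ln (1 + x))"

lemma log_jump_measurable [measurable]: "log_jump x \<in> borel_measurable borel"
  unfolding log_jump_def[abs_def] by measurable

text \<open>
  A common majorant of the logarithmic jump and its square outside \<open>|y| \<le> x / 2\<close>:
  linear for upward jumps, with square root growth for jumps towards the barrier.
\<close>

definition far_jump_bound :: "real \<Rightarrow> real \<Rightarrow> real" where
  "far_jump_bound x y = 4 / (1 + x) * (indicator {x/2..} y * y)
     + 16 * (indicator {-x..-(x/2)} y * sqrt ((1 + x) / (1 + x + y)))"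

lemma log_jump_far:
  assumes "0 \<le> x" "\<not> \<bar>y\<bar> \<le> x / 2"
  shows "\<bar>log_jump x y\<bar> \<le> far_jump_bound x y" "(log_jump x y)\<^sup>2 \<le> far_jump_bound x y"
proof -
  have "\<bar>log_jump x y\<bar> \<le> far_jump_bound x y \<and> (log_jump x y)\<^sup>2 \<le> far_jump_bound x y"
  proof (cases "x + y < 0")
    case True
    then have "log_jump x y = 0" "far_jump_bound x y = 0" using assms by (auto simp: log_jump_def far_jump_bound_def indicator_def)
    then show ?thesis by simp
  next
    case False
    then have J: "log_jump x y = ln (1 + y / (1 + x))"
      using assms by (simp add: log_jump_def ln_shift)
    show ?thesis
    proof (cases "0 \<le> y")
      case True
      then have y: "y > x / 2" using assms by auto
      have u: "0 \<le> y / (1 + x)" using assms True by simp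
      have "ln (1 + y / (1 + x)) \<le> y / (1 + x)" "0 \<le> ln (1 + y / (1 + x))"
        using u by (auto intro: ln_add_one_self_le_self)
      moreover have "far_jump_bound x y = 4 * (y / (1 + x))"
        using y assms by (simp add: far_jump_bound_def)
      ultimately show ?thesis unfolding J using ln_one_plus_sq_le[OF u] u by linarith
    next
      case y: False
      then have y2: "y < - (x / 2)" using assms by auto
      define r where "r = (1 + x) / (1 + x + y)"
      have r: "1 \<le> r" using False y unfolding r_def by (subst le_divide_eq_1) auto
      have "1 + y / (1 + x) = inverse r" using assms False by (simp add: r_def field_simps)
      then have "ln (1 + y / (1 + x)) = - ln r" using r by (simp add: ln_inverse)
      moreover have "far_jump_bound x y = 16 * sqrt r"
        using y2 y False assms by (simp add: far_jump_bound_def r_def)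
      ultimately show ?thesis unfolding J using abs_ln_le_sqrt[OF r] by simp
    qed
  qed
  then show "\<bar>log_jump x y\<bar> \<le> far_jump_bound x y" "(log_jump x y)\<^sup>2 \<le> far_jump_bound x y" by auto
qed

lemma far_jump_bound_nonneg: "0 \<le> x \<Longrightarrow> 0 \<le> far_jump_bound x y"
  by (auto simp: far_jump_bound_def indicator_def)

lemma far_jump_bound_integral:
  assumes "0 \<le> x"
  shows "integrable step_law (far_jump_bound x)"
    "(\<integral>y. far_jump_bound x y \<partial>step_law) \<le> 200 / (1 + x)\<^sup>2"
proof -
  have b: "0 \<le> x / 2" using assms by simp
  note I1 = has_bochner_integral_tail_moment1[OF b]
  note I2 = near_barrier_le[OF assms]
  show "integrable step_law (far_jump_bound x)"
    using I1 I2(1) unfolding far_jump_bound_def[abs_def] by (auto simp: has_bochner_integral_iff)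
  have "(\<integral>y. far_jump_bound x y \<partial>step_law) = 4 / (1 + x) * (1 / (2 * sqrt (1 + (x/2)\<^sup>2)))
     + 16 * (\<integral>y. indicator {-x..-(x/2)} y * sqrt ((1 + x) / (1 + x + y)) \<partial>step_law)"
    using I1 I2(1) unfolding far_jump_bound_def by (subst Bochner_Integration.integral_add) (auto simp: has_bochner_integral_iff)
  also have "\<dots> \<le> 4 / (1 + x) * (1 / (2 * sqrt (1 + (x/2)\<^sup>2)))
     + 16 * ((1 + x) / ((1 + (x/2)\<^sup>2) * sqrt (1 + (x/2)\<^sup>2)))"
    using I2(2) by (intro add_left_mono mult_left_mono) auto
  also have "\<dots> \<le> 200 / (1 + x)\<^sup>2"
  proof -
    define a where "a = 1 + x"
    define w where "w = sqrt (1 + (x/2)\<^sup>2)"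
    have a: "a \<ge> 1" using assms by (simp add: a_def)
    have ww: "1 + (x/2)\<^sup>2 = w * w" by (simp add: w_def)
    have w: "w > 0" by (simp add: w_def)
    have "a\<^sup>2 \<le> 5 * (w * w)"
      unfolding ww[symmetric] a_def using zero_le_power2[of "x / 2 - 2"] by (simp add: power2_eq_square algebra_simps)
    also have "\<dots> \<le> (9/4 * w)\<^sup>2" using w by (simp add: power2_eq_square)
    finally have aw: "a \<le> 9/4 * w" by (rule power2_le_imp_le) (use w in simp)
    have "4 / a * (1 / (2 * w)) \<le> 5 / a\<^sup>2"
    proof -
      have "4 / a * (1 / (2 * w)) = (2 * a / w) / a\<^sup>2" using a w by (simp add: field_simps power2_eq_square)
      also have "2 * a / w \<le> 5" using aw w by (simp add: divide_simps)
      finally show ?thesis using a by (simp add: divide_right_mono)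
    qed
    moreover have "16 * (a / ((w * w) * w)) \<le> 195 / a\<^sup>2"
    proof -
      have "a ^ 3 \<le> (9/4 * w) ^ 3" using aw a by (intro power_mono) auto
      moreover have "0 < w ^ 3" using w by simp
      moreover have "(9/4 * w) ^ 3 = 729 / 64 * w ^ 3" by (simp add: power_mult_distrib power_divide)
      ultimately have "16 * a ^ 3 \<le> 195 * w ^ 3" by linarith
      then have "16 * a ^ 3 / (w * w * w) \<le> 195" using w by (simp add: divide_simps power3_eq_cube)
      moreover have "16 * (a / ((w * w) * w)) = (16 * a ^ 3 / (w * w * w)) / a\<^sup>2"
        using a w by (simp add: field_simps power2_eq_square power3_eq_cube)
      ultimately show ?thesis by (metis divide_right_mono zero_le_power2)
    qed
    ultimately show ?thesis unfolding a_def[symmetric] w_def[symmetric] unfolding ww by linarith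
  qed
  finally show "(\<integral>y. far_jump_bound x y \<partial>step_law) \<le> 200 / (1 + x)\<^sup>2" .
qed

lemma log_jump_near:
  assumes "0 \<le> x" "\<bar>y\<bar> \<le> x / 2"
  shows "log_jump x y = ln (1 + y / (1 + x))" "\<bar>y / (1 + x)\<bar> \<le> 1 / 2"
    "\<bar>log_jump x y\<bar> \<le> 2 * \<bar>y / (1 + x)\<bar>"
proof -
  show 1: "log_jump x y = ln (1 + y / (1 + x))"
    using assms by (simp add: log_jump_def ln_shift abs_le_iff)
  define u where "u = y / (1 + x)"
  show u: "\<bar>y / (1 + x)\<bar> \<le> 1 / 2" using assms by (auto simp: field_simps abs_le_iff)
  have "\<bar>ln (1 + u) - u\<bar> \<le> 2 * u\<^sup>2" using u by (intro abs_ln_one_plus_x_minus_x_bound) (simp add: u_def)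
  also have "2 * u\<^sup>2 = (2 * \<bar>u\<bar>) * \<bar>u\<bar>" by (simp add: power2_eq_square)
  also have "\<dots> \<le> 1 * \<bar>u\<bar>" using u unfolding u_def[symmetric] by (intro mult_right_mono) linarith+
  finally show "\<bar>log_jump x y\<bar> \<le> 2 * \<bar>y / (1 + x)\<bar>" unfolding 1 u_def[symmetric] by linarith
qed

lemma log_jump_sq_bound:
  assumes "0 \<le> x"
  shows "(log_jump x y)\<^sup>2 \<le> 4 / (1 + x)\<^sup>2 * (indicator {-(x/2)..x/2} y * y\<^sup>2) + far_jump_bound x y"
proof (cases "\<bar>y\<bar> \<le> x / 2")
  case True
  have "(log_jump x y)\<^sup>2 = \<bar>log_jump x y\<bar>\<^sup>2" by simp
  also have "\<dots> \<le> (2 * \<bar>y / (1 + x)\<bar>)\<^sup>2"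
    using log_jump_near(3)[OF assms True] by (intro power_mono) auto
  also have "\<dots> = 4 / (1 + x)\<^sup>2 * y\<^sup>2" by (simp add: power_mult_distrib power_divide)
  also have "y\<^sup>2 = indicator {-(x/2)..x/2} y * y\<^sup>2" using True by (auto simp: abs_le_iff indicator_def)
  finally show ?thesis using far_jump_bound_nonneg[OF assms, of y] by linarith
next
  case False
  then show ?thesis using log_jump_far(2)[OF assms False] by (auto simp: indicator_def)
qed

text \<open>
  Small jumps contribute \<open>4 y\<^sup>2 / (1 + x)\<^sup>2\<close>, whose integral is the
  truncated variance divided by \<open>(1 + x)\<^sup>2\<close>; far jumps contribute less by a
  factor of \<open>ln (1 + x)\<close>.
\<close>

lemma log_jump_spread:
  assumes "0 \<le> x"
  shows "integrable step_law (\<lambda>y. (log_jump x y)\<^sup>2)"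
    "(\<integral>y. (log_jump x y)\<^sup>2 \<partial>step_law) \<le> 800 * (1 + ln (1 + x)) * step_tail x"
proof -
  have b: "0 \<le> x / 2" using assms by simp
  let ?g = "\<lambda>y. 4 / (1 + x)\<^sup>2 * (indicator {-(x/2)..x/2} y * y\<^sup>2) + far_jump_bound x y"
  note I1 = has_bochner_integral_truncated_moment2[OF b]
  note I2 = far_jump_bound_integral[OF assms]
  have Ig: "integrable step_law ?g" using I1 I2(1) by (auto simp: has_bochner_integral_iff)
  show I: "integrable step_law (\<lambda>y. (log_jump x y)\<^sup>2)"
    by (rule Bochner_Integration.integrable_bound[OF Ig])
       (use log_jump_sq_bound[OF assms] in \<open>auto intro!: AE_I2 order_trans[OF _ abs_ge_self]\<close>)
  have "(\<integral>y. (log_jump x y)\<^sup>2 \<partial>step_law) \<le> (\<integral>y. ?g y \<partial>step_law)"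
    using log_jump_sq_bound[OF assms] by (intro integral_mono I Ig) auto
  also have "\<dots> = 4 / (1 + x)\<^sup>2 * truncated_moment2 (x/2) + (\<integral>y. far_jump_bound x y \<partial>step_law)"
    using I1 I2(1) by (subst Bochner_Integration.integral_add) (auto simp: has_bochner_integral_iff)
  also have "\<dots> \<le> 4 / (1 + x)\<^sup>2 * ln (1 + x) + 200 / (1 + x)\<^sup>2"
    using truncated_moment2_bounds(2)[OF b] I2(2) assms by (intro add_mono mult_left_mono) auto
  also have "\<dots> = (4 * ln (1 + x) + 200) * (1 / (1 + x)\<^sup>2)" by (simp add: algebra_simps)
  also have "\<dots> \<le> (200 * ln (1 + x) + 200) * (4 * step_tail x)"
    using assms inverse_square_le_step_tail[OF assms] by (intro mult_mono) auto
  also have "\<dots> = 800 * (1 + ln (1 + x)) * step_tail x" by (simp add: algebra_simps)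
  finally show "(\<integral>y. (log_jump x y)\<^sup>2 \<partial>step_law) \<le> 800 * (1 + ln (1 + x)) * step_tail x" .
qed

lemma log_jump_integrable: "0 \<le> x \<Longrightarrow> integrable step_law (log_jump x)"
  by (rule step_law.square_integrable_imp_integrable) (auto intro: log_jump_spread)

text \<open>
  By symmetry the jumps \<open>y\<close> and \<open>-y\<close> are averaged, \<open>ln (1 + u) +
  ln (1 - u) = ln (1 - u\<^sup>2)\<close> with \<open>u = y / (1 + x)\<close>, so the first order
  cancels and the second moment appears with an error of fourth order.
\<close>

lemma log_jump_drift_near:
  assumes "0 \<le> x"
  shows "\<bar>(\<integral>y. indicator {-(x/2)..x/2} y * log_jump x y \<partial>step_law) + truncated_moment2 (x/2) / (2 * (1 + x)\<^sup>2)\<bar>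
    \<le> 1 / (1 + x)\<^sup>2"
proof -
  define a where "a = 1 + x"
  define b where "b = x / 2"
  have ab: "0 < a" "0 \<le> b" "b \<le> a" using assms by (auto simp: a_def b_def)
  let ?g = "\<lambda>y. indicator {-b..b} y * log_jump x y"
  have Ig: "integrable step_law ?g"
    using integrable_mult_indicator[OF _ log_jump_integrable[OF assms], of "{-b..b}"] by simp
  have refl: "(\<integral>y. ?g (-y) \<partial>step_law) = (\<integral>y. ?g y \<partial>step_law)"
    by (intro integral_step_law_reflect) measurable
  have Ig': "integrable step_law (\<lambda>y. ?g (-y))"
    using integrable_distr_eq[of uminus step_law borel ?g] Ig by (simp add: step_law_reflect)
  note I2 = has_bochner_integral_truncated_moment2[OF ab(2)]
  note I4 = truncated_moment4_le[OF ab(2)]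
  have pw: "\<bar>?g y + ?g (-y) + (indicator {-b..b} y * y\<^sup>2) / a\<^sup>2\<bar> \<le> 2 * (indicator {-b..b} y * y ^ 4) / a ^ 4" for y
  proof (cases "\<bar>y\<bar> \<le> b")
    case True
    define u where "u = y / a"
    have u: "\<bar>u\<bar> \<le> 1/2" using log_jump_near(2)[OF assms, of y] True by (simp add: b_def a_def u_def)
    have "\<bar>u\<bar>\<^sup>2 \<le> (1/2)\<^sup>2" using u by (intro power_mono) auto
    then have u2: "\<bar>- u\<^sup>2\<bar> \<le> 1/2" by (simp add: power2_eq_square)
    have "log_jump x y = ln (1 + u)" "log_jump x (-y) = ln (1 - u)"
      using log_jump_near(1)[OF assms, of y] log_jump_near(1)[OF assms, of "-y"] True
      by (simp_all add: b_def a_def u_def)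
    moreover have "ln (1 + u) + ln (1 - u) = ln (1 + - u\<^sup>2)"
      using u by (subst ln_mult_pos[symmetric]) (auto simp: algebra_simps power2_eq_square abs_le_iff)
    moreover have "\<bar>ln (1 + - u\<^sup>2) - - u\<^sup>2\<bar> \<le> 2 * (- u\<^sup>2)\<^sup>2"
      by (rule abs_ln_one_plus_x_minus_x_bound[OF u2])
    moreover have "y\<^sup>2 / a\<^sup>2 = u\<^sup>2" "y ^ 4 / a ^ 4 = (- u\<^sup>2)\<^sup>2" by (auto simp: u_def power_divide)
    moreover have "indicator {-b..b} y = (1::real)" "indicator {-b..b} (-y) = (1::real)"
      using True by (auto simp: indicator_def abs_le_iff)
    ultimately show ?thesis by simp
  next
    case False
    then show ?thesis by (auto simp: indicator_def)
  qed
  let ?h = "\<lambda>y. ?g y + ?g (-y) + (indicator {-b..b} y * y\<^sup>2) / a\<^sup>2"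
  have eq: "2 * (\<integral>y. ?g y \<partial>step_law) + truncated_moment2 b / a\<^sup>2 = (\<integral>y. ?h y \<partial>step_law)"
    using Ig Ig' I2 refl by (simp add: has_bochner_integral_iff)
  have "(\<integral>y. \<bar>?h y\<bar> \<partial>step_law) \<le> (\<integral>y. 2 * (indicator {-b..b} y * y ^ 4) / a ^ 4 \<partial>step_law)"
    using Ig Ig' I2 I4(1) pw by (intro integral_mono) (auto simp: has_bochner_integral_iff)
  then have "(\<integral>y. \<bar>?h y\<bar> \<partial>step_law) \<le> 2 / a ^ 4 * (\<integral>y. indicator {-b..b} y * y ^ 4 \<partial>step_law)"
    by simp
  with integral_abs_bound[of step_law ?h]
  have le: "\<bar>\<integral>y. ?h y \<partial>step_law\<bar> \<le> 2 / a ^ 4 * (\<integral>y. indicator {-b..b} y * y ^ 4 \<partial>step_law)"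
    by (rule order_trans)
  have "b\<^sup>2 \<le> a\<^sup>2" using ab by (intro power_mono) auto
  then have "2 / a ^ 4 * (\<integral>y. indicator {-b..b} y * y ^ 4 \<partial>step_law) \<le> 2 / a ^ 4 * a\<^sup>2"
    using I4(2) by (intro mult_left_mono) auto
  moreover have "2 / a ^ 4 * a\<^sup>2 = 2 / a\<^sup>2"
  proof -
    have "a ^ 4 = a\<^sup>2 * a\<^sup>2" by (simp flip: power_add)
    then show ?thesis using ab by (simp add: divide_simps)
  qed
  ultimately have "\<bar>2 * (\<integral>y. ?g y \<partial>step_law) + truncated_moment2 b / a\<^sup>2\<bar> / 2 \<le> 2 / a\<^sup>2 / 2"
    using le unfolding eq by (intro divide_right_mono) linarith+
  moreover have "\<bar>2 * p + q\<bar> / 2 = \<bar>p + q / 2\<bar>" for p q :: real by (simp add: abs_if field_simps)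
  ultimately show ?thesis unfolding a_def[symmetric] b_def[symmetric] by simp
qed

text \<open>
  The concavity of the logarithm produces the negative drift \<open>ln (1 + x) / (2 (1 +
  x)\<^sup>2)\<close>. It is expressed through the killing rate, since the two are of the same
  order up to the logarithm and it is their competition that determines the limit law.
\<close>

lemma log_jump_drift:
  assumes "0 \<le> x"
  shows "\<bar>(\<integral>y. log_jump x y \<partial>step_law) + 2 * ln (1 + x) * step_tail x\<bar> \<le> 1000 * step_tail x"
proof -
  define a where "a = 1 + x"
  have a: "1 \<le> a" using assms by (simp add: a_def)
  have b: "0 \<le> x / 2" using assms by simp
  let ?near = "\<lambda>y. indicator {-(x/2)..x/2} y * log_jump x y"
  note I = log_jump_integrable[OF assms]
  have In: "integrable step_law ?near" using integrable_mult_indicator[OF _ I, of "{-(x/2)..x/2}"] by simp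
  have 1: "\<bar>(\<integral>y. log_jump x y \<partial>step_law) - (\<integral>y. ?near y \<partial>step_law)\<bar> \<le> 200 / a\<^sup>2"
  proof -
    have "\<bar>(\<integral>y. log_jump x y \<partial>step_law) - (\<integral>y. ?near y \<partial>step_law)\<bar> = \<bar>\<integral>y. log_jump x y - ?near y \<partial>step_law\<bar>"
      using I In by simp
    also have "\<dots> \<le> (\<integral>y. \<bar>log_jump x y - ?near y\<bar> \<partial>step_law)" by (rule integral_abs_bound)
    also have "\<dots> \<le> (\<integral>y. far_jump_bound x y \<partial>step_law)"
    proof (intro integral_mono far_jump_bound_integral assms)
      show "\<bar>log_jump x y - ?near y\<bar> \<le> far_jump_bound x y" for y
        using log_jump_far(1)[OF assms, of y] far_jump_bound_nonneg[OF assms, of y]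
        by (cases "\<bar>y\<bar> \<le> x / 2") (auto simp: indicator_def abs_le_iff)
    qed (use I In in auto)
    also have "\<dots> \<le> 200 / a\<^sup>2" using far_jump_bound_integral(2)[OF assms] by (simp add: a_def)
    finally show ?thesis .
  qed
  have 2: "\<bar>(\<integral>y. ?near y \<partial>step_law) + truncated_moment2 (x/2) / (2 * a\<^sup>2)\<bar> \<le> 1 / a\<^sup>2"
    using log_jump_drift_near[OF assms] by (simp add: a_def)
  have 3: "\<bar>truncated_moment2 (x/2) / (2 * a\<^sup>2) - ln a / (2 * a\<^sup>2)\<bar> \<le> 1 / a\<^sup>2"
  proof -
    have "\<bar>truncated_moment2 (x/2) - ln a\<bar> \<le> 2"
      using truncated_moment2_bounds[OF b] by (simp add: a_def)
    then have "\<bar>truncated_moment2 (x/2) - ln a\<bar> / (2 * a\<^sup>2) \<le> 2 / (2 * a\<^sup>2)"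
      by (intro divide_right_mono) auto
    then show ?thesis using a by (simp flip: diff_divide_distrib)
  qed
  have 4: "\<bar>ln a / (2 * a\<^sup>2) - 2 * ln (1 + x) * step_tail x\<bar> \<le> 4 / a\<^sup>2"
  proof -
    define d where "d = step_tail x - 1 / (4 * a\<^sup>2)"
    have d: "0 \<le> d" "d \<le> 2 / a ^ 3" using step_tail_bounds[OF assms] by (auto simp: d_def a_def)
    have l: "0 \<le> ln a" "ln a \<le> a" using a ln_le_minus_one[of a] by auto
    have "ln a / (2 * a\<^sup>2) - 2 * ln (1 + x) * step_tail x = - (2 * (ln a * d))"
      by (simp add: d_def a_def algebra_simps)
    moreover have "ln a * d \<le> a * (2 / a ^ 3)" using d l a by (intro mult_mono) auto
    moreover have "a * (2 / a ^ 3) = 2 / a\<^sup>2" using a by (simp add: power2_eq_square power3_eq_cube)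
    moreover have "0 \<le> ln a * d" using d l by simp
    ultimately show ?thesis by (simp add: abs_le_iff)
  qed
  have "\<bar>(\<integral>y. log_jump x y \<partial>step_law) + 2 * ln (1 + x) * step_tail x\<bar> \<le> 206 * (1 / a\<^sup>2)"
    using 1 2 3 4 by (simp add: abs_le_iff)
  also have "\<dots> \<le> 206 * (4 * step_tail x)"
    using inverse_square_le_step_tail[OF assms] unfolding a_def by (intro mult_left_mono) auto
  also have "\<dots> \<le> 1000 * step_tail x" using step_tail_nonneg[of x] by simp
  finally show ?thesis .
qed

section \<open>The walk killed below zero and its Green sums\<close>

text \<open>
  One step of the walk on \<open>[0, \<infinity>)\<close> that is killed when it jumps below zero.
  Only the values of \<open>g\<close> on the half line enter.
\<close>

definition kill_op :: "(real \<Rightarrow> real) \<Rightarrow> real \<Rightarrow> real" where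
  "kill_op g x = (\<integral>y. indicator {0..} (x + y) * g (x + y) \<partial>step_law)"

definition admissible :: "(real \<Rightarrow> real) \<Rightarrow> bool" where
  "admissible g \<longleftrightarrow> g \<in> borel_measurable borel \<and> (\<exists>B. \<forall>x\<ge>0. \<bar>g x\<bar> \<le> B)"

lemma admissibleI: "g \<in> borel_measurable borel \<Longrightarrow> (\<And>x. 0 \<le> x \<Longrightarrow> \<bar>g x\<bar> \<le> B) \<Longrightarrow> admissible g"
  by (auto simp: admissible_def)

lemma admissible_measurable [measurable_dest]: "admissible g \<Longrightarrow> g \<in> borel_measurable borel"
  by (simp add: admissible_def)

lemma admissible_bound:
  assumes "admissible g" obtains B where "0 \<le> B" "\<And>x. 0 \<le> x \<Longrightarrow> \<bar>g x\<bar> \<le> B"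
proof -
  from assms obtain B where "\<forall>x\<ge>0. \<bar>g x\<bar> \<le> B" by (auto simp: admissible_def)
  then show ?thesis using that[of B] by (meson abs_ge_zero order_refl order_trans)
qed

lemma kill_op_integrable:
  assumes "admissible g"
  shows "integrable step_law (\<lambda>y. indicator {0..} (x + y) * g (x + y))"
proof -
  note [measurable] = admissible_measurable[OF assms]
  obtain B where "0 \<le> B" "\<And>x. 0 \<le> x \<Longrightarrow> \<bar>g x\<bar> \<le> B" using admissible_bound[OF assms] by blast
  then show ?thesis
    by (intro step_law.integrable_const_bound[where B = B]) (auto simp: indicator_def intro!: AE_I2)
qed

lemma kill_op_linear:
  assumes "admissible g" "admissible h"
  shows "kill_op (\<lambda>z. a * g z + b * h z) x = a * kill_op g x + b * kill_op h x"
proof -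
  have "kill_op (\<lambda>z. a * g z + b * h z) x = (\<integral>y. a * (indicator {0..} (x + y) * g (x + y))
      + b * (indicator {0..} (x + y) * h (x + y)) \<partial>step_law)"
    unfolding kill_op_def by (intro Bochner_Integration.integral_cong) (auto simp: algebra_simps)
  also have "\<dots> = a * kill_op g x + b * kill_op h x"
    unfolding kill_op_def using kill_op_integrable[OF assms(1)] kill_op_integrable[OF assms(2)] by simp
  finally show ?thesis .
qed

lemma kill_op_mono:
  assumes "admissible g" "admissible h" "\<And>z. 0 \<le> z \<Longrightarrow> g z \<le> h z"
  shows "kill_op g x \<le> kill_op h x"
  unfolding kill_op_def
  by (intro integral_mono kill_op_integrable assms(1,2)) (auto simp: indicator_def assms(3))

lemma kill_op_one: "kill_op (\<lambda>_. 1) x = 1 - step_tail x"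
proof -
  have "kill_op (\<lambda>_. 1) x = (\<integral>y. indicator {-x..} y \<partial>step_law)"
    unfolding kill_op_def by (intro Bochner_Integration.integral_cong) (auto simp: indicator_def)
  also have "\<dots> = step_tail (- x)" by (simp add: measure_step_law_atLeast)
  finally show ?thesis by (simp add: step_tail_minus)
qed

lemma admissible_const [simp]: "admissible (\<lambda>_. c)"
  by (rule admissibleI) auto

lemma admissible_linear:
  assumes "admissible g" "admissible h" shows "admissible (\<lambda>z. a * g z + b * h z)"
proof -
  obtain B where B: "\<And>x. 0 \<le> x \<Longrightarrow> \<bar>g x\<bar> \<le> B" using admissible_bound[OF assms(1)] by blast
  obtain C where C: "\<And>x. 0 \<le> x \<Longrightarrow> \<bar>h x\<bar> \<le> C" using admissible_bound[OF assms(2)] by blast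
  show ?thesis
  proof (rule admissibleI)
    show "(\<lambda>z. a * g z + b * h z) \<in> borel_measurable borel" using assms by measurable
    show "\<bar>a * g x + b * h x\<bar> \<le> \<bar>a\<bar> * B + \<bar>b\<bar> * C" if "0 \<le> x" for x
      using B[OF that] C[OF that]
      by (intro order_trans[OF abs_triangle_ineq] add_mono) (auto simp: abs_mult intro!: mult_left_mono)
  qed
qed

lemma kill_op_abs_le:
  assumes "admissible g" "\<And>x. 0 \<le> x \<Longrightarrow> \<bar>g x\<bar> \<le> B" "0 \<le> B"
  shows "\<bar>kill_op g x\<bar> \<le> B"
proof -
  have "kill_op g x \<le> kill_op (\<lambda>_. B * 1 + 0 * 1) x" "kill_op (\<lambda>_. - B * 1 + 0 * 1) x \<le> kill_op g x"
    using assms(2) by (auto intro!: kill_op_mono assms(1) simp: abs_le_iff minus_le_iff)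
  moreover have "kill_op (\<lambda>_. B * 1 + 0 * 1) x = B * (1 - step_tail x)"
    "kill_op (\<lambda>_. - B * 1 + 0 * 1) x = - B * (1 - step_tail x)"
    by (subst kill_op_linear; simp add: kill_op_one)+
  moreover have "B * (1 - step_tail x) \<le> B" using assms(3) by (simp add: mult_left_le)
  ultimately show ?thesis by (auto simp: abs_le_iff)
qed

lemma kill_op_measurable:
  assumes "admissible g" shows "kill_op g \<in> borel_measurable borel"
proof -
  note [measurable] = admissible_measurable[OF assms]
  show ?thesis unfolding kill_op_def[abs_def] by measurable
qed

lemma admissible_kill_op: assumes "admissible g" shows "admissible (kill_op g)"
proof -
  obtain B where "0 \<le> B" "\<And>x. 0 \<le> x \<Longrightarrow> \<bar>g x\<bar> \<le> B" using admissible_bound[OF assms] by blast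
  then show ?thesis by (intro admissibleI[where B=B] kill_op_measurable kill_op_abs_le assms) auto
qed

lemma admissible_kill_pow: "admissible g \<Longrightarrow> admissible ((kill_op ^^ n) g)"
  by (induction n) (auto intro: admissible_kill_op)

lemma kill_pow_linear:
  assumes "admissible g" "admissible h"
  shows "(kill_op ^^ n) (\<lambda>z. a * g z + b * h z) x = a * (kill_op ^^ n) g x + b * (kill_op ^^ n) h x"
proof (induction n arbitrary: x)
  case (Suc n)
  have "(kill_op ^^ n) (\<lambda>z. a * g z + b * h z) = (\<lambda>x. a * (kill_op ^^ n) g x + b * (kill_op ^^ n) h x)"
    using Suc by blast
  then show ?case by (simp add: kill_op_linear admissible_kill_pow assms)
qed simp

lemma kill_pow_mono:
  assumes "admissible g" "admissible h" "\<And>z. 0 \<le> z \<Longrightarrow> g z \<le> h z" "0 \<le> x"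
  shows "(kill_op ^^ n) g x \<le> (kill_op ^^ n) h x"
  using assms(4)
proof (induction n arbitrary: x)
  case (Suc n)
  then show ?case by (auto intro!: kill_op_mono admissible_kill_pow assms(1,2))
qed (simp add: assms(3))

lemma kill_pow_scale: "admissible g \<Longrightarrow> (kill_op ^^ n) (\<lambda>z. a * g z) x = a * (kill_op ^^ n) g x"
  using kill_pow_linear[of g g n a 0 x] by simp

lemma kill_pow_zero: "(kill_op ^^ n) (\<lambda>_. 0) x = 0"
  using kill_pow_scale[of "\<lambda>_. 0" n 0 x] by simp

lemma kill_pow_nonneg:
  "admissible g \<Longrightarrow> (\<And>z. 0 \<le> z \<Longrightarrow> 0 \<le> g z) \<Longrightarrow> 0 \<le> x \<Longrightarrow> 0 \<le> (kill_op ^^ n) g x"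
  using kill_pow_mono[of "\<lambda>_. 0" g x n] by (simp add: kill_pow_zero)

lemma kill_pow_abs_le:
  assumes "admissible g" "admissible h" "\<And>z. 0 \<le> z \<Longrightarrow> \<bar>g z\<bar> \<le> h z" "0 \<le> x"
  shows "\<bar>(kill_op ^^ n) g x\<bar> \<le> (kill_op ^^ n) h x"
proof -
  have "(kill_op ^^ n) (\<lambda>z. (-1) * h z + 0 * h z) x \<le> (kill_op ^^ n) g x"
    using assms(3) by (intro kill_pow_mono admissible_linear assms(1,2,4)) (auto simp: abs_le_iff minus_le_iff)
  then have "- (kill_op ^^ n) h x \<le> (kill_op ^^ n) g x"
    using assms by (simp only: kill_pow_linear)
  moreover have "(kill_op ^^ n) g x \<le> (kill_op ^^ n) h x"
    using assms(3) by (intro kill_pow_mono assms(1,2,4)) (auto simp: abs_le_iff)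
  ultimately show ?thesis by (auto simp: abs_le_iff)
qed

lemma kill_pow_telescope:
  assumes "admissible h"
  shows "(\<Sum>n<N. (kill_op ^^ n) (\<lambda>z. h z - kill_op h z) x) = h x - (kill_op ^^ N) h x"
proof -
  have "(kill_op ^^ n) (\<lambda>z. h z - kill_op h z) x = (kill_op ^^ n) h x - (kill_op ^^ Suc n) h x" for n
    using kill_pow_linear[OF assms admissible_kill_op[OF assms], of n 1 "-1" x]
    by (simp add: funpow_swap1)
  then show ?thesis using sum_lessThan_telescope'[of "\<lambda>n. (kill_op ^^ n) h x" N] by simp
qed

lemma step_tail_antimono: "x \<le> y \<Longrightarrow> step_tail y \<le> step_tail x"
  unfolding measure_step_law_greaterThan[symmetric] by (intro step_law.finite_measure_mono) auto

lemma step_tail_measurable [measurable]: "step_tail \<in> borel_measurable borel"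
  unfolding step_tail_def[abs_def] by measurable

lemma admissible_step_tail [simp]: "admissible step_tail"
  by (rule admissibleI[where B = 1]) (auto simp: step_tail_le_1)

lemma kill_pow_step_tail_sum: "(\<Sum>n<N. (kill_op ^^ n) step_tail x) = 1 - (kill_op ^^ N) (\<lambda>_. 1) x"
  using kill_pow_telescope[of "\<lambda>_. 1" x N] by (simp add: kill_op_one)

text \<open>
  The \<open>n\<close>-th term is the probability of being killed in step \<open>n + 1\<close>, so
  the sum is at most one.
\<close>

lemma kill_pow_step_tail_summable:
  assumes "0 \<le> x"
  shows "summable (\<lambda>n. (kill_op ^^ n) step_tail x)" "(\<Sum>n. (kill_op ^^ n) step_tail x) \<le> 1"
proof -
  have nn: "0 \<le> (kill_op ^^ n) step_tail x" for n by (rule kill_pow_nonneg) (auto simp: assms)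
  have le: "(\<Sum>n<N. (kill_op ^^ n) step_tail x) \<le> 1" for N
    unfolding kill_pow_step_tail_sum using kill_pow_nonneg[of "\<lambda>_. 1" x N] assms by simp
  show s: "summable (\<lambda>n. (kill_op ^^ n) step_tail x)"
    by (rule summableI_nonneg_bounded[OF nn le])
  show "(\<Sum>n. (kill_op ^^ n) step_tail x) \<le> 1" by (rule suminf_le_const[OF s le])
qed

text \<open>
  The functions that can be summed along the killed walk: a reward of at most \<open>C\<close>,
  paid on killing.
\<close>

definition tail_dominated :: "real \<Rightarrow> (real \<Rightarrow> real) \<Rightarrow> bool" where
  "tail_dominated C \<psi> \<longleftrightarrow> \<psi> \<in> borel_measurable borel \<and> (\<forall>x\<ge>0. \<bar>\<psi> x\<bar> \<le> C * step_tail x)"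

lemma tail_dominated_nonneg: "tail_dominated C \<psi> \<Longrightarrow> 0 \<le> C"
  by (metis abs_ge_zero order_refl order_trans step_tail_pos tail_dominated_def zero_le_mult_iff linorder_not_le)

lemma tail_dominated_admissible: assumes "tail_dominated C \<psi>" shows "admissible \<psi>"
proof (rule admissibleI[where B = C])
  show "\<bar>\<psi> x\<bar> \<le> C" if "0 \<le> x" for x
    using assms that tail_dominated_nonneg[OF assms] step_tail_le_1[of x]
    by (auto simp: tail_dominated_def intro: order_trans[OF _ mult_left_le])
qed (use assms in \<open>simp add: tail_dominated_def\<close>)

text \<open>
  If \<open>\<psi>(x)\<close> is the expected reward paid when the next jump from \<open>x\<close>
  kills, then this is the expected total reward from the starting point.
\<close>

definition green :: "(real \<Rightarrow> real) \<Rightarrow> real \<Rightarrow> real" where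
  "green \<psi> x = (\<Sum>n. (kill_op ^^ n) \<psi> x)"

lemma kill_pow_tail_dominated:
  assumes "tail_dominated C \<psi>" "0 \<le> x"
  shows "\<bar>(kill_op ^^ n) \<psi> x\<bar> \<le> C * (kill_op ^^ n) step_tail x"
proof -
  have "\<bar>(kill_op ^^ n) \<psi> x\<bar> \<le> (kill_op ^^ n) (\<lambda>z. C * step_tail z) x"
    using assms admissible_linear[of step_tail step_tail C 0]
    by (intro kill_pow_abs_le tail_dominated_admissible[OF assms(1)]) (auto simp: tail_dominated_def)
  then show ?thesis by (simp add: kill_pow_scale)
qed

lemma green_summable:
  assumes "tail_dominated C \<psi>" "0 \<le> x"
  shows "summable (\<lambda>n. \<bar>(kill_op ^^ n) \<psi> x\<bar>)" "summable (\<lambda>n. (kill_op ^^ n) \<psi> x)"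
proof -
  show "summable (\<lambda>n. \<bar>(kill_op ^^ n) \<psi> x\<bar>)"
    using kill_pow_tail_dominated[OF assms]
    by (intro summable_comparison_test'[OF summable_mult[OF kill_pow_step_tail_summable(1)[OF assms(2)]]]) auto
  then show "summable (\<lambda>n. (kill_op ^^ n) \<psi> x)" by (rule summable_rabs_cancel)
qed

lemma green_sums: "tail_dominated C \<psi> \<Longrightarrow> 0 \<le> x \<Longrightarrow> (\<lambda>n. (kill_op ^^ n) \<psi> x) sums green \<psi> x"
  unfolding green_def by (intro summable_sums green_summable)

lemma green_abs_le:
  assumes "tail_dominated C \<psi>" "0 \<le> x" shows "\<bar>green \<psi> x\<bar> \<le> C"
proof -
  have "\<bar>green \<psi> x\<bar> \<le> (\<Sum>n. \<bar>(kill_op ^^ n) \<psi> x\<bar>)"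
    unfolding green_def by (rule summable_rabs) (rule green_summable[OF assms])
  also have "\<dots> \<le> (\<Sum>n. C * (kill_op ^^ n) step_tail x)"
    by (intro suminf_le kill_pow_tail_dominated green_summable[OF assms] assms summable_mult
        kill_pow_step_tail_summable(1))
  also have "\<dots> = C * (\<Sum>n. (kill_op ^^ n) step_tail x)"
    by (intro suminf_mult kill_pow_step_tail_summable assms)
  also have "\<dots> \<le> C"
    using kill_pow_step_tail_summable(2)[OF assms(2)] tail_dominated_nonneg[OF assms(1)] by (simp add: mult_left_le)
  finally show ?thesis .
qed

lemma green_mono:
  assumes "tail_dominated C \<psi>" "tail_dominated C' \<psi>'" "\<And>z. 0 \<le> z \<Longrightarrow> \<psi> z \<le> \<psi>' z" "0 \<le> x"
  shows "green \<psi> x \<le> green \<psi>' x"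
  unfolding green_def using assms
  by (intro suminf_le kill_pow_mono green_summable) (auto intro: tail_dominated_admissible)

lemma tail_dominated_linear:
  assumes "tail_dominated C \<psi>" "tail_dominated D \<psi>'"
  shows "tail_dominated (\<bar>a\<bar> * C + \<bar>b\<bar> * D) (\<lambda>z. a * \<psi> z + b * \<psi>' z)"
  unfolding tail_dominated_def
proof (intro conjI allI impI)
  show "(\<lambda>z. a * \<psi> z + b * \<psi>' z) \<in> borel_measurable borel"
    using assms unfolding tail_dominated_def by auto
  fix x :: real assume x: "0 \<le> x"
  have "\<bar>a * \<psi> x + b * \<psi>' x\<bar> \<le> \<bar>a\<bar> * \<bar>\<psi> x\<bar> + \<bar>b\<bar> * \<bar>\<psi>' x\<bar>"
    by (metis abs_mult abs_triangle_ineq)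
  also have "\<dots> \<le> \<bar>a\<bar> * (C * step_tail x) + \<bar>b\<bar> * (D * step_tail x)"
    using assms x unfolding tail_dominated_def by (intro add_mono mult_left_mono) auto
  finally show "\<bar>a * \<psi> x + b * \<psi>' x\<bar> \<le> (\<bar>a\<bar> * C + \<bar>b\<bar> * D) * step_tail x"
    by (simp add: algebra_simps)
qed

lemma green_linear:
  assumes "tail_dominated C \<psi>" "tail_dominated D \<psi>'" "0 \<le> x"
  shows "green (\<lambda>z. a * \<psi> z + b * \<psi>' z) x = a * green \<psi> x + b * green \<psi>' x"
proof -
  have "(\<lambda>n. (kill_op ^^ n) (\<lambda>z. a * \<psi> z + b * \<psi>' z) x) sums (a * green \<psi> x + b * green \<psi>' x)"
    using sums_add[OF sums_mult[OF green_sums[OF assms(1,3)], of a] sums_mult[OF green_sums[OF assms(2,3)], of b]]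
    by (simp add: kill_pow_linear tail_dominated_admissible[OF assms(1)] tail_dominated_admissible[OF assms(2)])
  then show ?thesis unfolding green_def by (simp add: sums_iff)
qed

text \<open>
  Either the walk has been killed by time \<open>n\<close>, or it is far away where
  \<open>h\<close> is small, or it is below some level \<open>R\<close>. The last event has
  probability at most a constant times \<open>K\<^sup>n F\<close>, a summable sequence.
\<close>

lemma kill_pow_vanishing:
  assumes "admissible h" "(h \<longlongrightarrow> 0) at_top" "0 \<le> x"
  shows "(\<lambda>n. (kill_op ^^ n) h x) \<longlonglongrightarrow> 0"
proof (rule LIMSEQ_I)
  fix e :: real assume e: "0 < e"
  obtain B where B: "0 \<le> B" "\<And>z. 0 \<le> z \<Longrightarrow> \<bar>h z\<bar> \<le> B" using admissible_bound[OF assms(1)] by blast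
  have "eventually (\<lambda>z. \<bar>h z\<bar> < e / 2) at_top"
    using tendstoD[OF assms(2), of "e/2"] e by simp
  then obtain R where R: "\<And>z. R \<le> z \<Longrightarrow> \<bar>h z\<bar> < e / 2" by (auto simp: eventually_at_top_linorder)
  define c where "c = B / step_tail R"
  have c: "0 \<le> c" using B step_tail_pos[of R] by (simp add: c_def)
  have bound: "\<bar>h z\<bar> \<le> e / 2 * 1 + c * step_tail z" if "0 \<le> z" for z
  proof (cases "R \<le> z")
    case True
    then show ?thesis using R[OF True] c step_tail_nonneg[of z] by (simp add: add_increasing2)
  next
    case False
    have "B = c * step_tail R" using step_tail_pos[of R] by (simp add: c_def)
    also have "\<dots> \<le> c * step_tail z" using False c by (intro mult_left_mono step_tail_antimono) auto
    finally show ?thesis using B(2)[OF that] e by linarith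
  qed
  have one: "(kill_op ^^ n) (\<lambda>_. 1) x \<le> 1" for n
  proof -
    have "0 \<le> (\<Sum>k<n. (kill_op ^^ k) step_tail x)" by (intro sum_nonneg kill_pow_nonneg) (auto simp: assms)
    then show ?thesis unfolding kill_pow_step_tail_sum by simp
  qed
  have main: "\<bar>(kill_op ^^ n) h x\<bar> \<le> e / 2 + c * (kill_op ^^ n) step_tail x" for n
  proof -
    have "\<bar>(kill_op ^^ n) h x\<bar> \<le> (kill_op ^^ n) (\<lambda>z. e / 2 * 1 + c * step_tail z) x"
      by (intro kill_pow_abs_le assms admissible_linear bound) auto
    also have "\<dots> = e / 2 * (kill_op ^^ n) (\<lambda>_. 1) x + c * (kill_op ^^ n) step_tail x"
      by (rule kill_pow_linear) auto
    also have "\<dots> \<le> e / 2 * 1 + c * (kill_op ^^ n) step_tail x"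
      using one[of n] e by (intro add_right_mono mult_left_mono) auto
    finally show ?thesis by simp
  qed
  have "(\<lambda>n. c * (kill_op ^^ n) step_tail x) \<longlonglongrightarrow> c * 0"
    by (intro tendsto_mult_left summable_LIMSEQ_zero kill_pow_step_tail_summable assms)
  then have "eventually (\<lambda>n. c * (kill_op ^^ n) step_tail x < e / 2) sequentially"
    using e by (intro order_tendstoD(2)) auto
  then obtain N where N: "\<And>n. N \<le> n \<Longrightarrow> c * (kill_op ^^ n) step_tail x < e / 2"
    by (auto simp: eventually_sequentially)
  show "\<exists>N. \<forall>n\<ge>N. norm ((kill_op ^^ n) h x - 0) < e"
    using main N by (intro exI[of _ N]) (smt (verit) field_sum_of_halves real_norm_def)
qed

text \<open>
  Approximate solutions of the Poisson equation \<open>h - K h = \<psi>\<close> give approximate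
  Green sums: the error is itself a reward of size at most \<open>e\<close>.
\<close>

lemma green_potential:
  assumes h: "admissible h" "(h \<longlongrightarrow> 0) at_top" and \<psi>: "tail_dominated C \<psi>"
    and err: "\<And>z. 0 \<le> z \<Longrightarrow> \<bar>h z - kill_op h z - \<psi> z\<bar> \<le> e * step_tail z" and x: "0 \<le> x"
  shows "\<bar>green \<psi> x - h x\<bar> \<le> e"
proof -
  let ?g = "\<lambda>z. h z - kill_op h z"
  note a\<psi> = tail_dominated_admissible[OF \<psi>]
  have ag: "admissible ?g"
    using admissible_linear[OF h(1) admissible_kill_op[OF h(1)], of 1 "-1"] by simp
  have d: "tail_dominated e (\<lambda>z. 1 * ?g z + (-1) * \<psi> z)"
    unfolding tail_dominated_def using err admissible_measurable[OF ag] \<psi>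
    by (auto simp: tail_dominated_def)
  have "(\<lambda>N. h x - (kill_op ^^ N) h x) \<longlonglongrightarrow> h x - 0"
    by (intro tendsto_intros kill_pow_vanishing h x)
  then have "(\<lambda>n. (kill_op ^^ n) ?g x) sums h x"
    unfolding sums_def kill_pow_telescope[OF h(1)] by simp
  then have "(\<lambda>n. 1 * (kill_op ^^ n) ?g x + (-1) * (kill_op ^^ n) \<psi> x) sums (1 * h x + (-1) * green \<psi> x)"
    by (intro sums_add sums_mult green_sums[OF \<psi> x])
  then have "green (\<lambda>z. 1 * ?g z + (-1) * \<psi> z) x = h x - green \<psi> x"
    unfolding kill_pow_linear[OF ag a\<psi>, symmetric] green_def by (simp add: sums_iff)
  then show ?thesis using green_abs_le[OF d x] by (simp add: abs_minus_commute)
qed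

section \<open>The generator on slowly varying functions\<close>

lemma taylor_remainder_le:
  fixes \<phi> \<phi>' \<phi>'' :: "real \<Rightarrow> real"
  assumes S: "convex S" "l \<in> S" "m \<in> S"
    and d1: "\<And>z. z \<in> S \<Longrightarrow> (\<phi> has_real_derivative \<phi>' z) (at z)"
    and d2: "\<And>z. z \<in> S \<Longrightarrow> (\<phi>' has_real_derivative \<phi>'' z) (at z)"
    and B: "\<And>z. z \<in> S \<Longrightarrow> \<bar>\<phi>'' z\<bar> \<le> B"
  shows "\<bar>\<phi> m - \<phi> l - \<phi>' l * (m - l)\<bar> \<le> B * (m - l)\<^sup>2"
proof -
  have B0: "0 \<le> B" using B[OF S(2)] by linarith
  have seg: "closed_segment l m \<subseteq> S" using S by (simp add: closed_segment_subset)
  have lip: "\<bar>\<phi>' z - \<phi>' l\<bar> \<le> B * \<bar>z - l\<bar>" if "z \<in> S" for z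
    using field_differentiable_bound[OF S(1), of \<phi>' \<phi>'' B z l] d2 B that S(2)
    by (auto intro: has_field_derivative_at_within)
  have "norm ((\<phi> m - \<phi>' l * m) - (\<phi> l - \<phi>' l * l)) \<le> B * \<bar>m - l\<bar> * norm (m - l)"
  proof (rule field_differentiable_bound[where S = "closed_segment l m" and f' = "\<lambda>z. \<phi>' z - \<phi>' l"])
    fix z assume z: "z \<in> closed_segment l m"
    have "((\<lambda>z. \<phi> z - \<phi>' l * z) has_real_derivative \<phi>' z - \<phi>' l * 1) (at z)"
      using seg z by (intro derivative_intros d1) auto
    then show "((\<lambda>z. \<phi> z - \<phi>' l * z) has_real_derivative \<phi>' z - \<phi>' l) (at z within closed_segment l m)"
      by (simp add: has_field_derivative_at_within)
    have "\<bar>z - l\<bar> \<le> \<bar>m - l\<bar>"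
      using z by (auto simp: closed_segment_eq_real_ivl split: if_splits)
    then have "B * \<bar>z - l\<bar> \<le> B * \<bar>m - l\<bar>" using B0 by (rule mult_left_mono)
    moreover have "\<bar>\<phi>' z - \<phi>' l\<bar> \<le> B * \<bar>z - l\<bar>" using lip z seg by auto
    ultimately show "norm (\<phi>' z - \<phi>' l) \<le> B * \<bar>m - l\<bar>" by simp
  qed auto
  then show ?thesis by (simp add: algebra_simps power2_eq_square flip: abs_mult)
qed

text \<open>
  The weight \<open>1 / (1 + l)\<close> compensates the growth of the mean square of a logarithmic
  jump, which is proportional to the logarithm of the height. Near \<open>l\<close> it comes from
  the decay of the second derivative; for \<open>m < l / 2\<close> it comes from the boundedness
  of \<open>\<phi>\<close> and the decay of its derivative, as \<open>m - l\<close> is then of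
  order \<open>l\<close>.
\<close>

lemma decaying_taylor_remainder_le:
  fixes \<phi> \<phi>' \<phi>'' :: "real \<Rightarrow> real"
  assumes d1: "\<And>z. 0 \<le> z \<Longrightarrow> (\<phi> has_real_derivative \<phi>' z) (at z)"
    and d2: "\<And>z. 0 \<le> z \<Longrightarrow> (\<phi>' has_real_derivative \<phi>'' z) (at z)"
    and b0: "\<And>z. 0 \<le> z \<Longrightarrow> 0 \<le> \<phi> z \<and> \<phi> z \<le> 1"
    and b1: "\<And>z. 0 \<le> z \<Longrightarrow> \<bar>\<phi>' z\<bar> \<le> A / (1 + z)"
    and b2: "\<And>z. 0 \<le> z \<Longrightarrow> \<bar>\<phi>'' z\<bar> \<le> A / (1 + z)\<^sup>2"
    and lm: "0 \<le> l" "0 \<le> m"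
  shows "\<bar>\<phi> m - \<phi> l - \<phi>' l * (m - l)\<bar> \<le> (8 + 4 * A) * ((m - l)\<^sup>2 / (1 + l))"
proof -
  have "0 \<le> A / (1 + 0)" by (rule order_trans[OF abs_ge_zero b1]) simp
  then have A: "0 \<le> A" by simp
  have sq: "0 \<le> (m - l)\<^sup>2 / (1 + l)" using lm by simp
  have 8: "(4 * A) * ((m - l)\<^sup>2 / (1 + l)) \<le> (8 + 4 * A) * ((m - l)\<^sup>2 / (1 + l))"
    using sq by (intro mult_right_mono) auto
  consider "l / 2 \<le> m" | "m < l / 2" "l \<le> 1" | "m < l / 2" "1 < l" by linarith
  then show ?thesis
  proof cases
    case 1
    have "\<bar>\<phi> m - \<phi> l - \<phi>' l * (m - l)\<bar> \<le> (4 * A / (1 + l)) * (m - l)\<^sup>2"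
    proof (rule taylor_remainder_le[where S = "{l/2..}" and \<phi>'' = \<phi>''])
      fix z assume "z \<in> {l/2..}"
      then have z: "l / 2 \<le> z" "0 \<le> z" using lm by auto
      have "\<bar>\<phi>'' z\<bar> \<le> A / (1 + z)\<^sup>2" using b2 z by simp
      also have "\<dots> \<le> A / ((1 + l)\<^sup>2 / 4)"
      proof (intro divide_left_mono A)
        have "((1 + l) / 2)\<^sup>2 \<le> (1 + z)\<^sup>2" using z lm by (intro power_mono) auto
        then show "(1 + l)\<^sup>2 / 4 \<le> (1 + z)\<^sup>2" by (simp add: power_divide)
        show "0 < (1 + z)\<^sup>2 * ((1 + l)\<^sup>2 / 4)" using z lm by simp
      qed
      also have "\<dots> = 4 * A / (1 + l)\<^sup>2" by simp
      also have "\<dots> \<le> 4 * A / (1 + l)"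
      proof (intro divide_left_mono)
        show "1 + l \<le> (1 + l)\<^sup>2" using lm by (simp add: power2_eq_square)
      qed (use A lm in auto)
      finally show "\<bar>\<phi>'' z\<bar> \<le> 4 * A / (1 + l)" .
    qed (use 1 lm d1 d2 in auto)
    also have "\<dots> = (4 * A) * ((m - l)\<^sup>2 / (1 + l))" by simp
    finally show ?thesis using 8 by linarith
  next
    case 2
    have "\<bar>\<phi> m - \<phi> l - \<phi>' l * (m - l)\<bar> \<le> A * (m - l)\<^sup>2"
    proof (rule taylor_remainder_le[where S = "{0..}" and \<phi>'' = \<phi>''])
      fix z :: real assume "z \<in> {0..}"
      then have z: "0 \<le> z" by simp
      have "\<bar>\<phi>'' z\<bar> \<le> A / (1 + z)\<^sup>2" using b2 z by simp
      also have "\<dots> \<le> A / 1" using z A by (intro divide_left_mono) auto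
      finally show "\<bar>\<phi>'' z\<bar> \<le> A" by simp
    qed (use lm d1 d2 in auto)
    also have "\<dots> \<le> (4 * A / (1 + l)) * (m - l)\<^sup>2"
    proof (intro mult_right_mono)
      show "A \<le> 4 * A / (1 + l)" using A 2 lm mult_left_mono[of "1 + l" 4 A] by (simp add: field_simps)
    qed simp
    also have "\<dots> = (4 * A) * ((m - l)\<^sup>2 / (1 + l))" by simp
    finally show ?thesis using 8 by linarith
  next
    case 3
    have far: "l / 2 \<le> l - m" using 3 by linarith
    have "(l / 2)\<^sup>2 \<le> (l - m)\<^sup>2" using far 3 by (intro power_mono) auto
    then have q: "l\<^sup>2 / 4 \<le> (m - l)\<^sup>2" by (simp add: power_divide power2_commute)
    have "1 + l \<le> 2 * l\<^sup>2" using 3 mult_mono[of 1 l 1 l] by (simp add: power2_eq_square) (smt (verit) mult_le_cancel_right1)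
    also have "\<dots> \<le> 8 * (m - l)\<^sup>2" using q by simp
    finally have one: "1 \<le> 8 * ((m - l)\<^sup>2 / (1 + l))" using lm by (simp add: field_simps)
    have "\<bar>\<phi> m - \<phi> l\<bar> \<le> 1" using b0[of m] b0[of l] lm by linarith
    moreover have "\<bar>\<phi>' l * (m - l)\<bar> \<le> 4 * A * ((m - l)\<^sup>2 / (1 + l))"
    proof -
      have "\<bar>\<phi>' l * (m - l)\<bar> = \<bar>\<phi>' l\<bar> * (l - m)" using far 3 by (simp add: abs_mult)
      also have "\<dots> \<le> A / (1 + l) * (4 * (l - m)\<^sup>2)"
      proof (intro mult_mono b1 lm)
        have "(l - m) * 1 \<le> (l - m) * (4 * (l - m))" using far 3 by (intro mult_left_mono) auto
        moreover have "(l - m) * (4 * (l - m)) = 4 * (l - m)\<^sup>2" by (simp add: power2_eq_square algebra_simps)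
        ultimately show "l - m \<le> 4 * (l - m)\<^sup>2" by (simp only: mult_1_right)
      qed (use A lm far 3 in auto)
      also have "\<dots> = 4 * A * ((m - l)\<^sup>2 / (1 + l))" by (simp add: power2_commute)
      finally show ?thesis .
    qed
    ultimately have "\<bar>\<phi> m - \<phi> l - \<phi>' l * (m - l)\<bar> \<le> 8 * ((m - l)\<^sup>2 / (1 + l)) + 4 * A * ((m - l)\<^sup>2 / (1 + l))"
      using one by linarith
    then show ?thesis by (simp only: distrib_right)
  qed
qed

text \<open>
  Expand \<open>\<phi>\<close> at \<open>l = ln (1 + x) / T\<close>. The linear term meets the
  drift \<open>- 2 ln (1 + x) F(x)\<close>, divided by \<open>T\<close>, and gives \<open>- 2 l
  \<phi>'(l) F(x)\<close>. The quadratic remainder is of order \<open>(1 + T l) F(x) / (T\<^sup>2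
  (1 + l))\<close>, hence \<open>O(F(x) / T)\<close> uniformly in \<open>x\<close>.
\<close>

lemma log_profile_generator:
  fixes \<phi> \<phi>' :: "real \<Rightarrow> real"
  assumes [measurable]: "\<phi> \<in> borel_measurable borel"
    and b0: "\<And>z. 0 \<le> z \<Longrightarrow> \<bar>\<phi> z\<bar> \<le> 1"
    and b1: "\<And>z. 0 \<le> z \<Longrightarrow> \<bar>\<phi>' z\<bar> \<le> K"
    and rem: "\<And>l m. 0 \<le> l \<Longrightarrow> 0 \<le> m \<Longrightarrow> \<bar>\<phi> m - \<phi> l - \<phi>' l * (m - l)\<bar> \<le> K * ((m - l)\<^sup>2 / (1 + l))"
    and T: "1 \<le> T" and x: "0 \<le> x"
  defines "h \<equiv> \<lambda>x. \<phi> (ln (1 + x) / T)"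
  defines "l \<equiv> ln (1 + x) / T"
  shows "\<bar>h x - kill_op h x - (\<phi> l + 2 * l * \<phi>' l) * step_tail x\<bar> \<le> (1800 * K / T) * step_tail x"
proof -
  have K: "0 \<le> K" by (rule order_trans[OF abs_ge_zero b1[of 0]]) simp
  have l: "0 \<le> l" using x T by (simp add: l_def)
  have [measurable]: "h \<in> borel_measurable borel" unfolding h_def by measurable
  have ah: "admissible h"
    using T by (intro admissibleI[where B = 1]) (auto simp: h_def intro!: b0)
  define I where "I y = indicator {0..} (x + y) * (h (x + y) - h x)" for y
  define R where "R y = I y - \<phi>' l / T * log_jump x y" for y
  have I_eq: "I y = indicator {0..} (x + y) * h (x + y) - h x * (indicator {0..} (x + y) * 1)" for y
    by (simp add: I_def algebra_simps)
  have II: "integrable step_law I"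
    using kill_op_integrable[OF ah, of x] kill_op_integrable[of "\<lambda>_. 1" x]
    unfolding I_eq by (intro Bochner_Integration.integrable_diff integrable_mult_right) auto
  have intI: "(\<integral>y. I y \<partial>step_law) = kill_op h x - h x * (1 - step_tail x)"
    using kill_op_integrable[OF ah, of x] kill_op_integrable[of "\<lambda>_. 1" x] kill_op_one[of x]
    unfolding I_eq kill_op_def by simp
  have IR: "integrable step_law R"
    unfolding R_def using II log_jump_integrable[OF x] by auto
  have R_le: "\<bar>R y\<bar> \<le> K / (T\<^sup>2 * (1 + l)) * (log_jump x y)\<^sup>2" for y
  proof (cases "0 \<le> x + y")
    case False
    then show ?thesis by (simp add: R_def I_def log_jump_def)
  next
    case True
    define m where "m = ln (1 + (x + y)) / T"
    have m: "0 \<le> m" using True T by (simp add: m_def)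
    have J: "log_jump x y = T * (m - l)" using True T by (simp add: log_jump_def m_def l_def field_simps)
    have "R y = \<phi> m - \<phi> l - \<phi>' l * (m - l)"
      using True T unfolding R_def J by (simp add: I_def h_def m_def l_def)
    also have "\<bar>\<dots>\<bar> \<le> K * ((m - l)\<^sup>2 / (1 + l))" by (rule rem[OF l m])
    also have "\<dots> = K / (T\<^sup>2 * (1 + l)) * (log_jump x y)\<^sup>2"
      using T l unfolding J by (simp add: power_mult_distrib)
    finally show ?thesis .
  qed
  have intR: "\<bar>\<integral>y. R y \<partial>step_law\<bar> \<le> 800 * K / T * step_tail x"
  proof -
    have "\<bar>\<integral>y. R y \<partial>step_law\<bar> \<le> (\<integral>y. \<bar>R y\<bar> \<partial>step_law)" by (rule integral_abs_bound)
    also have "\<dots> \<le> (\<integral>y. K / (T\<^sup>2 * (1 + l)) * (log_jump x y)\<^sup>2 \<partial>step_law)"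
      using IR log_jump_spread(1)[OF x] R_le by (intro integral_mono) auto
    also have "\<dots> = K / (T\<^sup>2 * (1 + l)) * (\<integral>y. (log_jump x y)\<^sup>2 \<partial>step_law)" by simp
    also have "\<dots> \<le> K / (T\<^sup>2 * (1 + l)) * (800 * (1 + ln (1 + x)) * step_tail x)"
      using K l by (intro mult_left_mono log_jump_spread x) auto
    also have "\<dots> = 800 * K / T * step_tail x * ((1 + T * l) / (T * (1 + l)))"
    proof -
      have "ln (1 + x) = T * l" using T by (simp add: l_def)
      moreover have "1 + l \<noteq> 0" "T \<noteq> 0" using T l by auto
      ultimately show ?thesis by (simp add: divide_simps power2_eq_square)
    qed
    also have "\<dots> \<le> 800 * K / T * step_tail x * 1"
    proof (intro mult_left_mono)
      have "0 < T * (1 + l)" "1 + T * l \<le> T * (1 + l)" using T l by (simp, simp add: distrib_left)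
      then show "(1 + T * l) / (T * (1 + l)) \<le> 1" by (simp only: divide_le_eq_1_pos)
    qed (use K T in auto)
    finally show ?thesis by simp
  qed
  have drift: "\<bar>\<phi>' l / T * ((\<integral>y. log_jump x y \<partial>step_law) + 2 * ln (1 + x) * step_tail x)\<bar> \<le> 1000 * K / T * step_tail x"
  proof -
    have "\<bar>\<phi>' l / T * ((\<integral>y. log_jump x y \<partial>step_law) + 2 * ln (1 + x) * step_tail x)\<bar>
       = \<bar>\<phi>' l\<bar> / T * \<bar>(\<integral>y. log_jump x y \<partial>step_law) + 2 * ln (1 + x) * step_tail x\<bar>"
      using T by (simp add: abs_mult)
    also have "\<dots> \<le> K / T * (1000 * step_tail x)"
      using T K b1[OF l] by (intro mult_mono log_jump_drift x divide_right_mono) auto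
    also have "\<dots> = 1000 * K / T * step_tail x" by simp
    finally show ?thesis .
  qed
  have "(\<integral>y. R y \<partial>step_law) = (\<integral>y. I y \<partial>step_law) - \<phi>' l / T * (\<integral>y. log_jump x y \<partial>step_law)"
    unfolding R_def using II log_jump_integrable[OF x] by simp
  moreover have "2 * l * \<phi>' l * step_tail x = \<phi>' l / T * (2 * ln (1 + x) * step_tail x)"
    using T by (simp add: l_def)
  moreover have "h x = \<phi> l" by (simp add: h_def l_def)
  ultimately have "h x - kill_op h x - (\<phi> l + 2 * l * \<phi>' l) * step_tail x =
     - (\<integral>y. R y \<partial>step_law) - \<phi>' l / T * ((\<integral>y. log_jump x y \<partial>step_law) + 2 * ln (1 + x) * step_tail x)"
    unfolding intI by (simp add: algebra_simps)
  moreover have "800 * K / T * step_tail x + 1000 * K / T * step_tail x = (1800 * K / T) * step_tail x"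
    by (simp add: algebra_simps flip: add_divide_distrib)
  ultimately show ?thesis using intR drift by linarith
qed

section \<open>An explicit family of profiles\<close>

text \<open>
  The profile \<open>\<phi>\<close> whose reward \<open>\<phi> + 2 y \<phi>'\<close> is a smooth
  approximation of the indicator of \<open>y < 1\<close>; see \<open>profile_soft_step\<close>.
\<close>

definition profile :: "nat \<Rightarrow> real \<Rightarrow> real" where
  "profile n y = (1 + y ^ n) powr (- (1 / (2 * real n)))"

definition soft_step :: "nat \<Rightarrow> real \<Rightarrow> real" where
  "soft_step n y = (1 + y ^ n) powr (- (1 / (2 * real n)) - 1)"

lemma one_plus_power_pos: "0 \<le> (y::real) \<Longrightarrow> 0 < 1 + y ^ n"
  by (simp add: add_pos_nonneg)

lemma powr_neg_le_1: "1 \<le> z \<Longrightarrow> a \<le> 0 \<Longrightarrow> z powr a \<le> (1::real)"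
  using powr_mono[of a 0 z] by simp

lemma soft_step_eq: "0 \<le> y \<Longrightarrow> soft_step n y = profile n y / (1 + y ^ n)"
  using one_plus_power_pos[of y n] by (simp add: soft_step_def profile_def powr_diff)

lemma profile_bounds: "0 \<le> y \<Longrightarrow> 0 \<le> profile n y \<and> profile n y \<le> 1"
  unfolding profile_def by (auto intro!: powr_neg_le_1)

text \<open>
  First and second derivative of the profile.
\<close>

definition profile' :: "nat \<Rightarrow> real \<Rightarrow> real" where
  "profile' n y = - (1 / 2) * (y ^ (n - 1) * soft_step n y)"

definition profile'' :: "nat \<Rightarrow> real \<Rightarrow> real" where
  "profile'' n y = - (1 / 2) * (real (n - 1) * y ^ (n - 2) * soft_step n y
     + y ^ (n - 1) * ((- (1 / (2 * real n)) - 1) * (1 + y ^ n) powr (- (1 / (2 * real n)) - 1 - 1) * (real n * y ^ (n - 1))))"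

lemma profile_deriv:
  assumes "2 \<le> n" "0 \<le> y"
  shows "(profile n has_real_derivative profile' n y) (at y)"
proof -
  have "((\<lambda>y. (1 + y ^ n) powr (- (1 / (2 * real n)))) has_real_derivative
     - (1 / (2 * real n)) * (1 + y ^ n) powr (- (1 / (2 * real n)) - of_nat 1) * (real n * y ^ (n - 1))) (at y)"
    using one_plus_power_pos[OF assms(2), of n]
    by (intro DERIV_fun_powr) (auto intro!: derivative_eq_intros)
  moreover have "- (1 / (2 * real n)) * (1 + y ^ n) powr (- (1 / (2 * real n)) - of_nat 1) * (real n * y ^ (n - 1)) = profile' n y"
    using assms by (simp add: profile'_def soft_step_def)
  ultimately show ?thesis by (simp add: profile_def[abs_def])
qed

lemma profile_deriv2:
  assumes "2 \<le> n" "0 \<le> y"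
  shows "(profile' n has_real_derivative profile'' n y) (at y)"
proof -
  have s: "(soft_step n has_real_derivative
     ((- (1 / (2 * real n)) - 1) * (1 + y ^ n) powr (- (1 / (2 * real n)) - 1 - of_nat 1) * (real n * y ^ (n - 1)))) (at y)"
    using one_plus_power_pos[OF assms(2), of n] unfolding soft_step_def[abs_def]
    by (intro DERIV_fun_powr) (auto intro!: derivative_eq_intros)
  have p: "((\<lambda>y. y ^ (n - 1)) has_real_derivative real (n - 1) * y ^ (n - 2)) (at y)"
    by (auto intro!: derivative_eq_intros simp: numeral_2_eq_2)
  show ?thesis unfolding profile'_def[abs_def] profile''_def
    by (rule DERIV_cmult[OF DERIV_mult[OF p s], THEN DERIV_cong]) (simp add: algebra_simps)
qed

lemma power_le_one_plus_power: "m \<le> n \<Longrightarrow> 0 \<le> y \<Longrightarrow> y ^ m \<le> 1 + (y::real) ^ n"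
proof (cases "y \<le> 1")
  case True
  assume "m \<le> n" "0 \<le> y"
  then show ?thesis using True power_le_one[of y m] by (simp add: add_increasing2)
next
  case False
  assume "m \<le> n" "0 \<le> y"
  then have "y ^ m \<le> y ^ n" using False by (intro power_increasing) auto
  then show ?thesis by simp
qed

lemma soft_step_le:
  assumes "0 \<le> y" shows "0 \<le> soft_step n y" "soft_step n y \<le> 1 / (1 + y ^ n)"
  using profile_bounds[OF assms, of n] one_plus_power_pos[OF assms, of n] assms
  by (auto simp: soft_step_eq intro!: divide_right_mono)

lemma profile'_bound:
  assumes "2 \<le> n" "0 \<le> y"
  shows "\<bar>profile' n y\<bar> \<le> 1 / (1 + y)"
proof -
  have p: "0 < 1 + y ^ n" "0 < 1 + y" using one_plus_power_pos assms by auto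
  have "(1 + y) * y ^ (n - 1) \<le> 2 * (1 + y ^ n)"
    using power_le_one_plus_power[of "n - 1" n y] assms
    by (simp add: distrib_right flip: power_Suc)
  then have "1/2 * (y ^ (n - 1) / (1 + y ^ n)) \<le> 1 / (1 + y)"
    using p by (simp add: field_simps)
  moreover have "\<bar>profile' n y\<bar> = 1/2 * (y ^ (n - 1) * soft_step n y)"
    using assms soft_step_le(1)[of y n] by (simp add: profile'_def abs_mult)
  moreover have "1/2 * (y ^ (n - 1) * soft_step n y) \<le> 1/2 * (y ^ (n - 1) * (1 / (1 + y ^ n)))"
    using assms by (intro mult_left_mono soft_step_le) auto
  moreover have "y ^ (n - 1) * (1 / (1 + y ^ n)) = y ^ (n - 1) / (1 + y ^ n)" by simp
  ultimately show ?thesis by linarith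
qed

text \<open>
  Both summands of the second derivative are of order \<open>n y\<^sup>n\<^sup>-\<^sup>2 / (1 +
  y\<^sup>n)\<close>, which is bounded near \<open>0\<close> since \<open>n \<ge> 2\<close> and
  decays like \<open>1 / y\<^sup>2\<close>.
\<close>

lemma profile''_bound:
  assumes "2 \<le> n" "0 \<le> y"
  shows "\<bar>profile'' n y\<bar> \<le> 8 * real n / (1 + y)\<^sup>2"
proof -
  define p where "p = 1 + y ^ n"
  define z where "z = y ^ (n - 2)"
  have p: "0 < p" "1 \<le> p" "0 < 1 + y" using one_plus_power_pos assms by (auto simp: p_def)
  have z: "0 \<le> z" using assms by (simp add: z_def)
  define s where "s = soft_step n y"
  have s: "0 \<le> s" "s \<le> 1 / p" using soft_step_le[OF assms(2), of n] by (auto simp: s_def p_def)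
  have e1: "y ^ (n - 1) = y * z" using assms by (cases n) (auto simp: z_def numeral_2_eq_2 simp flip: power_Suc intro: Suc_pred)
  have e2: "(1 + y ^ n) powr (- (1 / (2 * real n)) - 1 - 1) = s / p"
    using p unfolding s_def soft_step_def p_def[symmetric] by (subst powr_diff) simp
  have e3: "y ^ n = y\<^sup>2 * z"
  proof -
    have "n = 2 + (n - 2)" using assms by simp
    then show ?thesis unfolding z_def by (metis power_add)
  qed
  define c where "c = real n + 1 / 2"
  have e4: "((1 / (2 * real n)) + 1) * real n = c" using assms by (simp add: c_def field_simps)
  have "profile'' n y = - (1 / 2) * (real (n - 1) * z * s - (((1 / (2 * real n)) + 1) * real n) * (y\<^sup>2 * z * z) * (s / p))"
    unfolding profile''_def e1 e2 s_def[symmetric] z_def[symmetric] by (simp add: algebra_simps power2_eq_square)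
  then have eq: "profile'' n y = - (1 / 2) * (real (n - 1) * z * s - c * (y\<^sup>2 * z * z) * (s / p))"
    unfolding e4 .
  have a: "0 \<le> real (n - 1) * z * s" "real (n - 1) * z * s \<le> real n * (z / p)"
  proof -
    have "real (n - 1) * (z * s) \<le> real n * (z * (1 / p))"
      using z s by (intro mult_mono mult_left_mono) auto
    then show "real (n - 1) * z * s \<le> real n * (z / p)" by (simp add: mult.assoc)
  qed (use z s in auto)
  have b: "0 \<le> c * (y\<^sup>2 * z * z) * (s / p)" "c * (y\<^sup>2 * z * z) * (s / p) \<le> 2 * real n * (z / p)"
  proof -
    have "y\<^sup>2 * z / p \<le> 1" using p e3 by (simp add: p_def divide_le_eq)
    then have le: "(y\<^sup>2 * z / p) * (z * s) \<le> 1 * (z * (1 / p))"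
      using z s by (intro mult_mono mult_left_mono) auto
    have "c * ((y\<^sup>2 * z / p) * (z * s)) \<le> (2 * real n) * (1 * (z * (1 / p)))"
      by (rule mult_mono[OF _ le]) (use assms z s p in \<open>auto simp: c_def\<close>)
    then show "c * (y\<^sup>2 * z * z) * (s / p) \<le> 2 * real n * (z / p)" by (simp add: mult_ac)
  qed (use z s p in \<open>auto simp: c_def\<close>)
  have "\<bar>profile'' n y\<bar> \<le> 2 * real n * (z / p)"
  proof -
    have "\<bar>- (1 / 2) * (A - B)\<bar> \<le> D" if "0 \<le> A" "A \<le> E" "0 \<le> B" "B \<le> D" "E \<le> D" for A B D E :: real
      using that by (simp add: abs_if field_simps)
    moreover have "real n * (z / p) \<le> 2 * real n * (z / p)" using z p by (intro mult_right_mono) auto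
    ultimately show ?thesis unfolding eq using a b by metis
  qed
  also have "\<dots> \<le> 2 * real n * (4 / (1 + y)\<^sup>2)"
  proof (intro mult_left_mono)
    have "z * (1 + y)\<^sup>2 = z + 2 * (y * z) + y\<^sup>2 * z" by (simp add: power2_eq_square algebra_simps)
    also have "\<dots> = y ^ (n - 2) + 2 * y ^ (n - 1) + y ^ n" using e1 e3 by (simp add: z_def)
    also have "\<dots> \<le> 4 * p"
      using power_le_one_plus_power[of "n - 2" n y] power_le_one_plus_power[of "n - 1" n y] assms
      by (simp add: p_def)
    finally show "z / p \<le> 4 / (1 + y)\<^sup>2" using p by (simp add: field_simps)
  qed simp
  finally show ?thesis by simp
qed

lemma profile_soft_step:
  assumes "2 \<le> n" "0 \<le> y"
  shows "profile n y + 2 * y * profile' n y = soft_step n y"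
proof -
  have "profile n y = (1 + y ^ n) * soft_step n y"
    using one_plus_power_pos[OF assms(2), of n] by (simp add: soft_step_eq assms)
  moreover have "y * y ^ (n - 1) = y ^ n" using assms by (simp flip: power_Suc)
  moreover have "2 * y * profile' n y = - (y * y ^ (n - 1)) * soft_step n y" by (simp add: profile'_def)
  ultimately show ?thesis by (simp add: algebra_simps)
qed

lemma profile_measurable [measurable]: "profile n \<in> borel_measurable borel"
  unfolding profile_def[abs_def] by measurable

lemma soft_step_measurable [measurable]: "soft_step n \<in> borel_measurable borel"
  unfolding soft_step_def[abs_def] by measurable

lemma ln_over_at_top: "0 < T \<Longrightarrow> filterlim (\<lambda>x::real. ln (1 + x) / T) at_top at_top"
  by real_asymp

lemma profile_vanishes:
  assumes "2 \<le> n" shows "(profile n \<longlongrightarrow> 0) at_top"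
  unfolding profile_def[abs_def]
proof (rule tendsto_neg_powr)
  show "filterlim (\<lambda>y::real. 1 + y ^ n) at_top at_top"
    using assms by (intro filterlim_tendsto_add_at_top[OF tendsto_const] filterlim_pow_at_top filterlim_ident) auto
qed (use assms in simp)

lemma soft_step_tail_dominated:
  assumes "0 < T" shows "tail_dominated 1 (\<lambda>x. soft_step n (ln (1 + x) / T) * step_tail x)"
  unfolding tail_dominated_def
proof (intro conjI allI impI)
  fix x :: real assume "0 \<le> x"
  then have y: "0 \<le> ln (1 + x) / T" using assms by simp
  have "soft_step n (ln (1 + x) / T) \<le> 1"
    using soft_step_le(2)[OF y, of n] one_plus_power_pos[OF y, of n] y
    by (smt (verit) divide_le_eq_1 zero_le_power)
  then show "\<bar>soft_step n (ln (1 + x) / T) * step_tail x\<bar> \<le> 1 * step_tail x"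
    using soft_step_le(1)[OF y, of n] mult_right_mono[of _ 1 "step_tail x"] by (simp add: abs_mult)
qed simp

text \<open>
  The heart of the matter: the expected value of the soft indicator of \<open>ln (1 + U) <
  T\<close>, up to \<open>O(1 / T)\<close>, for all starting points at once.
\<close>

lemma green_soft_step:
  assumes n: "2 \<le> n"
  obtains C where "0 \<le> C" "\<And>T s. 1 \<le> T \<Longrightarrow> 0 \<le> s \<Longrightarrow>
    \<bar>green (\<lambda>x. soft_step n (ln (1 + x) / T) * step_tail x) s - profile n (ln (1 + s) / T)\<bar> \<le> C / T"
proof
  define K where "K = 8 + 4 * (8 * real n)"
  show "0 \<le> 1800 * K" by (simp add: K_def)
  fix T s :: real assume T: "1 \<le> T" and s: "0 \<le> s"
  let ?h = "\<lambda>x. profile n (ln (1 + x) / T)"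
  have b1: "\<bar>profile' n z\<bar> \<le> 8 * real n / (1 + z)" if "0 \<le> z" for z
  proof -
    have "1 / (1 + z) \<le> 8 * real n / (1 + z)" using n that by (intro divide_right_mono) auto
    then show ?thesis using profile'_bound[OF n that] by linarith
  qed
  show "\<bar>green (\<lambda>x. soft_step n (ln (1 + x) / T) * step_tail x) s - ?h s\<bar> \<le> 1800 * K / T"
  proof (rule green_potential)
    show "admissible ?h"
      using T profile_bounds by (intro admissibleI[where B = 1]) auto
    show "(?h \<longlongrightarrow> 0) at_top"
      using T by (intro filterlim_compose[OF profile_vanishes[OF n] ln_over_at_top]) simp
    show "tail_dominated 1 (\<lambda>x. soft_step n (ln (1 + x) / T) * step_tail x)"
      using T by (intro soft_step_tail_dominated) simp
  next
    fix z :: real assume z: "0 \<le> z"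
    have l: "0 \<le> ln (1 + z) / T" using z T by simp
    have "\<bar>?h z - kill_op ?h z - (profile n (ln (1 + z) / T) + 2 * (ln (1 + z) / T) * profile' n (ln (1 + z) / T)) * step_tail z\<bar>
        \<le> (1800 * K / T) * step_tail z"
    proof (rule log_profile_generator[where K = K])
      show "\<bar>profile n z\<bar> \<le> 1" if "0 \<le> z" for z using profile_bounds[OF that, of n] by simp
      show "\<bar>profile' n z\<bar> \<le> K" if "0 \<le> z" for z
      proof -
        have "8 * real n / (1 + z) \<le> 8 * real n / 1" using that by (intro divide_left_mono) auto
        then show ?thesis using b1[OF that] by (simp add: K_def)
      qed
      show "\<bar>profile n m - profile n l - profile' n l * (m - l)\<bar> \<le> K * ((m - l)\<^sup>2 / (1 + l))"
        if "0 \<le> l" "0 \<le> m" for l m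
        unfolding K_def
        by (rule decaying_taylor_remainder_le[OF profile_deriv[OF n] profile_deriv2[OF n] profile_bounds b1 profile''_bound[OF n] that])
    qed (use T z in auto)
    then show "\<bar>?h z - kill_op ?h z - soft_step n (ln (1 + z) / T) * step_tail z\<bar> \<le> (1800 * K / T) * step_tail z"
      unfolding profile_soft_step[OF n l] .
  qed (rule s)
qed

section \<open>The law of the undershoot on the logarithmic scale\<close>

text \<open>
  This and the next lemma show that the limit value of the profile is \<open>sqrt \<tau>\<close>
  up to a factor that tends to one as \<open>n\<close> grows.
\<close>

lemma profile_le_sqrt:
  assumes "2 \<le> n" "0 < \<tau>" shows "profile n (1 / \<tau>) \<le> sqrt \<tau>"
proof -
  have "profile n (1 / \<tau>) \<le> ((1 / \<tau>) ^ n) powr (- (1 / (2 * real n)))"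
    unfolding profile_def using assms by (intro powr_mono2') auto
  also have "\<dots> = (1 / \<tau>) powr (- (1 / 2))"
    using assms by (simp add: powr_powr flip: powr_realpow)
  also have "\<dots> = sqrt \<tau>" using assms by (simp add: powr_minus powr_half_sqrt real_sqrt_divide)
  finally show ?thesis .
qed

lemma sqrt_le_profile:
  assumes "2 \<le> n" "0 < \<tau>" "\<tau> \<le> 1" shows "2 powr (- (1 / (2 * real n))) * sqrt \<tau> \<le> profile n (1 / \<tau>)"
proof -
  have "sqrt \<tau> = (1 / \<tau>) powr (- (1 / 2))"
    using assms by (simp add: powr_minus powr_half_sqrt real_sqrt_divide)
  also have "\<dots> = ((1 / \<tau>) ^ n) powr (- (1 / (2 * real n)))"
    using assms by (simp add: powr_powr flip: powr_realpow)
  finally have "2 powr (- (1 / (2 * real n))) * sqrt \<tau> = (2 * (1 / \<tau>) ^ n) powr (- (1 / (2 * real n)))"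
    using assms by (simp add: powr_mult)
  also have "\<dots> \<le> profile n (1 / \<tau>)"
    unfolding profile_def using assms by (intro powr_mono2') (auto intro!: add_pos_nonneg one_le_power)
  finally show ?thesis .
qed

lemma soft_step_lower:
  assumes "2 \<le> n" "0 \<le> y" "y \<le> q" shows "1 \<le> (1 + q ^ n)\<^sup>2 * soft_step n y"
proof -
  have q: "0 \<le> q" using assms by simp
  have "1 + y ^ n \<le> 1 + q ^ n" using assms by (simp add: power_mono)
  then have "(1 + q ^ n) powr (-2) \<le> (1 + y ^ n) powr (-2)"
    using one_plus_power_pos[OF assms(2), of n] by (intro powr_mono2') auto
  also have "\<dots> \<le> soft_step n y"
    unfolding soft_step_def using assms by (intro powr_mono) (auto simp: field_simps)
  finally have "(1 + q ^ n)\<^sup>2 * (1 + q ^ n) powr (-2) \<le> (1 + q ^ n)\<^sup>2 * soft_step n y"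
    by (intro mult_left_mono) auto
  moreover have "(1 + q ^ n)\<^sup>2 * (1 + q ^ n) powr (-2) = 1"
    using one_plus_power_pos[OF q, of n] by (simp add: powr_minus powr_numeral)
  ultimately show ?thesis by simp
qed

text \<open>
  The reward \<open>1\<close> for being killed from a height of at most \<open>w\<close>.
\<close>

definition below :: "real \<Rightarrow> real \<Rightarrow> real" where
  "below w x = indicator {..w} x * step_tail x"

lemma below_tail_dominated: "tail_dominated 1 (below w)"
  by (auto simp: tail_dominated_def below_def[abs_def] indicator_def)

lemma step_tail_tail_dominated: "tail_dominated 1 step_tail"
  by (auto simp: tail_dominated_def)

text \<open>
  The scale \<open>T = \<tau> ln s\<close> places the soft threshold at \<open>s powr
  \<tau>\<close>, while the starting point has logarithmic height \<open>1 / \<tau>\<close>.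
\<close>

lemma green_profile_limit:
  assumes n: "2 \<le> n" and \<tau>: "0 < \<tau>"
  shows "((\<lambda>s. green (\<lambda>x. soft_step n (ln (1 + x) / (\<tau> * ln s)) * step_tail x) s) \<longlongrightarrow> profile n (1 / \<tau>)) at_top"
proof -
  obtain C where C: "0 \<le> C" "\<And>T s. 1 \<le> T \<Longrightarrow> 0 \<le> s \<Longrightarrow>
    \<bar>green (\<lambda>x. soft_step n (ln (1 + x) / T) * step_tail x) s - profile n (ln (1 + s) / T)\<bar> \<le> C / T"
    using green_soft_step[OF n] by blast
  let ?g = "\<lambda>s. green (\<lambda>x. soft_step n (ln (1 + x) / (\<tau> * ln s)) * step_tail x) s"
  have "((\<lambda>s::real. ln (1 + s) / ln s) \<longlongrightarrow> 1) at_top" by real_asymp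
  then have "((\<lambda>s::real. ln (1 + s) / ln s / \<tau>) \<longlongrightarrow> 1 / \<tau>) at_top"
    using \<tau> by (intro tendsto_divide tendsto_const) auto
  moreover have "ln (1 + s) / ln s / \<tau> = ln (1 + s) / (\<tau> * ln s)" for s :: real by simp
  ultimately have L: "((\<lambda>s::real. ln (1 + s) / (\<tau> * ln s)) \<longlongrightarrow> 1 / \<tau>) at_top" by (simp only:)
  have "isCont (profile n) (1 / \<tau>)"
    by (rule DERIV_isCont[OF profile_deriv]) (use n \<tau> in auto)
  then have P: "((\<lambda>s. profile n (ln (1 + s) / (\<tau> * ln s))) \<longlongrightarrow> profile n (1 / \<tau>)) at_top"
    using L by (rule isCont_tendsto_compose)
  have E: "((\<lambda>s. C / (\<tau> * ln s)) \<longlongrightarrow> 0) at_top"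
  proof -
    have "filterlim (\<lambda>s. \<tau> * ln s) at_top at_top"
      using \<tau> by (intro filterlim_tendsto_pos_mult_at_top[OF tendsto_const] ln_at_top)
    then show ?thesis by (intro real_tendsto_divide_at_top[OF tendsto_const])
  qed
  have D: "((\<lambda>s. ?g s - profile n (ln (1 + s) / (\<tau> * ln s))) \<longlongrightarrow> 0) at_top"
  proof (rule Lim_null_comparison[OF _ E])
    have "eventually (\<lambda>s. exp (1 / \<tau>) \<le> s) at_top" by (rule eventually_ge_at_top)
    then show "eventually (\<lambda>s. norm (?g s - profile n (ln (1 + s) / (\<tau> * ln s))) \<le> C / (\<tau> * ln s)) at_top"
    proof eventually_elim
      case (elim s)
      have s: "0 < s" using elim exp_gt_zero[of "1 / \<tau>"] by linarith
      have "1 / \<tau> \<le> ln s" using elim s by (simp add: ln_ge_iff)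
      then have "1 \<le> \<tau> * ln s" using \<tau> by (simp add: field_simps)
      then show ?case using C(2)[of "\<tau> * ln s" s] s by simp
    qed
  qed
  show ?thesis using tendsto_add[OF D P] by simp
qed

text \<open>
  The indicator of \<open>x \<le> s powr \<tau>\<close> is squeezed between soft indicators with
  thresholds \<open>\<tau>2\<close> slightly above and slightly below \<open>\<tau>\<close>. At a
  fixed gap the deviation of the soft from the sharp indicator is of order
  \<open>q\<^sup>n\<close> with \<open>q < 1\<close>. The order of the choices is the gap, then
  \<open>n\<close>, then \<open>s\<close>.
\<close>

lemma green_below_limit:
  assumes \<tau>: "0 \<le> \<tau>" "\<tau> \<le> 1"
  shows "((\<lambda>s. green (below (s powr \<tau>)) s) \<longlongrightarrow> sqrt \<tau>) at_top"
proof (rule order_tendstoI)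
  fix a assume a: "sqrt \<tau> < a"
  have pos: "0 < sqrt \<tau> + a" using a real_sqrt_ge_zero[OF \<tau>(1)] by linarith
  \<comment> \<open>the intermediate value \<open>b\<close> fixes the gap: \<open>\<tau>2\<close> is chosen with \<open>sqrt \<tau>2 = b\<close>\<close>
  define b where "b = (sqrt \<tau> + a) / 2"
  have b: "sqrt \<tau> < b" "b < a" "0 < b" using a pos by (simp_all add: b_def)
  define \<tau>2 where "\<tau>2 = b\<^sup>2"
  have "(sqrt \<tau>)\<^sup>2 < b\<^sup>2" using b \<tau> by (intro power_strict_mono) auto
  then have t2: "\<tau> < \<tau>2" "0 < \<tau>2" "sqrt \<tau>2 = b" using b \<tau> by (auto simp: \<tau>2_def)
  \<comment> \<open>room for the difference between \<open>ln (1 + s powr \<tau>)\<close> and \<open>\<tau> ln s\<close>\<close>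
  define \<tau>1 where "\<tau>1 = (\<tau> + \<tau>2) / 2"
  have t1: "\<tau> < \<tau>1" "\<tau>1 < \<tau>2" "0 < \<tau>1" using t2 \<tau> by (auto simp: \<tau>1_def)
  define q where "q = \<tau>1 / \<tau>2"
  have q: "0 < q" "q < 1" using t1 t2 by (auto simp: q_def)
  have "(\<lambda>n. (1 + q ^ n)\<^sup>2 * b) \<longlonglongrightarrow> (1 + 0)\<^sup>2 * b"
    using q by (intro tendsto_intros LIMSEQ_power_zero) auto
  then have "eventually (\<lambda>n. (1 + q ^ n)\<^sup>2 * b < a) sequentially" using b by (intro order_tendstoD(2)) auto
  then have "eventually (\<lambda>n. (1 + q ^ n)\<^sup>2 * b < a \<and> 2 \<le> n) sequentially"
    using eventually_ge_at_top[of "2::nat"] by eventually_elim auto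
  then obtain n where n: "(1 + q ^ n)\<^sup>2 * b < a" "2 \<le> n" by (auto simp: eventually_sequentially)
  let ?\<rho> = "\<lambda>s x. soft_step n (ln (1 + x) / (\<tau>2 * ln s)) * step_tail x"
  have "((\<lambda>s. (1 + q ^ n)\<^sup>2 * green (?\<rho> s) s) \<longlongrightarrow> (1 + q ^ n)\<^sup>2 * profile n (1 / \<tau>2)) at_top"
    by (intro tendsto_mult_left green_profile_limit n t2)
  moreover have "(1 + q ^ n)\<^sup>2 * profile n (1 / \<tau>2) < a"
  proof -
    have "(1 + q ^ n)\<^sup>2 * profile n (1 / \<tau>2) \<le> (1 + q ^ n)\<^sup>2 * b"
      using profile_le_sqrt[OF n(2) t2(2)] t2 by (intro mult_left_mono) auto
    then show ?thesis using n by linarith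
  qed
  ultimately have "eventually (\<lambda>s. (1 + q ^ n)\<^sup>2 * green (?\<rho> s) s < a) at_top"
    by (rule order_tendstoD(2))
  moreover have "eventually (\<lambda>s::real. ln (1 + s powr \<tau>) / ln s < \<tau>1) at_top"
  proof (rule order_tendstoD(2)[OF _ t1(1)])
    show "((\<lambda>s::real. ln (1 + s powr \<tau>) / ln s) \<longlongrightarrow> \<tau>) at_top"
    proof (cases "\<tau> = 0")
      case True
      have "((\<lambda>s::real. ln (1 + 1) / ln s) \<longlongrightarrow> 0) at_top" by real_asymp
      moreover have "eventually (\<lambda>s::real. ln (1 + 1) / ln s = ln (1 + s powr \<tau>) / ln s) at_top"
        using eventually_gt_at_top[of "0::real"] by eventually_elim (simp add: True)
      ultimately have "((\<lambda>s::real. ln (1 + s powr \<tau>) / ln s) \<longlongrightarrow> 0) at_top"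
        by (rule Lim_transform_eventually)
      then show ?thesis using True by simp
    next
      case False
      then have "0 < \<tau>" using \<tau> by simp
      then show ?thesis by real_asymp
    qed
  qed
  moreover have "eventually (\<lambda>s::real. 1 < s) at_top" by (rule eventually_gt_at_top)
  ultimately show "eventually (\<lambda>s. green (below (s powr \<tau>)) s < a) at_top"
  proof eventually_elim
    case (elim s)
    have ls: "0 < ln s" using elim by simp
    have \<rho>: "tail_dominated 1 (?\<rho> s)" using ls t2 by (intro soft_step_tail_dominated) simp
    note \<rho>' = tail_dominated_linear[OF \<rho> \<rho>, of "(1 + q ^ n)\<^sup>2" 0]
    have "green (below (s powr \<tau>)) s \<le> green (\<lambda>z. (1 + q ^ n)\<^sup>2 * ?\<rho> s z + 0 * ?\<rho> s z) s"
    proof (rule green_mono[OF below_tail_dominated \<rho>'])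
      fix z :: real assume z: "0 \<le> z"
      define y where "y = ln (1 + z) / (\<tau>2 * ln s)"
      have y: "0 \<le> y" using z ls t2 by (simp add: y_def)
      show "below (s powr \<tau>) z \<le> (1 + q ^ n)\<^sup>2 * ?\<rho> s z + 0 * ?\<rho> s z"
      proof (cases "z \<le> s powr \<tau>")
        case True
        have "ln (1 + z) \<le> ln (1 + s powr \<tau>)" using z True by (intro ln_mono) auto
        also have "\<dots> \<le> \<tau>1 * ln s" using elim ls by (simp add: field_simps)
        finally have "y \<le> \<tau>1 * ln s / (\<tau>2 * ln s)" unfolding y_def using ls t2 by (intro divide_right_mono) auto
        then have "y \<le> q" using ls by (simp add: q_def)
        then have "1 * step_tail z \<le> (1 + q ^ n)\<^sup>2 * soft_step n y * step_tail z"
          by (intro mult_right_mono soft_step_lower n y) auto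
        then show ?thesis using True by (simp add: below_def y_def mult.assoc)
      next
        case False
        then show ?thesis using soft_step_le(1)[OF y, of n] by (simp add: below_def y_def)
      qed
    qed (use elim in simp)
    also have "\<dots> = (1 + q ^ n)\<^sup>2 * green (?\<rho> s) s"
      using green_linear[OF \<rho> \<rho>, of s "(1 + q ^ n)\<^sup>2" 0] elim by simp
    finally show ?case using elim by linarith
  qed
next
  fix a assume a: "a < sqrt \<tau>"
  show "eventually (\<lambda>s. a < green (below (s powr \<tau>)) s) at_top"
  proof (cases "a < 0")
    case True
    have nonneg: "0 \<le> green (below (s powr \<tau>)) s" if "0 \<le> s" for s
    proof -
      have "0 \<le> (kill_op ^^ n) (below (s powr \<tau>)) s" for n
        using that by (intro kill_pow_nonneg tail_dominated_admissible[OF below_tail_dominated]) (auto simp: below_def)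
      then show ?thesis unfolding green_def
        using that by (intro suminf_nonneg green_summable[OF below_tail_dominated]) auto
    qed
    show ?thesis
      using eventually_ge_at_top[of "0::real"]
    proof eventually_elim
      case (elim s)
      then show ?case using nonneg[of s] True by linarith
    qed
  next
    case a0: False
    define b where "b = (sqrt \<tau> + a) / 2"
    have b: "b < sqrt \<tau>" "a < b" "0 < b" using a a0 by (auto simp: b_def)
    define \<tau>2 where "\<tau>2 = b\<^sup>2"
    have "b\<^sup>2 < (sqrt \<tau>)\<^sup>2" using b \<tau> by (intro power_strict_mono) auto
    then have t2: "\<tau>2 < \<tau>" "0 < \<tau>2" "sqrt \<tau>2 = b" "\<tau>2 \<le> 1" using b \<tau> by (auto simp: \<tau>2_def)
    define q where "q = \<tau>2 / \<tau>"
    have q: "0 < q" "q < 1" using t2 \<tau> by (auto simp: q_def)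
    have "(\<lambda>n. 2 powr (- (1 / (2 * real n))) * b - q ^ n) \<longlonglongrightarrow> 2 powr (- 0) * b - 0"
    proof (intro tendsto_intros LIMSEQ_power_zero)
      show "(\<lambda>n. 1 / (2 * real n)) \<longlonglongrightarrow> 0" by real_asymp
    qed (use q in auto)
    then have "eventually (\<lambda>n. a < 2 powr (- (1 / (2 * real n))) * b - q ^ n) sequentially"
      using b by (intro order_tendstoD(1)) auto
    then have "eventually (\<lambda>n. a < 2 powr (- (1 / (2 * real n))) * b - q ^ n \<and> 2 \<le> n) sequentially"
      using eventually_ge_at_top[of "2::nat"] by eventually_elim auto
    then obtain n where n: "a < 2 powr (- (1 / (2 * real n))) * b - q ^ n" "2 \<le> n" by (auto simp: eventually_sequentially)
    let ?\<rho> = "\<lambda>s x. soft_step n (ln (1 + x) / (\<tau>2 * ln s)) * step_tail x"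
    have "((\<lambda>s. green (?\<rho> s) s - q ^ n) \<longlongrightarrow> profile n (1 / \<tau>2) - q ^ n) at_top"
      by (intro tendsto_diff tendsto_const green_profile_limit n t2)
    moreover have "a < profile n (1 / \<tau>2) - q ^ n"
      using sqrt_le_profile[OF n(2) t2(2,4)] n t2 by simp
    ultimately have "eventually (\<lambda>s. a < green (?\<rho> s) s - q ^ n) at_top"
      by (rule order_tendstoD(1))
    moreover have "eventually (\<lambda>s::real. 1 < s) at_top" by (rule eventually_gt_at_top)
    ultimately show ?thesis
    proof eventually_elim
      case (elim s)
      have ls: "0 < ln s" using elim by simp
      have \<rho>: "tail_dominated 1 (?\<rho> s)" using ls t2 by (intro soft_step_tail_dominated) simp
      let ?u = "\<lambda>z. 1 * below (s powr \<tau>) z + q ^ n * step_tail z"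
      have "green (?\<rho> s) s \<le> green ?u s"
      proof (rule green_mono[OF \<rho> tail_dominated_linear[OF below_tail_dominated step_tail_tail_dominated]])
        fix z :: real assume z: "0 \<le> z"
        define y where "y = ln (1 + z) / (\<tau>2 * ln s)"
        have y: "0 \<le> y" using z ls t2 by (simp add: y_def)
        have le1: "soft_step n y \<le> 1"
          using soft_step_le(2)[OF y, of n] y by (smt (verit) divide_le_eq_1 zero_le_power)
        have "soft_step n y \<le> indicator {..s powr \<tau>} z + q ^ n"
        proof (cases "z \<le> s powr \<tau>")
          case True
          then show ?thesis using le1 q by (simp add: add_increasing2)
        next
          case False
          have "\<tau> * ln s = ln (s powr \<tau>)" using elim by (simp add: ln_powr)
          also have "\<dots> \<le> ln (1 + z)" using False elim by (intro ln_mono) auto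
          finally have "\<tau> * ln s / (\<tau>2 * ln s) \<le> y" unfolding y_def using ls t2 by (intro divide_right_mono) auto
          then have qy: "1 / q \<le> y" using ls by (simp add: q_def)
          have "soft_step n y \<le> 1 / (1 + y ^ n)" by (rule soft_step_le[OF y])
          also have "\<dots> \<le> 1 / (1 / q) ^ n"
          proof (intro divide_left_mono)
            have "(1 / q) ^ n \<le> y ^ n" using qy q by (intro power_mono) auto
            then show "(1 / q) ^ n \<le> 1 + y ^ n" by simp
          qed (use q one_plus_power_pos[OF y, of n] in auto)
          also have "\<dots> = q ^ n" using q by (simp add: power_divide)
          finally show ?thesis using False by simp
        qed
        then have "soft_step n y * step_tail z \<le> (indicator {..s powr \<tau>} z + q ^ n) * step_tail z"
          by (intro mult_right_mono) auto
        then show "?\<rho> s z \<le> ?u z" by (simp add: below_def y_def distrib_right)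
      qed (use elim in simp)
      also have "\<dots> = 1 * green (below (s powr \<tau>)) s + q ^ n * green step_tail s"
        using elim by (intro green_linear[OF below_tail_dominated step_tail_tail_dominated]) simp
      also have "q ^ n * green step_tail s \<le> q ^ n"
        using green_abs_le[OF step_tail_tail_dominated, of s] elim q by (intro mult_left_le) auto
      finally show ?case using elim by linarith
    qed
  qed
qed

section \<open>The ratio of undershoot and jump\<close>

definition jump_ratio_prob :: "real \<Rightarrow> real \<Rightarrow> real" where
  "jump_ratio_prob v u = measure step_law {y. u < y \<and> u \<le> v * y}"

lemma jump_ratio_prob_measurable [measurable]: "jump_ratio_prob v \<in> borel_measurable borel"
proof -
  have "jump_ratio_prob v = (\<lambda>u. \<integral>y. indicat_real {p. fst p < snd p \<and> fst p \<le> v * snd p} (u, y) \<partial>step_law)"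
  proof
    fix u
    have "(\<integral>y. indicat_real {p. fst p < snd p \<and> fst p \<le> v * snd p} (u, y) \<partial>step_law)
        = (\<integral>y. indicat_real {y. u < y \<and> u \<le> v * y} y \<partial>step_law)"
      by (intro Bochner_Integration.integral_cong) (auto simp: indicator_def)
    then show "jump_ratio_prob v u = (\<integral>y. indicat_real {p. fst p < snd p \<and> fst p \<le> v * snd p} (u, y) \<partial>step_law)"
      by (simp add: jump_ratio_prob_def)
  qed
  moreover have [measurable]: "{p :: real \<times> real. fst p < snd p \<and> fst p \<le> v * snd p} \<in> sets (borel \<Otimes>\<^sub>M borel)"
  proof -
    have "{p \<in> space (borel \<Otimes>\<^sub>M borel). fst p < snd p \<and> fst p \<le> v * snd (p :: real \<times> real)}
        \<in> sets (borel \<Otimes>\<^sub>M borel)" by measurable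
    then show ?thesis by (simp add: space_pair_measure)
  qed
  ultimately show ?thesis by (simp only:) measurable
qed

lemma jump_ratio_prob_bounds: "0 \<le> jump_ratio_prob v u" "jump_ratio_prob v u \<le> step_tail u"
  unfolding jump_ratio_prob_def measure_step_law_greaterThan[symmetric]
  by (auto intro!: step_law.finite_measure_mono)

text \<open>
  The law has no atoms, so whether the bounds are strict is immaterial; for \<open>v < 1\<close>
  the condition \<open>u \<le> v y\<close> implies \<open>u < y\<close>.
\<close>

lemma jump_ratio_prob_eq:
  assumes "0 < v" "v \<le> 1" "0 < u" shows "jump_ratio_prob v u = step_tail (u / v)"
proof (cases "v = 1")
  case True
  then have "{y. u < y \<and> u \<le> v * y} = {u<..}" by auto
  then show ?thesis using True by (simp add: jump_ratio_prob_def measure_step_law_greaterThan)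
next
  case False
  have "u < y" if "u \<le> v * y" for y
  proof -
    have "0 < v * y" using that assms by linarith
    then have "0 < y" using assms by (simp add: zero_less_mult_iff)
    then have "v * y < 1 * y" using False assms by (intro mult_strict_right_mono) auto
    then show ?thesis using that by simp
  qed
  then have "{y. u < y \<and> u \<le> v * y} = {u / v..}" using assms by (auto simp: field_simps)
  then show ?thesis by (simp add: jump_ratio_prob_def measure_step_law_atLeast)
qed

lemma step_tail_regularly_varying:
  assumes "0 < (c::real)" shows "((\<lambda>u. step_tail (c * u) / step_tail u) \<longlongrightarrow> 1 / c\<^sup>2) at_top"
proof -
  have "((\<lambda>u. step_tail (c * u) / step_tail u) \<longlongrightarrow> 2 * (inverse \<bar>c\<bar> * inverse (\<bar>c\<bar> + c))) at_top"
    unfolding step_tail_alt using assms by real_asymp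
  moreover have "2 * (inverse \<bar>c\<bar> * inverse (\<bar>c\<bar> + c)) = 1 / c\<^sup>2"
    using assms by (simp add: power2_eq_square field_simps)
  ultimately show ?thesis by simp
qed

lemma jump_ratio_prob_asymp:
  assumes v: "0 \<le> v" "v \<le> 1" and e: "0 < e"
  obtains u0 where "\<And>u. u0 < u \<Longrightarrow> \<bar>jump_ratio_prob v u - v\<^sup>2 * step_tail u\<bar> \<le> e * step_tail u"
proof (cases "v = 0")
  case True
  have "jump_ratio_prob v u = 0" if "0 < u" for u
    using that True by (simp add: jump_ratio_prob_def)
  then show ?thesis using True e that[of 0] by simp
next
  case False
  then have "((\<lambda>u. step_tail (1 / v * u) / step_tail u) \<longlongrightarrow> 1 / (1 / v)\<^sup>2) at_top"
    using v by (intro step_tail_regularly_varying) auto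
  then have "eventually (\<lambda>u. dist (step_tail (1 / v * u) / step_tail u) (1 / (1 / v)\<^sup>2) < e) at_top"
    using e by (rule tendstoD)
  then have "eventually (\<lambda>u. \<bar>step_tail (u / v) / step_tail u - v\<^sup>2\<bar> < e) at_top"
    by (simp add: dist_real_def power_divide)
  then obtain u0 where u0: "\<And>u. u0 \<le> u \<Longrightarrow> \<bar>step_tail (u / v) / step_tail u - v\<^sup>2\<bar> < e"
    by (auto simp: eventually_at_top_linorder)
  show ?thesis
  proof (rule that[of "max u0 0"])
    fix u assume u: "max u0 0 < u"
    have "jump_ratio_prob v u - v\<^sup>2 * step_tail u = (step_tail (u / v) / step_tail u - v\<^sup>2) * step_tail u"
      using jump_ratio_prob_eq[of v u] False v u step_tail_pos[of u] by (simp add: left_diff_distrib)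
    also have "\<bar>\<dots>\<bar> = \<bar>step_tail (u / v) / step_tail u - v\<^sup>2\<bar> * step_tail u" by (simp add: abs_mult)
    also have "\<dots> \<le> e * step_tail u" using u0[of u] u by (intro mult_right_mono) auto
    finally show "\<bar>jump_ratio_prob v u - v\<^sup>2 * step_tail u\<bar> \<le> e * step_tail u" .
  qed
qed

text \<open>
  The probability that the next jump from height \<open>u\<close> kills and satisfies both
  constraints on undershoot and ratio.
\<close>

definition exit_reward :: "real \<Rightarrow> real \<Rightarrow> real \<Rightarrow> real" where
  "exit_reward w v u = indicator {..w} u * jump_ratio_prob v u"

lemma exit_reward_tail_dominated: "tail_dominated 1 (exit_reward w v)"
  using jump_ratio_prob_bounds by (auto simp: tail_dominated_def exit_reward_def[abs_def] indicator_def abs_le_iff intro: order_trans)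

lemma green_nonneg:
  assumes "tail_dominated C \<psi>" "\<And>z. 0 \<le> z \<Longrightarrow> 0 \<le> \<psi> z" "0 \<le> x" shows "0 \<le> green \<psi> x"
  unfolding green_def
  by (intro suminf_nonneg green_summable[OF assms(1)] kill_pow_nonneg tail_dominated_admissible[OF assms(1)] assms(2,3))

text \<open>
  A bounded height is below \<open>s powr \<tau>\<close> eventually, for every \<open>\<tau> >
  0\<close>, and \<open>sqrt \<tau>\<close> is arbitrarily small.
\<close>

lemma green_below_const: "((\<lambda>s. green (below u) s) \<longlongrightarrow> 0) at_top"
proof (rule order_tendstoI)
  fix a :: real assume "a < 0"
  have pos: "a < green (below u) s" if "0 \<le> s" for s
    using green_nonneg[OF below_tail_dominated[of u], of s] that \<open>a < 0\<close> by (force simp: below_def)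
  show "eventually (\<lambda>s. a < green (below u) s) at_top"
    using eventually_ge_at_top[of "0::real"] by eventually_elim (rule pos)
next
  fix a :: real assume a: "0 < a"
  define \<tau> where "\<tau> = min 1 ((a / 2)\<^sup>2)"
  have t: "0 < \<tau>" "\<tau> \<le> 1" using a by (auto simp: \<tau>_def)
  have "sqrt \<tau> \<le> sqrt ((a / 2)\<^sup>2)" by (simp add: \<tau>_def del: real_sqrt_abs)
  then have "sqrt \<tau> < a" using a by simp
  then have "eventually (\<lambda>s. green (below (s powr \<tau>)) s < a) at_top"
    using green_below_limit[of \<tau>] t by (intro order_tendstoD(2)) auto
  moreover have "eventually (\<lambda>s::real. u \<le> s powr \<tau>) at_top"
  proof -
    have "filterlim (\<lambda>s::real. s powr \<tau>) at_top at_top" using t(1) by real_asymp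
    then show ?thesis by (auto simp: filterlim_at_top)
  qed
  ultimately show "eventually (\<lambda>s. green (below u) s < a) at_top"
    using eventually_ge_at_top[of "0::real"]
  proof eventually_elim
    case (elim s)
    have "green (below u) s \<le> green (below (s powr \<tau>)) s"
      by (rule green_mono[OF below_tail_dominated below_tail_dominated])
         (use elim in \<open>auto simp: below_def indicator_def\<close>)
    then show ?case using elim by linarith
  qed
qed

text \<open>
  Replacing the ratio constraint by the factor \<open>v\<^sup>2\<close> costs at most \<open>e /
  2\<close> times the killing rate above some level \<open>u0\<close>, and at most the killing
  rate below it; killing from below \<open>u0\<close> has vanishing probability.
\<close>

lemma green_exit_reward_limit:
  assumes t: "0 \<le> t" "t \<le> 1" and v: "0 \<le> v" "v \<le> 1"
  shows "((\<lambda>s. green (exit_reward (s powr (t\<^sup>2)) v) s) \<longlongrightarrow> t * v\<^sup>2) at_top"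
proof -
  have "((\<lambda>s. v\<^sup>2 * green (below (s powr (t\<^sup>2))) s) \<longlongrightarrow> v\<^sup>2 * sqrt (t\<^sup>2)) at_top"
    using t by (intro tendsto_mult_left green_below_limit) (auto simp: power_le_one)
  then have lim: "((\<lambda>s. v\<^sup>2 * green (below (s powr (t\<^sup>2))) s) \<longlongrightarrow> t * v\<^sup>2) at_top"
    using t by (simp add: mult.commute)
  have "((\<lambda>s. green (exit_reward (s powr (t\<^sup>2)) v) s - v\<^sup>2 * green (below (s powr (t\<^sup>2))) s) \<longlongrightarrow> 0) at_top"
  proof (rule tendstoI)
    fix e :: real assume e: "0 < e"
    obtain u0 where u0: "\<And>u. u0 < u \<Longrightarrow> \<bar>jump_ratio_prob v u - v\<^sup>2 * step_tail u\<bar> \<le> e / 2 * step_tail u"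
      using jump_ratio_prob_asymp[OF v, of "e / 2"] e by auto
    have "eventually (\<lambda>s. green (below u0) s < e / 2) at_top"
      using e by (intro order_tendstoD(2)[OF green_below_const]) auto
    then show "eventually (\<lambda>s. dist (green (exit_reward (s powr (t\<^sup>2)) v) s - v\<^sup>2 * green (below (s powr (t\<^sup>2))) s) 0 < e) at_top"
      using eventually_ge_at_top[of "0::real"]
    proof eventually_elim
      case (elim s)
      define w where "w = s powr (t\<^sup>2)"
      note T1 = exit_reward_tail_dominated[of w v]
      note T2 = below_tail_dominated[of w]
      note T3 = below_tail_dominated[of u0]
      let ?d = "\<lambda>z. 1 * exit_reward w v z + (- (v\<^sup>2)) * below w z"
      let ?b = "\<lambda>z. e / 2 * step_tail z + 1 * below u0 z"
      note Td = tail_dominated_linear[OF T1 T2, of 1 "- (v\<^sup>2)"]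
      note Tb = tail_dominated_linear[OF step_tail_tail_dominated T3, of "e / 2" 1]
      note Tb' = tail_dominated_linear[OF Tb Tb, of "-1" 0]
      have pw: "\<bar>?d z\<bar> \<le> ?b z" if "0 \<le> z" for z
      proof -
        have "\<bar>?d z\<bar> \<le> \<bar>jump_ratio_prob v z - v\<^sup>2 * step_tail z\<bar>"
          by (simp add: exit_reward_def below_def indicator_def)
        also have "\<dots> \<le> ?b z"
        proof (cases "u0 < z")
          case True
          then show ?thesis using u0[OF True] by (simp add: below_def)
        next
          case False
          have "0 \<le> v\<^sup>2 * step_tail z" "v\<^sup>2 * step_tail z \<le> step_tail z"
            using v by (auto intro!: mult_left_le_one_le simp: power_le_one)
          then have "\<bar>jump_ratio_prob v z - v\<^sup>2 * step_tail z\<bar> \<le> step_tail z"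
            using jump_ratio_prob_bounds[of v z] by linarith
          also have "\<dots> \<le> ?b z" using False e by (simp add: below_def)
          finally show ?thesis .
        qed
        finally show ?thesis .
      qed
      have "green ?d s \<le> green ?b s"
        by (rule green_mono[OF Td Tb]) (use pw elim in \<open>auto simp: abs_le_iff\<close>)
      moreover have "green (\<lambda>z. (-1) * ?b z + 0 * ?b z) s \<le> green ?d s"
      proof (rule green_mono[OF Tb' Td])
        fix z :: real assume "0 \<le> z"
        moreover have "(-1) * B + 0 * B \<le> D" if "\<bar>D\<bar> \<le> B" for B D :: real
          using that by (auto simp: abs_le_iff)
        ultimately show "(-1) * ?b z + 0 * ?b z \<le> ?d z" using pw[of z] by blast
      qed (use elim in simp)
      moreover have "green (\<lambda>z. (-1) * ?b z + 0 * ?b z) s = (-1) * green ?b s + 0 * green ?b s"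
        using elim by (intro green_linear[OF Tb Tb])
      moreover have "green ?d s = 1 * green (exit_reward w v) s + (- (v\<^sup>2)) * green (below w) s"
        using elim by (intro green_linear[OF T1 T2])
      moreover have "green ?b s = e / 2 * green step_tail s + 1 * green (below u0) s"
        using elim by (intro green_linear[OF step_tail_tail_dominated T3])
      moreover have "e / 2 * green step_tail s \<le> e / 2"
        using green_abs_le[OF step_tail_tail_dominated, of s] elim e by (intro mult_left_le) auto
      ultimately show ?case unfolding w_def[symmetric] dist_real_def using elim by linarith
    qed
  qed
  from tendsto_add[OF this lim] show ?thesis by simp
qed

section \<open>The parity of the passage time\<close>

lemma kill_op_limit:
  assumes g: "\<And>n. admissible (g n)" "\<And>n z. 0 \<le> z \<Longrightarrow> \<bar>g n z\<bar> \<le> B"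
    and lim: "\<And>z. 0 \<le> z \<Longrightarrow> (\<lambda>n. g n z) \<longlonglongrightarrow> h z" and [measurable]: "h \<in> borel_measurable borel"
  shows "(\<lambda>n. kill_op (g n) x) \<longlonglongrightarrow> kill_op h x"
  unfolding kill_op_def
proof (rule integral_dominated_convergence[where w = "\<lambda>_. B"])
  note [measurable] = admissible_measurable[OF g(1)]
  show "(\<lambda>y. indicator {0..} (x + y) * g n (x + y)) \<in> borel_measurable step_law" for n by measurable
  have "0 \<le> B" using g(2)[of 0 0] by simp
  then show "AE y in step_law. norm (indicator {0..} (x + y) * g n (x + y)) \<le> B" for n
    using g(2) by (auto simp: indicator_def)
  have "(\<lambda>n. indicator {0..} (x + y) * g n (x + y)) \<longlonglongrightarrow> indicator {0..} (x + y) * h (x + y)" for y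
    using lim[of "x + y"] by (cases "0 \<le> x + y") auto
  then show "AE y in step_law. (\<lambda>n. indicator {0..} (x + y) * g n (x + y)) \<longlonglongrightarrow> indicator {0..} (x + y) * h (x + y)"
    by simp
qed auto

lemma kill_op_vanishes:
  assumes "admissible h" "(h \<longlongrightarrow> 0) at_top" shows "(kill_op h \<longlongrightarrow> 0) at_top"
proof -
  note [measurable] = admissible_measurable[OF assms(1)]
  obtain B where B: "0 \<le> B" "\<And>x. 0 \<le> x \<Longrightarrow> \<bar>h x\<bar> \<le> B" using admissible_bound[OF assms(1)] by blast
  have "((\<lambda>x. \<integral>y. indicator {0..} (x + y) * h (x + y) \<partial>step_law) \<longlongrightarrow> (\<integral>y. 0 \<partial>step_law)) at_top"
  proof (rule integral_dominated_convergence_at_top[where w = "\<lambda>_. B"])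
    have "((\<lambda>x. indicator {0..} (x + y) * h (x + y)) \<longlongrightarrow> 0) at_top" for y
    proof -
      have f: "filterlim (\<lambda>x::real. x + y) at_top at_top" by real_asymp
      have "((\<lambda>x. indicator {0..} x * h x) \<longlongrightarrow> 0) at_top"
        by (rule Lim_null_comparison[OF _ tendsto_norm_zero[OF assms(2)]]) (auto simp: indicator_def)
      then show ?thesis using f by (rule filterlim_compose)
    qed
    then show "AE y in step_law. ((\<lambda>x. indicator {0..} (x + y) * h (x + y)) \<longlongrightarrow> 0) at_top" by simp
    show "eventually (\<lambda>x. AE y in step_law. norm (indicator {0..} (x + y) * h (x + y)) \<le> B) at_top"
      using B by (auto simp: indicator_def intro!: always_eventually AE_I2)
  qed auto
  then show ?thesis by (simp add: kill_op_def[abs_def])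
qed

text \<open>
  The factor is \<open>3 powr (3 / 2) \<le> 6\<close>, as \<open>1 + (y - a)\<^sup>2 \<le> 3 (1 +
  y\<^sup>2)\<close>.
\<close>

lemma step_density_shift_le:
  assumes "\<bar>a\<bar> \<le> 1" shows "step_density y / 6 \<le> step_density (y - a)"
proof -
  define p where "p = 1 + y\<^sup>2"
  define q where "q = 1 + (y - a)\<^sup>2"
  have p: "0 < p" and q: "0 < q" by (simp_all add: p_def q_def)
  have "(y - a)\<^sup>2 \<le> (\<bar>y\<bar> + 1)\<^sup>2" using assms by (intro power2_le_iff_abs_le[THEN iffD2]) auto
  also have "\<dots> \<le> 2 * y\<^sup>2 + 2" using zero_le_power2[of "\<bar>y\<bar> - 1"] by (simp add: power2_sum power2_diff)
  also have "\<dots> \<le> 3 * y\<^sup>2 + 2" by simp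
  finally have qp: "q \<le> 3 * p" by (simp add: p_def q_def)
  have "sqrt q \<le> 2 * sqrt p"
    using qp p by (intro real_le_lsqrt) (auto simp: power_mult_distrib)
  with qp have "q * sqrt q \<le> (3 * p) * (2 * sqrt p)" using p q by (intro mult_mono) auto
  then have "1 / (2 * ((3 * p) * (2 * sqrt p))) \<le> 1 / (2 * (q * sqrt q))"
    using p q by (intro divide_left_mono mult_left_mono) auto
  moreover have "step_density y / 6 = 1 / (2 * ((3 * p) * (2 * sqrt p)))"
    by (simp add: step_density_def p_def mult_ac)
  moreover have "step_density (y - a) = 1 / (2 * (q * sqrt q))"
    by (simp add: step_density_def q_def mult_ac)
  ultimately show ?thesis by simp
qed

lemma step_law_shift_ge:
  fixes G :: "real \<Rightarrow> real"
  assumes [measurable]: "G \<in> borel_measurable borel" and G: "\<And>y. 0 \<le> G y" "\<And>y. G y \<le> B" and a: "\<bar>a\<bar> \<le> 1"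
  shows "(\<integral>y. G y \<partial>step_law) / 6 \<le> (\<integral>y. G (a + y) \<partial>step_law)"
proof -
  have Ib: "integrable step_law G" and Ia: "integrable step_law (\<lambda>y. G (a + y))"
    using G by (auto intro!: step_law.integrable_const_bound[where B = B] AE_I2)
  have I1: "integrable lborel (\<lambda>y. step_density y * G y)"
    using Ib by (simp add: step_law_def integrable_density)
  have "integrable lborel (\<lambda>y. step_density y * G (a + y))"
    using Ia by (simp add: step_law_def integrable_density)
  from lborel_integrable_real_affine[OF this, of 1 "-a"]
  have I2: "integrable lborel (\<lambda>y. step_density (y - a) * G y)" by (simp add: algebra_simps)
  have "(\<integral>y. G y \<partial>step_law) / 6 = (\<integral>y. step_density y / 6 * G y \<partial>lborel)"
    unfolding integral_step_law[OF assms(1)] integral_divide_zero[symmetric]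
    by (intro Bochner_Integration.integral_cong) auto
  also have "\<dots> \<le> (\<integral>y. step_density (y - a) * G y \<partial>lborel)"
    using I1 I2 by (intro integral_mono mult_right_mono step_density_shift_le a G) (auto simp: field_simps)
  also have "\<dots> = (\<integral>y. step_density y * G (a + y) \<partial>lborel)"
    using lborel_integral_real_affine[of 1 "\<lambda>y. step_density y * G (a + y)" "-a"] by (simp add: algebra_simps)
  also have "\<dots> = (\<integral>y. G (a + y) \<partial>step_law)" by (simp add: integral_step_law)
  finally show ?thesis .
qed

definition overlap :: real where "overlap = measure step_law {-1..1} / 6"

lemma overlap_pos: "0 < overlap"
proof -
  have "step_tail 0 \<le> measure step_law ({-1..1} \<union> {1<..})"
    unfolding measure_step_law_greaterThan[symmetric] by (intro step_law.finite_measure_mono) auto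
  also have "\<dots> \<le> measure step_law {-1..1} + step_tail 1"
    unfolding measure_step_law_greaterThan[symmetric] by (rule measure_Un_le) auto
  finally have "step_tail 0 \<le> measure step_law {-1..1} + step_tail 1" .
  moreover have "step_tail 0 = 1 / 2" "step_tail 1 < 1 / 2" by (simp_all add: step_tail_def)
  ultimately have "0 < measure step_law {-1..1}" by linarith
  then show ?thesis by (simp add: overlap_def)
qed

lemma overlap_le: "overlap \<le> 1"
proof -
  have "measure step_law {-1..1} \<le> 6" by (rule order_trans[OF step_law.prob_le_1]) simp
  then show ?thesis by (simp add: overlap_def)
qed

text \<open>
  With a probability bounded away from zero the first of two jumps has length at most one. It then
  does not kill, since \<open>x \<ge> 1\<close>, and it changes the law of the second landing
  point by at most a constant factor.
\<close>

lemma kill_op_twice_ge: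
  assumes g: "admissible g" "\<And>z. 0 \<le> z \<Longrightarrow> 0 \<le> g z" and x: "1 \<le> x"
  shows "overlap * kill_op g x \<le> kill_op (kill_op g) x"
proof -
  note [measurable] = admissible_measurable[OF g(1)]
  obtain B where B: "0 \<le> B" "\<And>x. 0 \<le> x \<Longrightarrow> \<bar>g x\<bar> \<le> B" using admissible_bound[OF g(1)] by blast
  let ?G = "\<lambda>y. indicator {0..} (x + y) * g (x + y)"
  have G: "0 \<le> ?G y" "?G y \<le> B" for y using g(2) B by (auto simp: indicator_def abs_le_iff)
  have K0: "0 \<le> kill_op g z" for z
    unfolding kill_op_def using g(2) by (intro integral_nonneg_AE AE_I2) (auto simp: indicator_def)
  have "overlap * kill_op g x = (\<integral>a. indicator {-1..1} a * (kill_op g x / 6) \<partial>step_law)"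
    by (simp add: overlap_def)
  also have "\<dots> \<le> (\<integral>a. indicator {0..} (x + a) * kill_op g (x + a) \<partial>step_law)"
  proof (intro integral_mono kill_op_integrable admissible_kill_op g)
    show "indicator {-1..1} a * (kill_op g x / 6) \<le> indicator {0..} (x + a) * kill_op g (x + a)" for a
    proof (cases "\<bar>a\<bar> \<le> 1")
      case True
      have "kill_op g x / 6 \<le> (\<integral>y. ?G (a + y) \<partial>step_law)"
        unfolding kill_op_def by (rule step_law_shift_ge[OF _ G True]) measurable
      also have "\<dots> = kill_op g (x + a)" by (simp add: kill_op_def add.assoc)
      finally show ?thesis using True x by (simp add: indicator_def abs_le_iff)
    next
      case False
      then show ?thesis using K0 by (auto simp: indicator_def)
    qed
    show "integrable step_law (\<lambda>a. indicator {-1..1} a * (kill_op g x / 6))"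
      by (intro integrable_mult_left integrable_real_indicator) (auto simp: step_law.emeasure_eq_measure)
  qed
  finally show ?thesis by (simp add: kill_op_def[of "kill_op g"])
qed

definition alternating_green :: "(real \<Rightarrow> real) \<Rightarrow> real \<Rightarrow> real" where
  "alternating_green \<psi> x = (\<Sum>n. (-1) ^ n * (kill_op ^^ n) \<psi> x)"

lemma alternating_green_sums:
  assumes "tail_dominated C \<psi>" "0 \<le> x"
  shows "(\<lambda>n. (-1) ^ n * (kill_op ^^ n) \<psi> x) sums alternating_green \<psi> x"
proof -
  have "summable (\<lambda>n. \<bar>(-1) ^ n * (kill_op ^^ n) \<psi> x\<bar>)"
    using green_summable(1)[OF assms] by (simp add: abs_mult)
  then show ?thesis unfolding alternating_green_def
    by (intro summable_sums) (rule summable_rabs_cancel)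
qed

lemma alternating_partial_sum_le:
  assumes "tail_dominated 1 \<psi>" "0 \<le> x"
  shows "\<bar>\<Sum>n<N. (-1) ^ n * (kill_op ^^ n) \<psi> x\<bar> \<le> 1"
proof -
  have "\<bar>\<Sum>n<N. (-1) ^ n * (kill_op ^^ n) \<psi> x\<bar> \<le> (\<Sum>n<N. \<bar>(kill_op ^^ n) \<psi> x\<bar>)"
    by (rule order_trans[OF sum_abs]) (simp add: abs_mult)
  also have "\<dots> \<le> (\<Sum>n<N. (kill_op ^^ n) step_tail x)"
    using kill_pow_tail_dominated[OF assms] by (intro sum_mono) auto
  also have "\<dots> \<le> (\<Sum>n. (kill_op ^^ n) step_tail x)"
    by (intro sum_le_suminf kill_pow_step_tail_summable assms kill_pow_nonneg) auto
  also have "\<dots> \<le> 1" by (rule kill_pow_step_tail_summable(2)[OF assms(2)])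
  finally show ?thesis .
qed

lemma alternating_green_abs_le:
  assumes "tail_dominated 1 \<psi>" "0 \<le> x" shows "\<bar>alternating_green \<psi> x\<bar> \<le> 1"
proof -
  have "(\<lambda>N. \<bar>\<Sum>n<N. (-1) ^ n * (kill_op ^^ n) \<psi> x\<bar>) \<longlonglongrightarrow> \<bar>alternating_green \<psi> x\<bar>"
    using alternating_green_sums[OF assms] unfolding sums_def by (rule tendsto_rabs)
  then show ?thesis by (rule LIMSEQ_le_const2) (use alternating_partial_sum_le[OF assms] in auto)
qed

lemma alternating_green_measurable:
  assumes "tail_dominated C \<psi>" shows "alternating_green \<psi> \<in> borel_measurable borel"
proof -
  have [measurable]: "(kill_op ^^ n) \<psi> \<in> borel_measurable borel" for n
    by (intro admissible_measurable admissible_kill_pow tail_dominated_admissible[OF assms])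
  show ?thesis unfolding alternating_green_def[abs_def] by measurable
qed

lemma admissible_alternating_green:
  assumes "tail_dominated 1 \<psi>" shows "admissible (alternating_green \<psi>)"
  by (rule admissibleI[where B = 1]) (auto intro: alternating_green_measurable[OF assms] alternating_green_abs_le[OF assms])

text \<open>
  Shifting the index in \<open>\<Sum> (-1)\<^sup>n K\<^sup>n \<psi>\<close> changes all signs;
  partial sums are bounded by one, so the kernel may be applied termwise.
\<close>

lemma kill_op_alternating_green:
  assumes \<psi>: "tail_dominated 1 \<psi>" and x: "0 \<le> x"
  shows "kill_op (alternating_green \<psi>) x = \<psi> x - alternating_green \<psi> x"
proof -
  define A where "A N z = (\<Sum>n<N. (-1) ^ n * (kill_op ^^ n) \<psi> z)" for N z
  note a\<psi> = tail_dominated_admissible[OF \<psi>]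
  have ag: "admissible (A N)" for N
  proof (rule admissibleI[where B = 1])
    have [measurable]: "(kill_op ^^ n) \<psi> \<in> borel_measurable borel" for n
      by (intro admissible_measurable admissible_kill_pow a\<psi>)
    show "A N \<in> borel_measurable borel" unfolding A_def[abs_def] by measurable
  qed (simp add: A_def alternating_partial_sum_le[OF \<psi>])
  have rec: "kill_op (A N) z = \<psi> z - A (Suc N) z" for N z
  proof (induction N)
    case 0
    have "A 0 = (\<lambda>_. 0)" by (simp add: A_def fun_eq_iff)
    then show ?case using kill_pow_zero[of 1 z] by (simp add: A_def)
  next
    case (Suc N)
    have "A (Suc N) = (\<lambda>z. 1 * A N z + (-1) ^ N * (kill_op ^^ N) \<psi> z)" by (simp add: A_def fun_eq_iff)
    then have "kill_op (A (Suc N)) z = kill_op (A N) z + (-1) ^ N * (kill_op ^^ Suc N) \<psi> z"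
      using kill_op_linear[OF ag admissible_kill_pow[OF a\<psi>], of 1 N "(-1) ^ N" N z] by simp
    also have "\<dots> = \<psi> z - A (Suc (Suc N)) z"
    proof -
      have "A (Suc (Suc N)) z = A (Suc N) z + (-1) ^ Suc N * (kill_op ^^ Suc N) \<psi> z" by (simp add: A_def)
      moreover have "(-1) ^ Suc N * (kill_op ^^ Suc N) \<psi> z = - ((-1) ^ N * (kill_op ^^ Suc N) \<psi> z)" by simp
      ultimately show ?thesis using Suc.IH by linarith
    qed
    finally show ?case .
  qed
  have lim: "(\<lambda>N. A N z) \<longlonglongrightarrow> alternating_green \<psi> z" if "0 \<le> z" for z
    using alternating_green_sums[OF \<psi> that] by (simp add: sums_def A_def)
  have "(\<lambda>N. kill_op (A N) x) \<longlonglongrightarrow> kill_op (alternating_green \<psi>) x"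
    by (rule kill_op_limit[where B = 1, OF ag _ lim alternating_green_measurable[OF \<psi>]])
       (simp add: A_def alternating_partial_sum_le[OF \<psi>])
  moreover have "(\<lambda>N. kill_op (A N) x) \<longlonglongrightarrow> \<psi> x - alternating_green \<psi> x"
    unfolding rec by (intro tendsto_intros LIMSEQ_Suc lim x)
  ultimately show ?thesis by (rule LIMSEQ_unique)
qed

text \<open>
  Uniformity in the reward is essential, because the reward in the theorem changes with
  \<open>s\<close>.
\<close>

definition parity_bound :: "real \<Rightarrow> bool" where
  "parity_bound \<beta> \<longleftrightarrow> (\<exists>x0. \<forall>\<psi> x. tail_dominated 1 \<psi> \<longrightarrow> x0 \<le> x \<longrightarrow> \<bar>alternating_green \<psi> x\<bar> \<le> \<beta>)"

text \<open>
  Let \<open>g\<close> be the alternating sum and \<open>\<sigma>\<close> a sign. Far out,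
  \<open>K g\<close> is nearly \<open>- g\<close> and \<open>K\<^sup>2 g\<close> nearly
  \<open>g\<close>, while constants are nearly preserved. Applied to \<open>\<beta> - \<sigma>
  g\<close>, which is nonnegative beyond \<open>x0\<close>, the domination of one step by two
  steps reads \<open>c (\<beta> + \<sigma> g) \<le> \<beta> - \<sigma> g\<close> up to a vanishing
  error. So \<open>(1 + c) \<sigma> g \<le> (1 - c) \<beta>\<close> up to that error, which is
  eventually below \<open>c \<beta>\<close>.
\<close>

lemma parity_bound_contract:
  assumes "parity_bound \<beta>" and \<beta>: "0 < \<beta>" "\<beta> \<le> 1"
  shows "parity_bound (\<beta> / (1 + overlap))"
proof -
  obtain x0 where x0: "\<And>\<psi> x. tail_dominated 1 \<psi> \<Longrightarrow> x0 \<le> x \<Longrightarrow> \<bar>alternating_green \<psi> x\<bar> \<le> \<beta>"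
    using assms(1) unfolding parity_bound_def by blast
  define c where "c = overlap"
  have c: "0 < c" "c \<le> 1" using overlap_pos overlap_le by (auto simp: c_def)
  \<comment> \<open>the bound \<open>\<beta>\<close> is only known beyond \<open>x0\<close>; below it, \<open>|g| \<le> 1\<close> is repaired by an indicator\<close>
  define \<iota> where "\<iota> z = (indicator {..<x0} z :: real)" for z
  have a\<iota>: "admissible \<iota>" by (rule admissibleI[where B = 1]) (auto simp: \<iota>_def[abs_def] indicator_def)
  have "eventually (\<lambda>z. \<iota> z = 0) at_top"
    using eventually_ge_at_top[of x0] by eventually_elim (simp add: \<iota>_def)
  then have "(\<iota> \<longlongrightarrow> 0) at_top" by (rule tendsto_eventually)
  then have l1: "(kill_op (kill_op \<iota>) \<longlongrightarrow> 0) at_top"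
    by (intro kill_op_vanishes admissible_kill_op a\<iota>)
  have l2: "(kill_op step_tail \<longlongrightarrow> 0) at_top"
    by (intro kill_op_vanishes step_tail_at_top) simp
  have "((\<lambda>x. 3 * step_tail x + kill_op step_tail x + kill_op (kill_op \<iota>) x) \<longlongrightarrow> 3 * 0 + 0 + 0) at_top"
    by (intro tendsto_intros l1 l2 step_tail_at_top)
  then have "eventually (\<lambda>x. 3 * step_tail x + kill_op step_tail x + kill_op (kill_op \<iota>) x < c * \<beta>) at_top"
    using c \<beta> by (intro order_tendstoD(2)) auto
  then obtain x1 where x1: "\<And>x. x1 \<le> x \<Longrightarrow> 3 * step_tail x + kill_op step_tail x + kill_op (kill_op \<iota>) x < c * \<beta>"
    by (auto simp: eventually_at_top_linorder)
  have one: "\<sigma> * alternating_green \<psi> x \<le> \<beta> / (1 + c)"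
    if \<psi>: "tail_dominated 1 \<psi>" and x: "max 1 x1 \<le> x" and \<sigma>: "\<sigma> = 1 \<or> \<sigma> = -1" for \<psi> x \<sigma>
  proof -
    define g where "g = alternating_green \<psi>"
    note a\<psi> = tail_dominated_admissible[OF \<psi>]
    note ag = admissible_alternating_green[OF \<psi>, folded g_def]
    have x': "0 \<le> x" "1 \<le> x" using x by auto
    have \<psi>x: "\<bar>\<psi> x\<bar> \<le> step_tail x" using \<psi> x' by (simp add: tail_dominated_def)
    have \<psi>K: "\<bar>kill_op \<psi> x\<bar> \<le> kill_op step_tail x"
      using kill_pow_tail_dominated[OF \<psi> x'(1), of 1] by simp
    define u where "u z = 1 * (\<beta> * 1 + (-\<sigma>) * g z) + 1 * \<iota> z" for z
    have au1: "admissible (\<lambda>z. \<beta> * 1 + (-\<sigma>) * g z)" by (intro admissible_linear ag) simp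
    have au: "admissible u" unfolding u_def by (intro admissible_linear au1 a\<iota>)
    have u0: "0 \<le> u z" if "0 \<le> z" for z
    proof -
      have "\<bar>g z\<bar> \<le> \<beta> + \<iota> z"
        using x0[OF \<psi>, of z] alternating_green_abs_le[OF \<psi> that] \<beta> by (auto simp: g_def \<iota>_def indicator_def)
      then show ?thesis using \<sigma> by (auto simp: u_def)
    qed
    have Ku: "kill_op u z = \<beta> * (1 - step_tail z) - \<sigma> * kill_op g z + kill_op \<iota> z" for z
      unfolding u_def by (subst kill_op_linear[OF au1 a\<iota>], subst kill_op_linear[OF _ ag]) (auto simp: kill_op_one)
    have Kg: "kill_op g z = \<psi> z - g z" if "0 \<le> z" for z
      unfolding g_def by (rule kill_op_alternating_green[OF \<psi> that])
    have K\<iota>: "0 \<le> kill_op \<iota> x"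
      unfolding kill_op_def by (intro integral_nonneg_AE AE_I2) (auto simp: \<iota>_def)
    have KKg: "kill_op (kill_op g) x = kill_op \<psi> x - (\<psi> x - g x)"
    proof -
      have "kill_op (kill_op g) x = kill_op (\<lambda>z. 1 * \<psi> z + (-1) * g z) x"
        unfolding kill_op_def[of "kill_op g"] kill_op_def[of "\<lambda>z. 1 * \<psi> z + (-1) * g z"]
        by (intro Bochner_Integration.integral_cong) (auto simp: Kg indicator_def)
      then show ?thesis using kill_op_linear[OF a\<psi> ag, of 1 "-1" x] Kg[OF x'(1)] by simp
    qed
    have KKu: "kill_op (kill_op u) x \<le> \<beta> - \<sigma> * kill_op (kill_op g) x + kill_op (kill_op \<iota>) x"
    proof -
      define r where "r z = \<beta> * 1 + (-\<sigma>) * kill_op g z" for z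
      have ar: "admissible r" unfolding r_def by (intro admissible_linear admissible_kill_op ag) simp
      have "kill_op (kill_op u) x \<le> kill_op (\<lambda>z. 1 * r z + 1 * kill_op \<iota> z) x"
        using \<beta> by (intro kill_op_mono admissible_kill_op au admissible_linear ar a\<iota>)
          (auto simp: Ku r_def algebra_simps)
      also have "\<dots> = kill_op r x + kill_op (kill_op \<iota>) x"
        using kill_op_linear[OF ar admissible_kill_op[OF a\<iota>], of 1 1 x] by simp
      also have "kill_op r x = \<beta> * (1 - step_tail x) - \<sigma> * kill_op (kill_op g) x"
        using kill_op_linear[OF _ admissible_kill_op[OF ag], of "\<lambda>_. 1" \<beta> "-\<sigma>" x] by (simp add: r_def[abs_def] kill_op_one)
      also have "\<beta> * (1 - step_tail x) \<le> \<beta>" using \<beta> by (simp add: mult_left_le)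
      finally show ?thesis by simp
    qed
    have "c * kill_op u x \<le> kill_op (kill_op u) x"
      unfolding c_def by (rule kill_op_twice_ge[OF au u0 x'(2)])
    moreover have "c * (\<beta> - 2 * step_tail x + \<sigma> * g x) \<le> c * kill_op u x"
    proof (rule mult_left_mono)
      have "\<beta> * step_tail x \<le> step_tail x" using \<beta> by (simp add: mult_left_le_one_le)
      moreover have "\<sigma> * \<psi> x \<le> step_tail x" using \<psi>x \<sigma> by auto
      ultimately show "\<beta> - 2 * step_tail x + \<sigma> * g x \<le> kill_op u x"
        unfolding Ku Kg[OF x'(1)] using K\<iota> by (simp add: algebra_simps)
    qed (use c in simp)
    moreover have "- \<sigma> * kill_op (kill_op g) x \<le> kill_op step_tail x + step_tail x - \<sigma> * g x"
      unfolding KKg using \<psi>x \<psi>K \<sigma> by auto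
    moreover have "c * (2 * step_tail x) \<le> 2 * step_tail x" using c by (intro mult_left_le_one_le) auto
    ultimately have "(1 + c) * (\<sigma> * g x) + c * \<beta> \<le> \<beta> + (3 * step_tail x + kill_op step_tail x + kill_op (kill_op \<iota>) x)"
      using KKu by (simp add: algebra_simps)
    then have "(1 + c) * (\<sigma> * g x) \<le> \<beta>" using x1[of x] x by linarith
    then show ?thesis using c by (simp add: g_def field_simps)
  qed
  have "\<bar>alternating_green \<psi> x\<bar> \<le> \<beta> / (1 + c)" if "tail_dominated 1 \<psi>" "max 1 x1 \<le> x" for \<psi> x
    using one[OF that, of 1] one[OF that, of "-1"] by (simp add: abs_le_iff)
  then show ?thesis unfolding parity_bound_def c_def by blast
qed

lemma parity_bound_all:
  assumes "0 < e" shows "parity_bound e"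
proof -
  define \<gamma> where "\<gamma> = 1 / (1 + overlap)"
  have \<gamma>: "0 < \<gamma>" "\<gamma> < 1" using overlap_pos by (auto simp: \<gamma>_def)
  have "parity_bound (\<gamma> ^ n)" for n
  proof (induction n)
    case 0
    show ?case unfolding parity_bound_def by (intro exI[of _ 0]) (simp add: alternating_green_abs_le)
  next
    case (Suc n)
    then have "parity_bound (\<gamma> ^ n / (1 + overlap))"
      using \<gamma> by (intro parity_bound_contract) (auto simp: power_le_one)
    then show ?case by (simp add: \<gamma>_def)
  qed
  moreover obtain n where "\<gamma> ^ n < e" using real_arch_pow_inv[OF assms \<gamma>(2)] by blast
  ultimately obtain x0 where "\<And>\<psi> x. tail_dominated 1 \<psi> \<Longrightarrow> x0 \<le> x \<Longrightarrow> \<bar>alternating_green \<psi> x\<bar> \<le> \<gamma> ^ n"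
    unfolding parity_bound_def by blast
  then show ?thesis using \<open>\<gamma> ^ n < e\<close> unfolding parity_bound_def by (meson less_imp_le order_trans)
qed

lemma alternating_green_vanishes:
  assumes "\<And>s. tail_dominated 1 (\<psi> s)"
  shows "((\<lambda>s. alternating_green (\<psi> s) s) \<longlongrightarrow> 0) at_top"
proof (rule tendstoI)
  fix e :: real assume "0 < e"
  then have "parity_bound (e / 2)" by (intro parity_bound_all) simp
  then obtain x0 where x0: "\<And>\<psi> x. tail_dominated 1 \<psi> \<Longrightarrow> x0 \<le> x \<Longrightarrow> \<bar>alternating_green \<psi> x\<bar> \<le> e / 2"
    unfolding parity_bound_def by blast
  show "eventually (\<lambda>s. dist (alternating_green (\<psi> s) s) 0 < e) at_top"
    using eventually_ge_at_top[of x0]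
  proof eventually_elim
    case (elim s)
    then show ?case using x0[OF assms elim, of s] \<open>0 < e\<close> by simp
  qed
qed

section \<open>From the random walk to the killing kernel\<close>

text \<open>
  The sums over even and over odd \<open>n\<close> are half the sum and half the difference of the
  plain and the alternating Green sum.
\<close>

lemma exit_reward_parity_limit:
  assumes t: "0 \<le> t" "t \<le> 1" and v: "0 \<le> v" "v \<le> 1"
  shows "((\<lambda>s. \<Sum>n. of_bool (even n = b) * (kill_op ^^ n) (exit_reward (s powr (t\<^sup>2)) v) s)
     \<longlongrightarrow> 1 / 2 * t * v\<^sup>2) at_top"
proof -
  let ?r = "\<lambda>s. exit_reward (s powr (t\<^sup>2)) v"
  define \<sigma> :: real where "\<sigma> = (if b then 1 else -1)"
  have eq: "(\<Sum>n. of_bool (even n = b) * (kill_op ^^ n) (?r s) s) = (green (?r s) s + \<sigma> * alternating_green (?r s) s) / 2"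
    if s: "0 \<le> s" for s
  proof -
    have "(\<lambda>n. ((kill_op ^^ n) (?r s) s + \<sigma> * ((-1) ^ n * (kill_op ^^ n) (?r s) s)) / 2)
        sums ((green (?r s) s + \<sigma> * alternating_green (?r s) s) / 2)"
      by (intro sums_divide sums_add sums_mult green_sums[OF exit_reward_tail_dominated s]
          alternating_green_sums[OF exit_reward_tail_dominated s])
    moreover have "((kill_op ^^ n) (?r s) s + \<sigma> * ((-1) ^ n * (kill_op ^^ n) (?r s) s)) / 2
        = of_bool (even n = b) * (kill_op ^^ n) (?r s) s" for n
      by (cases "even n"; cases b) (auto simp: \<sigma>_def)
    ultimately show ?thesis by (simp add: sums_iff)
  qed
  have "((\<lambda>s. (green (?r s) s + \<sigma> * alternating_green (?r s) s) / 2) \<longlongrightarrow> (t * v\<^sup>2 + \<sigma> * 0) / 2) at_top"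
    by (intro tendsto_intros green_exit_reward_limit alternating_green_vanishes exit_reward_tail_dominated t v) simp
  then have "((\<lambda>s. (green (?r s) s + \<sigma> * alternating_green (?r s) s) / 2) \<longlongrightarrow> 1 / 2 * t * v\<^sup>2) at_top"
    by simp
  then show ?thesis
    by (rule Lim_transform_eventually)
       (use eq in \<open>auto intro!: eventually_mono[OF eventually_ge_at_top[of "0::real"]]\<close>)
qed

context prob_space
begin

lemma tan_step_law:
  assumes \<Theta>: "distributed M lborel \<Theta> (\<lambda>\<theta>. ennreal (angle_density \<theta>))"
  shows "distr M borel (\<lambda>\<omega>. tan (\<Theta> \<omega>)) = step_law"
proof -
  have [measurable]: "\<Theta> \<in> borel_measurable M" using distributed_measurable[OF \<Theta>] by simp
  have [measurable]: "tan \<in> borel_measurable (borel :: real measure)"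
    unfolding tan_def[abs_def] by measurable
  interpret X: prob_space "distr M borel (\<lambda>\<omega>. tan (\<Theta> \<omega>))" by (rule prob_space_distr) measurable
  show ?thesis
  proof (rule measure_eqI_lessThan)
    fix x :: real
    show "emeasure (distr M borel (\<lambda>\<omega>. tan (\<Theta> \<omega>))) {x<..} < \<infinity>"
      by (simp add: X.emeasure_eq_measure)
    have sin: "sin (arctan x) = x / sqrt (1 + x\<^sup>2)" by (simp add: sin_arctan)
    have "emeasure (distr M borel (\<lambda>\<omega>. tan (\<Theta> \<omega>))) {x<..} = emeasure M (\<Theta> -` {\<theta>. x < tan \<theta>} \<inter> space M)"
      by (subst emeasure_distr) (auto intro!: arg_cong[where f = "emeasure M"])
    also have "\<dots> = (\<integral>\<^sup>+\<theta>. ennreal (angle_density \<theta>) * indicator {\<theta>. x < tan \<theta>} \<theta> \<partial>lborel)"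
      by (intro distributed_emeasure[OF \<Theta>]) measurable
    \<comment> \<open>inside the support the tangent is increasing; the two endpoints are null\<close>
    also have "\<dots> = (\<integral>\<^sup>+\<theta>. ennreal (cos \<theta> / 2) * indicator {arctan x..pi / 2} \<theta> \<partial>lborel)"
    proof (intro nn_integral_cong_AE)
      have "AE \<theta> in lborel. \<theta> \<noteq> arctan x \<and> \<theta> \<noteq> pi / 2"
        using AE_lborel_singleton[of "arctan x"] AE_lborel_singleton[of "pi / 2"] by eventually_elim auto
      then show "AE \<theta> in lborel. ennreal (angle_density \<theta>) * indicator {\<theta>. x < tan \<theta>} \<theta>
          = ennreal (cos \<theta> / 2) * indicator {arctan x..pi / 2} \<theta>"
      proof eventually_elim
        case (elim \<theta>)
        have b: "- (pi / 2) < arctan x" "arctan x < pi / 2" using arctan_bounded[of x] by auto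
        show ?case
        proof (cases "- (pi / 2) < \<theta> \<and> \<theta> < pi / 2")
          case True
          have "x < tan \<theta> \<longleftrightarrow> arctan x < \<theta>"
            using True arctan_less_iff[of x "tan \<theta>"] arctan_tan[of \<theta>] by simp
          then show ?thesis using True elim by (auto simp: angle_density_def indicator_def)
        next
          case False
          then show ?thesis using elim b by (auto simp: angle_density_def indicator_def)
        qed
      qed
    qed
    also have "\<dots> = ennreal (sin (pi / 2) / 2 - sin (arctan x) / 2)"
    proof (rule nn_integral_FTC_Icc)
      fix \<theta> assume "\<theta> \<in> {arctan x..pi / 2}"
      then show "0 \<le> cos \<theta> / 2" using arctan_lbound[of x] by (intro divide_nonneg_nonneg cos_ge_zero) auto
      show "((\<lambda>\<theta>. sin \<theta> / 2) has_real_derivative cos \<theta> / 2) (at \<theta>)"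
        by (auto intro!: derivative_eq_intros)
    qed (use arctan_ubound[of x] in \<open>auto intro: less_imp_le\<close>)
    also have "\<dots> = emeasure step_law {x<..}"
      by (simp add: emeasure_step_law_greaterThan step_tail_def sin diff_divide_distrib)
    finally show "emeasure (distr M borel (\<lambda>\<omega>. tan (\<Theta> \<omega>))) {x<..} = emeasure step_law {x<..}" .
  qed auto
qed

end

locale iid_walk = prob_space +
  fixes X :: "nat \<Rightarrow> 'a \<Rightarrow> real"
  assumes indep: "indep_vars (\<lambda>_. borel) X {1..}"
    and law: "\<And>n. 1 \<le> n \<Longrightarrow> distr M borel (X n) = step_law"
begin

lemma X_measurable [measurable]: "1 \<le> n \<Longrightarrow> X n \<in> borel_measurable M"
  using indep unfolding indep_vars_def2 by auto

text \<open>
  The height below the barrier while it has not been passed, and a negative marker afterwards.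
  Absorbing the history into one real variable makes a single independence statement suffice.
\<close>

definition killed_height :: "real \<Rightarrow> nat \<Rightarrow> 'a \<Rightarrow> real" where
  "killed_height s n \<omega> = (if \<forall>k\<in>{1..n}. walk X k \<omega> \<le> s then s - walk X n \<omega> else -1)"

lemma walk_measurable [measurable]: "walk X n \<in> borel_measurable M"
  unfolding walk_def[abs_def] by (intro borel_measurable_sum X_measurable) auto

lemma killed_height_measurable [measurable]: "killed_height s n \<in> borel_measurable M"
  unfolding killed_height_def[abs_def] by measurable

lemma killed_height_indep: "indep_var borel (killed_height s n) borel (X (Suc n))"
proof -
  have "indep_var (PiM {1..n} (\<lambda>_. borel)) (\<lambda>\<omega>. restrict (\<lambda>i. X i \<omega>) {1..n})
      (PiM {Suc n} (\<lambda>_. borel)) (\<lambda>\<omega>. restrict (\<lambda>i. X i \<omega>) {Suc n})"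
    by (rule indep_var_restrict[OF indep]) auto
  moreover define G where "G p = (if \<forall>k\<in>{1..n}. (\<Sum>i=1..k. p i) \<le> s then s - (\<Sum>i=1..n. p i) else -1)" for p :: "nat \<Rightarrow> real"
  have [measurable]: "(\<lambda>p. \<Sum>i=1..k. p i) \<in> borel_measurable (PiM {1..n} (\<lambda>_. borel :: real measure))" if "k \<le> n" for k
    using that by (intro borel_measurable_sum measurable_component_singleton) auto
  have "G \<in> borel_measurable (PiM {1..n} (\<lambda>_. borel :: real measure))"
    unfolding G_def[abs_def] by measurable
  moreover have "(\<lambda>p. p (Suc n)) \<in> borel_measurable (PiM {Suc n} (\<lambda>_. borel :: real measure))"
    by (intro measurable_component_singleton) auto
  ultimately have "indep_var borel (G \<circ> (\<lambda>\<omega>. restrict (\<lambda>i. X i \<omega>) {1..n}))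
      borel ((\<lambda>p. p (Suc n)) \<circ> (\<lambda>\<omega>. restrict (\<lambda>i. X i \<omega>) {Suc n}))"
    by (rule indep_var_compose)
  moreover have "G \<circ> (\<lambda>\<omega>. restrict (\<lambda>i. X i \<omega>) {1..n}) = killed_height s n"
  proof
    fix \<omega>
    have "(\<Sum>i=1..k. restrict (\<lambda>i. X i \<omega>) {1..n} i) = walk X k \<omega>" if "k \<le> n" for k
      unfolding walk_def using that by (intro sum.cong) auto
    then show "(G \<circ> (\<lambda>\<omega>. restrict (\<lambda>i. X i \<omega>) {1..n})) \<omega> = killed_height s n \<omega>"
      by (simp add: G_def killed_height_def)
  qed
  moreover have "(\<lambda>p. p (Suc n)) \<circ> (\<lambda>\<omega>. restrict (\<lambda>i. X i \<omega>) {Suc n}) = X (Suc n)" by auto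
  ultimately show ?thesis by simp
qed

text \<open>
  The next step is independent of the current height, so it can be integrated out first.
\<close>

lemma expectation_next_step:
  fixes F :: "real \<times> real \<Rightarrow> real"
  assumes [measurable]: "F \<in> borel_measurable (borel \<Otimes>\<^sub>M borel)" and B: "\<And>p. \<bar>F p\<bar> \<le> B"
  shows "expectation (\<lambda>\<omega>. F (killed_height s n \<omega>, X (Suc n) \<omega>))
    = expectation (\<lambda>\<omega>. \<integral>y. F (killed_height s n \<omega>, y) \<partial>step_law)"
proof -
  let ?D = "distr M borel (killed_height s n)"
  interpret D: prob_space ?D by (rule prob_space_distr) measurable
  interpret P: pair_prob_space ?D step_law ..
  have joint: "distr M (borel \<Otimes>\<^sub>M borel) (\<lambda>\<omega>. (killed_height s n \<omega>, X (Suc n) \<omega>)) = ?D \<Otimes>\<^sub>M step_law"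
    using indep_var_distribution_eq[THEN iffD1, OF killed_height_indep] by (simp add: law)
  have I: "integrable (?D \<Otimes>\<^sub>M step_law) F"
    by (intro P.integrable_const_bound[where B = B]) (auto simp: B)
  have "expectation (\<lambda>\<omega>. F (killed_height s n \<omega>, X (Suc n) \<omega>))
      = integral\<^sup>L (distr M (borel \<Otimes>\<^sub>M borel) (\<lambda>\<omega>. (killed_height s n \<omega>, X (Suc n) \<omega>))) F"
    by (subst integral_distr) auto
  also have "\<dots> = (\<integral>x. \<integral>y. F (x, y) \<partial>step_law \<partial>?D)"
    unfolding joint by (rule P.integral_fst'[OF I, symmetric])
  also have "\<dots> = expectation (\<lambda>\<omega>. \<integral>y. F (killed_height s n \<omega>, y) \<partial>step_law)"
    by (subst integral_distr) auto
  finally show ?thesis .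
qed

lemma killed_height_Suc:
  "killed_height s (Suc n) \<omega> =
    (if 0 \<le> killed_height s n \<omega> \<and> 0 \<le> killed_height s n \<omega> - X (Suc n) \<omega>
     then killed_height s n \<omega> - X (Suc n) \<omega> else -1)"
  if "0 \<le> s"
proof -
  have w: "walk X (Suc n) \<omega> = walk X n \<omega> + X (Suc n) \<omega>" by (simp add: walk_def)
  have a: "(\<forall>k\<in>{1..Suc n}. walk X k \<omega> \<le> s) \<longleftrightarrow> (\<forall>k\<in>{1..n}. walk X k \<omega> \<le> s) \<and> walk X (Suc n) \<omega> \<le> s"
    by (auto simp: le_Suc_eq)
  have b: "walk X n \<omega> \<le> s" if "\<forall>k\<in>{1..n}. walk X k \<omega> \<le> s"
    using that \<open>0 \<le> s\<close> by (cases "n = 0") (auto simp: walk_def)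
  show ?thesis using b unfolding killed_height_def a by (auto simp: w)
qed

text \<open>
  Peeling off the last step applies the kernel to the test function; the walk moves down by
  \<open>X\<close> and the kernel moves up, which agrees by symmetry of the law.
\<close>

lemma expectation_killed_height:
  assumes s: "0 \<le> s" and g: "admissible g"
  shows "expectation (\<lambda>\<omega>. indicator {0..} (killed_height s n \<omega>) * g (killed_height s n \<omega>)) = (kill_op ^^ n) g s"
  using g
proof (induction n arbitrary: g)
  case 0
  have "killed_height s 0 \<omega> = s" for \<omega> by (simp add: killed_height_def walk_def)
  then show ?case using s by (simp add: prob_space)
next
  case (Suc n)
  note [measurable] = admissible_measurable[OF Suc.prems]
  obtain B where B: "0 \<le> B" "\<And>x. 0 \<le> x \<Longrightarrow> \<bar>g x\<bar> \<le> B" using admissible_bound[OF Suc.prems] by blast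
  define F where "F p = indicator {0..} (fst p) * (indicator {0..} (fst p - snd p) * g (fst p - snd p))" for p :: "real \<times> real"
  have F_m: "F \<in> borel_measurable (borel \<Otimes>\<^sub>M borel)" unfolding F_def[abs_def] by measurable
  have F_b: "\<bar>F p\<bar> \<le> B" for p using B by (auto simp: F_def indicator_def)
  have "indicator {0..} (killed_height s (Suc n) \<omega>) * g (killed_height s (Suc n) \<omega>) = F (killed_height s n \<omega>, X (Suc n) \<omega>)" for \<omega>
    by (auto simp: killed_height_Suc[OF s] F_def indicator_def)
  then have "expectation (\<lambda>\<omega>. indicator {0..} (killed_height s (Suc n) \<omega>) * g (killed_height s (Suc n) \<omega>))
      = expectation (\<lambda>\<omega>. F (killed_height s n \<omega>, X (Suc n) \<omega>))" by simp
  also have "\<dots> = expectation (\<lambda>\<omega>. \<integral>y. F (killed_height s n \<omega>, y) \<partial>step_law)"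
    by (rule expectation_next_step[OF F_m F_b])
  also have "(\<lambda>\<omega>. \<integral>y. F (killed_height s n \<omega>, y) \<partial>step_law)
      = (\<lambda>\<omega>. indicator {0..} (killed_height s n \<omega>) * kill_op g (killed_height s n \<omega>))"
  proof
    fix \<omega>
    let ?h = "killed_height s n \<omega>"
    have "(\<integral>y. F (?h, y) \<partial>step_law) = indicator {0..} ?h * (\<integral>y. indicator {0..} (?h - y) * g (?h - y) \<partial>step_law)"
      by (simp add: F_def)
    also have "(\<integral>y. indicator {0..} (?h - y) * g (?h - y) \<partial>step_law) = kill_op g ?h"
      unfolding kill_op_def
      using integral_step_law_reflect[of "\<lambda>y. indicator {0..} (?h + y) * g (?h + y)"] by simp
    finally show "(\<integral>y. F (?h, y) \<partial>step_law) = indicator {0..} ?h * kill_op g ?h" .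
  qed
  also have "expectation \<dots> = (kill_op ^^ n) (kill_op g) s"
    by (rule Suc.IH[OF admissible_kill_op[OF Suc.prems]])
  finally show ?case by (simp add: funpow_swap1)
qed

lemma prob_exit_step:
  assumes s: "0 \<le> s"
  shows "prob {\<omega>\<in>space M. 0 \<le> killed_height s n \<omega> \<and> killed_height s n \<omega> < X (Suc n) \<omega>
      \<and> killed_height s n \<omega> \<le> w \<and> killed_height s n \<omega> \<le> v * X (Suc n) \<omega>}
    = (kill_op ^^ n) (exit_reward w v) s"
proof -
  define F where "F p = (of_bool (0 \<le> fst p \<and> fst p < snd p \<and> fst p \<le> w \<and> fst p \<le> v * snd p) :: real)" for p :: "real \<times> real"
  have F_m: "F \<in> borel_measurable (borel \<Otimes>\<^sub>M borel)" unfolding F_def[abs_def] by measurable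
  let ?A = "{\<omega>\<in>space M. 0 \<le> killed_height s n \<omega> \<and> killed_height s n \<omega> < X (Suc n) \<omega>
      \<and> killed_height s n \<omega> \<le> w \<and> killed_height s n \<omega> \<le> v * X (Suc n) \<omega>}"
  have "prob ?A = expectation (indicator ?A)" by simp
  also have "\<dots> = expectation (\<lambda>\<omega>. F (killed_height s n \<omega>, X (Suc n) \<omega>))"
    by (intro Bochner_Integration.integral_cong) (auto simp: F_def indicator_def)
  also have "\<dots> = expectation (\<lambda>\<omega>. \<integral>y. F (killed_height s n \<omega>, y) \<partial>step_law)"
    by (rule expectation_next_step[OF F_m, of 1]) (simp add: F_def)
  also have "(\<lambda>\<omega>. \<integral>y. F (killed_height s n \<omega>, y) \<partial>step_law)
      = (\<lambda>\<omega>. indicator {0..} (killed_height s n \<omega>) * exit_reward w v (killed_height s n \<omega>))"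
  proof
    fix \<omega>
    let ?h = "killed_height s n \<omega>"
    have "(\<integral>y. F (?h, y) \<partial>step_law)
        = (\<integral>y. (indicator {0..} ?h * indicator {..w} ?h) * indicat_real {y. ?h < y \<and> ?h \<le> v * y} y \<partial>step_law)"
      by (intro Bochner_Integration.integral_cong) (auto simp: F_def indicator_def)
    also have "\<dots> = indicator {0..} ?h * exit_reward w v ?h"
      by (simp add: exit_reward_def jump_ratio_prob_def)
    finally show "(\<integral>y. F (?h, y) \<partial>step_law) = indicator {0..} ?h * exit_reward w v ?h" .
  qed
  also have "expectation \<dots> = (kill_op ^^ n) (exit_reward w v) s"
    by (rule expectation_killed_height[OF s tail_dominated_admissible[OF exit_reward_tail_dominated]])
  finally show ?thesis .
qed

lemma passage_time_Suc:
  assumes s: "0 \<le> s"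
  shows "passage_time X s \<omega> = Suc n \<and> (\<exists>n>0. s < walk X n \<omega>)
    \<longleftrightarrow> 0 \<le> killed_height s n \<omega> \<and> killed_height s n \<omega> < X (Suc n) \<omega>"
proof -
  let ?N = "{n. 0 < n \<and> s < walk X n \<omega>}"
  have w: "walk X (Suc n) \<omega> = walk X n \<omega> + X (Suc n) \<omega>" by (simp add: walk_def)
  have b: "walk X n \<omega> \<le> s" if "\<forall>k\<in>{1..n}. walk X k \<omega> \<le> s"
    using that s by (cases "n = 0") (auto simp: walk_def)
  have rhs: "0 \<le> killed_height s n \<omega> \<and> killed_height s n \<omega> < X (Suc n) \<omega>
     \<longleftrightarrow> (\<forall>k\<in>{1..n}. walk X k \<omega> \<le> s) \<and> s < walk X (Suc n) \<omega>"
    using b by (auto simp: killed_height_def w)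
  show ?thesis unfolding rhs
  proof
    assume l: "passage_time X s \<omega> = Suc n \<and> (\<exists>n>0. s < walk X n \<omega>)"
    then have "?N \<noteq> {}" by auto
    then have "Inf ?N \<in> ?N" by (rule Inf_nat_def1)
    moreover have "Inf ?N = Suc n" using l by (simp add: passage_time_def)
    moreover have "walk X k \<omega> \<le> s" if "k \<in> {1..n}" for k
    proof (rule ccontr)
      assume "\<not> walk X k \<omega> \<le> s"
      then have "k \<in> ?N" using that by auto
      then have "Inf ?N \<le> k" by (intro cInf_lower) auto
      then show False using \<open>Inf ?N = Suc n\<close> that by simp
    qed
    ultimately show "(\<forall>k\<in>{1..n}. walk X k \<omega> \<le> s) \<and> s < walk X (Suc n) \<omega>" by auto
  next
    assume r: "(\<forall>k\<in>{1..n}. walk X k \<omega> \<le> s) \<and> s < walk X (Suc n) \<omega>"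
    have "Inf ?N = Suc n"
    proof (rule cInf_eq_minimum)
      show "Suc n \<in> ?N" using r by simp
      show "Suc n \<le> m" if "m \<in> ?N" for m
      proof (rule ccontr)
        assume "\<not> Suc n \<le> m"
        then have "m \<in> {1..n}" using that by auto
        then have "walk X m \<omega> \<le> s" using r by blast
        then show False using that by simp
      qed
    qed
    then show "passage_time X s \<omega> = Suc n \<and> (\<exists>n>0. s < walk X n \<omega>)"
      using r by (auto simp: passage_time_def)
  qed
qed

definition exit_event :: "real \<Rightarrow> real \<Rightarrow> real \<Rightarrow> nat \<Rightarrow> 'a set" where
  "exit_event s w v n = {\<omega>\<in>space M. 0 \<le> killed_height s n \<omega> \<and> killed_height s n \<omega> < X (Suc n) \<omega>
      \<and> killed_height s n \<omega> \<le> w \<and> killed_height s n \<omega> \<le> v * X (Suc n) \<omega>}"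

lemma exit_event_measurable [measurable]: "exit_event s w v n \<in> events"
  unfolding exit_event_def by measurable

lemma exit_event_passage_time:
  assumes "0 \<le> s" "\<omega> \<in> exit_event s w v n"
  shows "passage_time X s \<omega> = Suc n" "\<exists>n>0. s < walk X n \<omega>"
  using passage_time_Suc[OF assms(1), of \<omega> n] assms(2) by (auto simp: exit_event_def)

text \<open>
  The passage time distinguishes the events for different \<open>n\<close>, so their probabilities
  add up. The predicate \<open>P\<close> serves to select a parity.
\<close>

lemma exit_event_sums:
  assumes s: "0 \<le> s"
  shows "(\<lambda>n. of_bool (P n) * (kill_op ^^ n) (exit_reward w v) s) sums
    prob {\<omega>\<in>space M. \<exists>n. P n \<and> \<omega> \<in> exit_event s w v n}"
proof -
  define A where "A n = (if P n then exit_event s w v n else {})" for n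
  have "disjoint_family A"
    unfolding disjoint_family_on_def
  proof (intro ballI impI)
    fix m n :: nat assume "m \<noteq> n"
    have "exit_event s w v m \<inter> exit_event s w v n = {}"
    proof (rule equals0I)
      fix \<omega> assume "\<omega> \<in> exit_event s w v m \<inter> exit_event s w v n"
      then have "Suc m = Suc n" using exit_event_passage_time(1)[OF s] by (metis IntD1 IntD2)
      then show False using \<open>m \<noteq> n\<close> by simp
    qed
    then show "A m \<inter> A n = {}" by (simp add: A_def)
  qed
  moreover have "range A \<subseteq> events" by (auto simp: A_def)
  ultimately have "(\<lambda>n. prob (A n)) sums prob (\<Union>n. A n)" by (intro finite_measure_UNION)
  moreover have "(\<Union>n. A n) = {\<omega>\<in>space M. \<exists>n. P n \<and> \<omega> \<in> exit_event s w v n}"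
    by (auto simp: A_def exit_event_def split: if_splits)
  moreover have "prob (A n) = of_bool (P n) * (kill_op ^^ n) (exit_reward w v) s" for n
    using prob_exit_step[OF s, of n w v] by (simp add: A_def exit_event_def)
  ultimately show ?thesis by simp
qed

text \<open>
  The exits with undershoot at most \<open>s\<close> already have probability tending to one.
\<close>

lemma passage_certain: "((\<lambda>s. prob {\<omega>\<in>space M. \<exists>n>0. s < walk X n \<omega>}) \<longlongrightarrow> 1) at_top"
proof (rule tendsto_sandwich)
  show "((\<lambda>s. green (exit_reward (s powr (1\<^sup>2)) 1) s) \<longlongrightarrow> 1) at_top"
    using green_exit_reward_limit[of 1 1] by simp
  show "eventually (\<lambda>s. green (exit_reward (s powr (1\<^sup>2)) 1) s \<le> prob {\<omega>\<in>space M. \<exists>n>0. s < walk X n \<omega>}) at_top"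
    using eventually_ge_at_top[of "0::real"]
  proof eventually_elim
    case (elim s)
    have "green (exit_reward (s powr (1\<^sup>2)) 1) s
        = prob {\<omega>\<in>space M. \<exists>n. True \<and> \<omega> \<in> exit_event s (s powr (1\<^sup>2)) 1 n}"
      using exit_event_sums[OF elim, of "\<lambda>_. True" "s powr (1\<^sup>2)" 1] by (simp add: green_def sums_iff)
    also have "\<dots> \<le> prob {\<omega>\<in>space M. \<exists>n>0. s < walk X n \<omega>}"
    proof (intro finite_measure_mono subsetI)
      fix \<omega> assume "\<omega> \<in> {\<omega>\<in>space M. \<exists>n. True \<and> \<omega> \<in> exit_event s (s powr (1\<^sup>2)) 1 n}"
      then show "\<omega> \<in> {\<omega>\<in>space M. \<exists>n>0. s < walk X n \<omega>}"
        using exit_event_passage_time(2)[OF elim] by blast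
    qed measurable
    finally show ?case .
  qed
qed (auto intro!: tendsto_const)

text \<open>
  On the event that the barrier is passed, the event of interest is the disjoint union of the exit
  events of one parity; since \<open>N = n + 1\<close>, an odd passage time corresponds to even
  \<open>n\<close>. The complement has vanishing probability.
\<close>

lemma exit_joint_limit:
  assumes t: "0 \<le> t" "t \<le> 1" and v: "0 \<le> v" "v \<le> 1" and j: "j \<in> {0, 1 :: nat}"
  shows "((\<lambda>s. prob {\<omega> \<in> space M.
            sqrt_log_ratio s (undershoot X s \<omega>) \<le> t
          \<and> undershoot X s \<omega> / (undershoot X s \<omega> + overshoot X s \<omega>) \<le> v
          \<and> (indicator {n. even n} (passage_time X s \<omega>) :: nat) = j})
        \<longlongrightarrow> 1 / 2 * t * v\<^sup>2) at_top"
proof -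
  define Q where "Q s \<omega> \<longleftrightarrow> sqrt_log_ratio s (undershoot X s \<omega>) \<le> t
          \<and> undershoot X s \<omega> / (undershoot X s \<omega> + overshoot X s \<omega>) \<le> v
          \<and> (indicator {n. even n} (passage_time X s \<omega>) :: nat) = j" for s \<omega>
  define C where "C s = {\<omega>\<in>space M. \<exists>n>0. s < walk X n \<omega>}" for s
  have C_m [measurable]: "C s \<in> events" for s unfolding C_def by measurable
  define main where "main s = prob {\<omega>\<in>space M. \<exists>n. (even n = (j = 0)) \<and> \<omega> \<in> exit_event s (s powr (t\<^sup>2)) v n}" for s
  have eq: "{\<omega>\<in>space M. Q s \<omega>} \<inter> C s = {\<omega>\<in>space M. \<exists>n. (even n = (j = 0)) \<and> \<omega> \<in> exit_event s (s powr (t\<^sup>2)) v n}"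
    if s: "1 < s" for s
  proof -
    have s0: "0 \<le> s" using s by simp
    have step: "Q s \<omega> \<longleftrightarrow> (even n = (j = 0)) \<and> killed_height s n \<omega> \<le> s powr (t\<^sup>2) \<and> killed_height s n \<omega> \<le> v * X (Suc n) \<omega>"
      if N: "passage_time X s \<omega> = Suc n" "\<exists>n>0. s < walk X n \<omega>" for n \<omega>
    proof -
      have H: "0 \<le> killed_height s n \<omega>" "killed_height s n \<omega> < X (Suc n) \<omega>"
        using passage_time_Suc[OF s0, of \<omega> n] N by auto
      have h: "killed_height s n \<omega> = s - walk X n \<omega>"
        using H(1) by (auto simp: killed_height_def split: if_splits)
      have U: "undershoot X s \<omega> = killed_height s n \<omega>" by (simp add: undershoot_def N h)
      have O: "undershoot X s \<omega> + overshoot X s \<omega> = X (Suc n) \<omega>"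
        by (simp add: undershoot_def overshoot_def N walk_def)
      have "sqrt_log_ratio s (killed_height s n \<omega>) \<le> t \<longleftrightarrow> killed_height s n \<omega> \<le> s powr (t\<^sup>2)"
        by (rule sqrt_log_ratio_le_iff[OF s H(1) t(1)])
      moreover have "killed_height s n \<omega> / X (Suc n) \<omega> \<le> v \<longleftrightarrow> killed_height s n \<omega> \<le> v * X (Suc n) \<omega>"
        using H by (intro pos_divide_le_eq) linarith
      moreover have "(indicator {n. even n} (passage_time X s \<omega>) :: nat) = j \<longleftrightarrow> (even n = (j = 0))"
        using j by (auto simp: N indicator_def)
      ultimately show ?thesis unfolding Q_def O unfolding U by (simp only:) blast
    qed
    show ?thesis
    proof (intro set_eqI iffI)
      fix \<omega> assume w: "\<omega> \<in> {\<omega>\<in>space M. Q s \<omega>} \<inter> C s"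
      then have ex: "\<exists>n>0. s < walk X n \<omega>" by (simp add: C_def)
      then have "{n. 0 < n \<and> s < walk X n \<omega>} \<noteq> {}" by auto
      then have "Inf {n. 0 < n \<and> s < walk X n \<omega>} \<in> {n. 0 < n \<and> s < walk X n \<omega>}" by (rule Inf_nat_def1)
      then have "0 < passage_time X s \<omega>" by (simp add: passage_time_def)
      then obtain n where N: "passage_time X s \<omega> = Suc n" by (cases "passage_time X s \<omega>") auto
      have "0 \<le> killed_height s n \<omega> \<and> killed_height s n \<omega> < X (Suc n) \<omega>"
        using passage_time_Suc[OF s0, of \<omega> n] N ex by auto
      then show "\<omega> \<in> {\<omega>\<in>space M. \<exists>n. (even n = (j = 0)) \<and> \<omega> \<in> exit_event s (s powr (t\<^sup>2)) v n}"
        using w step[OF N ex] by (auto simp: exit_event_def)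
    next
      fix \<omega> assume "\<omega> \<in> {\<omega>\<in>space M. \<exists>n. (even n = (j = 0)) \<and> \<omega> \<in> exit_event s (s powr (t\<^sup>2)) v n}"
      then obtain n where n: "even n = (j = 0)" "\<omega> \<in> exit_event s (s powr (t\<^sup>2)) v n" by blast
      note N = exit_event_passage_time[OF s0 n(2)]
      show "\<omega> \<in> {\<omega>\<in>space M. Q s \<omega>} \<inter> C s"
        using n N(2) step[OF N] by (auto simp: exit_event_def C_def)
    qed
  qed
  have junk: "{\<omega>\<in>space M. Q s \<omega>} - C s \<in> events" for s
  proof -
    \<comment> \<open>if the barrier is never passed, the passage time is the infimum of the empty set, the same number for all outcomes; this gives measurability\<close>
    define m where "m = Inf ({} :: nat set)"
    define U where "U \<omega> = s - walk X (m - 1) \<omega>" for \<omega>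
    have [measurable]: "U \<in> borel_measurable M" unfolding U_def[abs_def] by measurable
    have "passage_time X s \<omega> = m" if "\<omega> \<in> space M - C s" for \<omega>
    proof -
      have "{n. 0 < n \<and> s < walk X n \<omega>} = {}" using that by (auto simp: C_def)
      then show ?thesis unfolding passage_time_def m_def by (simp only:)
    qed
    then have "{\<omega>\<in>space M. Q s \<omega>} - C s = {\<omega>\<in>space M. sqrt_log_ratio s (U \<omega>) \<le> t
        \<and> U \<omega> / (U \<omega> + (walk X m \<omega> - s)) \<le> v \<and> (indicator {n. even n} m :: nat) = j} - C s"
      by (auto simp: Q_def undershoot_def overshoot_def U_def)
    also have "\<dots> \<in> events" unfolding sqrt_log_ratio_def by measurable
    finally show ?thesis .
  qed
  have lim: "(main \<longlongrightarrow> 1 / 2 * t * v\<^sup>2) at_top"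
  proof (rule Lim_transform_eventually[OF exit_reward_parity_limit[OF t v, of "j = 0"]])
    show "eventually (\<lambda>s. (\<Sum>n. of_bool (even n = (j = 0)) * (kill_op ^^ n) (exit_reward (s powr (t\<^sup>2)) v) s) = main s) at_top"
      using eventually_ge_at_top[of "0::real"]
    proof eventually_elim
      case (elim s)
      show ?case
        using exit_event_sums[OF elim, of "\<lambda>n. even n = (j = 0)" "s powr (t\<^sup>2)" v]
        unfolding main_def by (rule sums_unique[symmetric])
    qed
  qed
  have "((\<lambda>s. prob {\<omega>\<in>space M. Q s \<omega>} - main s) \<longlongrightarrow> 0) at_top"
  proof (rule Lim_null_comparison)
    show "((\<lambda>s. 1 - prob (C s)) \<longlongrightarrow> 0) at_top"
      using tendsto_diff[OF tendsto_const passage_certain, of 1] by (simp add: C_def)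
    show "eventually (\<lambda>s. norm (prob {\<omega>\<in>space M. Q s \<omega>} - main s) \<le> 1 - prob (C s)) at_top"
      using eventually_gt_at_top[of "1::real"]
    proof eventually_elim
      case (elim s)
      have e: "{\<omega>\<in>space M. Q s \<omega>} \<inter> C s \<in> events" unfolding eq[OF elim] by measurable
      have "prob {\<omega>\<in>space M. Q s \<omega>} = prob (({\<omega>\<in>space M. Q s \<omega>} \<inter> C s) \<union> ({\<omega>\<in>space M. Q s \<omega>} - C s))"
        by (rule arg_cong[where f = prob]) auto
      also have "\<dots> = main s + prob ({\<omega>\<in>space M. Q s \<omega>} - C s)"
        unfolding main_def eq[OF elim, symmetric] by (rule finite_measure_Union[OF e junk]) auto
      finally have "prob {\<omega>\<in>space M. Q s \<omega>} - main s = prob ({\<omega>\<in>space M. Q s \<omega>} - C s)" by simp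
      also have "\<dots> \<le> prob (space M - C s)" by (intro finite_measure_mono) auto
      also have "\<dots> = 1 - prob (C s)" by (rule prob_compl) measurable
      finally have "prob {\<omega>\<in>space M. Q s \<omega>} - main s \<le> 1 - prob (C s)" .
      then show ?case
        using \<open>prob {\<omega>\<in>space M. Q s \<omega>} - main s = prob ({\<omega>\<in>space M. Q s \<omega>} - C s)\<close> by simp
    qed
  qed
  from tendsto_add[OF this lim] show ?thesis by (simp add: Q_def)
qed

end

theorem theorem4p10:
  fixes M :: "'a measure" and \<Theta> :: "nat \<Rightarrow> 'a \<Rightarrow> real"
    and t v :: real and j :: nat
  assumes "prob_space M"
    and "prob_space.indep_vars M (\<lambda>_. borel) \<Theta> {1..}"
    and "\<And>n. n \<ge> 1 \<Longrightarrow> distributed M lborel (\<Theta> n) (\<lambda>\<theta>. ennreal (angle_density \<theta>))"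
    and "t \<in> {0..1}" and "v \<in> {0..1}" and "j \<in> {0, 1}"
  shows "((\<lambda>s. measure M {\<omega> \<in> space M.
            sqrt_log_ratio s (undershoot (tan_step \<Theta>) s \<omega>) \<le> t
          \<and> undershoot (tan_step \<Theta>) s \<omega>
              / (undershoot (tan_step \<Theta>) s \<omega> + overshoot (tan_step \<Theta>) s \<omega>) \<le> v
          \<and> (indicator {n. even n} (passage_time (tan_step \<Theta>) s \<omega>) :: nat) = j})
        \<longlongrightarrow> 1 / 2 * t * v\<^sup>2) at_top"
proof -
  interpret prob_space M by fact
  have [measurable]: "tan \<in> borel_measurable (borel :: real measure)"
    unfolding tan_def[abs_def] by measurable
  have tan_step: "tan_step \<Theta> = (\<lambda>n \<omega>. tan (\<Theta> n \<omega>))" by (simp add: tan_step_def fun_eq_iff)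
  interpret iid_walk M "tan_step \<Theta>"
  proof
    show "indep_vars (\<lambda>_. borel) (tan_step \<Theta>) {1..}"
      unfolding tan_step by (rule indep_vars_compose2[OF assms(2)]) measurable
    show "distr M borel (tan_step \<Theta> n) = step_law" if "1 \<le> n" for n
      unfolding tan_step by (rule tan_step_law[OF assms(3)[OF that]])
  qed
  show ?thesis using assms(4-6) by (intro exit_joint_limit) auto
qed

end
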